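(* Let $G$ be a connected semisimple Lie group and $\rho:G\to\mathrm{GL}_d(\mathbb{C})$ a representation (continuous homomorphism) of $G$. Then every $\rho(G)$-invariant subspace of $\mathbb{C}^d$ has a $\rho(G)$-invariant complement.
   Context: A (matrix) Lie group is a closed subgroup of $\mathrm{GL}_n(\mathbb{R})$ for some $n$. Its Lie algebra is $\mathcal{L}(G)=\{X\in\mathrm{M}_n(\mathbb{R}):\exp(tX)\in G\ \forall t\in\mathbb{R}\}$ with bracket $[X,Y]=XY-YX$. A connected Lie group $H$ is solvable if $\mathcal{L}(H)^{(k)}=0$ for some $k$, where $\mathfrak{g}^{(1)}=\langle[x,y]:x,y\in\mathfrak{g}\rangle$ and $\mathfrak{g}^{(k+1)}=\langle[x,y]:x,y\in\mathfrak{g}^{(k)}\rangle$. A connected Lie group is called semisimple if it contains no nontrivial normal closed connected solvable subgroups. *)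

theory Defs
  imports "HOL-Analysis.Analysis" "HOL-Algebra.Coset"
begin

definition GL :: "('a::field ^ 'n ^ 'n) monoid" where
  "GL = \<lparr>carrier = {A. invertible A}, mult = (**), one = mat 1\<rparr>"

lemma group_GL: "group (GL :: ('a::field ^ 'n ^ 'n) monoid)"
proof (rule groupI)
  fix x :: "'a ^ 'n ^ 'n" assume "x \<in> carrier GL"
  then obtain y where "x ** y = mat 1" "y ** x = mat 1"
    by (auto simp: GL_def invertible_def)
  then show "\<exists>y\<in>carrier GL. y \<otimes>\<^bsub>GL\<^esub> x = \<one>\<^bsub>GL\<^esub>"
    by (auto simp: GL_def invertible_def)
next
  fix x y :: "'a ^ 'n ^ 'n" assume "x \<in> carrier GL" "y \<in> carrier GL"
  then obtain x' y' where "x ** x' = mat 1" "x' ** x = mat 1" "y ** y' = mat 1" "y' ** y = mat 1"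
    by (auto simp: GL_def invertible_def)
  then have "x ** (y ** y') ** x' = mat 1" "y' ** (x' ** x) ** y = mat 1"
    by simp_all
  then have "(x ** y) ** (y' ** x') = mat 1" "(y' ** x') ** (x ** y) = mat 1"
    by (simp_all only: matrix_mul_assoc)
  then show "x \<otimes>\<^bsub>GL\<^esub> y \<in> carrier GL"
    by (auto simp: GL_def invertible_def)
qed (auto simp: GL_def matrix_mul_assoc invertible_def)

text \<open>The group structure on a subgroup of the general linear group is
  \<open>GL\<lparr>carrier := G\<rparr>\<close>. Closedness is relative to the general linear group,
  not to the space of all matrices.\<close>

definition matrix_lie_group :: "(real ^ 'n ^ 'n) set \<Rightarrow> bool" where
  "matrix_lie_group G \<longleftrightarrow>
     subgroup G GL \<and> closedin (top_of_set (carrier GL)) G"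

text \<open>The multiplication and power operations of the type class hierarchy are not
  matrix multiplication on \<open>real ^ 'n ^ 'n\<close>, so the matrix exponential is
  defined here by its power series.\<close>

primrec matrix_power :: "real ^ 'n ^ 'n \<Rightarrow> nat \<Rightarrow> real ^ 'n ^ 'n" where
  "matrix_power X 0 = mat 1"
| "matrix_power X (Suc k) = X ** matrix_power X k"

definition matrix_exp :: "real ^ 'n ^ 'n \<Rightarrow> real ^ 'n ^ 'n" where
  "matrix_exp X = (\<Sum>k. (1 / fact k) *\<^sub>R matrix_power X k)"

lemma summable_matrix_exp:
  fixes X :: "real ^ 'n ^ 'n"
  shows "summable (\<lambda>k. (1 / fact k) *\<^sub>R matrix_power X k)"
proof -
  have "bilinear ((**) :: real ^ 'n ^ 'n \<Rightarrow> real ^ 'n ^ 'n \<Rightarrow> real ^ 'n ^ 'n)"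
    by (auto simp: bilinear_def linear_iff matrix_matrix_mult_def vec_eq_iff
        algebra_simps sum.distrib sum_distrib_left)
  then have "bounded_bilinear ((**) :: real ^ 'n ^ 'n \<Rightarrow> real ^ 'n ^ 'n \<Rightarrow> real ^ 'n ^ 'n)"
    by (simp add: bilinear_conv_bounded_bilinear)
  from bounded_bilinear.pos_bounded[OF this]
  obtain K where K: "K > 0"
      "\<And>(x :: real ^ 'n ^ 'n) (y :: real ^ 'n ^ 'n). norm (x ** y) \<le> norm x * norm y * K"
    by blast
  let ?b = "norm X * K" and ?c = "norm (mat 1 :: real ^ 'n ^ 'n)"
  have le: "norm (matrix_power X k) \<le> ?b ^ k * ?c" for k
  proof (induction k)
    case (Suc k)
    have "norm (matrix_power X (Suc k)) \<le> norm X * norm (matrix_power X k) * K"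
      unfolding matrix_power.simps by (rule K(2))
    also have "\<dots> = ?b * norm (matrix_power X k)"
      by (simp only: mult_ac)
    also have "\<dots> \<le> ?b * (?b ^ k * ?c)"
      by (rule mult_left_mono[OF Suc]) (use K(1) in simp)
    also have "\<dots> = ?b ^ Suc k * ?c"
      by (simp only: power_Suc mult.assoc)
    finally show ?case .
  qed simp
  have "summable (\<lambda>k. inverse (fact k) * ?b ^ k * ?c)"
    by (intro summable_mult2 summable_exp)
  moreover have "norm ((1 / fact k) *\<^sub>R matrix_power X k) \<le> inverse (fact k) * ?b ^ k * ?c" for k
  proof -
    have "norm ((1 / fact k) *\<^sub>R matrix_power X k) = inverse (fact k) * norm (matrix_power X k)"
      by (simp add: inverse_eq_divide)
    also have "\<dots> \<le> inverse (fact k) * (?b ^ k * ?c)"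
      by (rule mult_left_mono[OF le]) simp
    finally show ?thesis by (simp only: mult.assoc)
  qed
  ultimately show ?thesis
    by (rule summable_comparison_test'[where N = 0])
qed

definition lie_algebra :: "(real ^ 'n ^ 'n) set \<Rightarrow> (real ^ 'n ^ 'n) set" where
  "lie_algebra G = {X. \<forall>t::real. matrix_exp (t *\<^sub>R X) \<in> G}"

definition lie_bracket :: "real ^ 'n ^ 'n \<Rightarrow> real ^ 'n ^ 'n \<Rightarrow> real ^ 'n ^ 'n" where
  "lie_bracket X Y = X ** Y - Y ** X"

definition derived_algebra :: "(real ^ 'n ^ 'n) set \<Rightarrow> (real ^ 'n ^ 'n) set" where
  "derived_algebra g = span {lie_bracket x y |x y. x \<in> g \<and> y \<in> g}"

text \<open>The next two predicates are meant for connected Lie groups only. The subgroups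
  \<open>H\<close> below are closed in \<open>G\<close>, hence Lie groups whenever \<open>G\<close> is.\<close>

definition solvable_lie_group :: "(real ^ 'n ^ 'n) set \<Rightarrow> bool" where
  "solvable_lie_group H \<longleftrightarrow>
     (\<exists>k\<ge>1. (derived_algebra ^^ k) (lie_algebra H) = {0})"

definition semisimple_lie_group :: "(real ^ 'n ^ 'n) set \<Rightarrow> bool" where
  "semisimple_lie_group G \<longleftrightarrow>
     (\<forall>H. H \<lhd> GL\<lparr>carrier := G\<rparr> \<and> closedin (top_of_set G) H \<and> connected H \<and>
          solvable_lie_group H \<longrightarrow> H = {mat 1})"

definition lie_representation ::
    "(real ^ 'n ^ 'n) set \<Rightarrow> (real ^ 'n ^ 'n \<Rightarrow> complex ^ 'd ^ 'd) \<Rightarrow> bool" where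
  "lie_representation G \<rho> \<longleftrightarrow> \<rho> \<in> hom (GL\<lparr>carrier := G\<rparr>) GL \<and> continuous_on G \<rho>"

definition invariant_subspace ::
    "(real ^ 'n ^ 'n) set \<Rightarrow> (real ^ 'n ^ 'n \<Rightarrow> complex ^ 'd ^ 'd) \<Rightarrow>
     (complex ^ 'd) set \<Rightarrow> bool" where
  "invariant_subspace G \<rho> W \<longleftrightarrow>
     vec.subspace W \<and> (\<forall>g\<in>G. \<forall>w\<in>W. \<rho> g *v w \<in> W)"

definition complementary :: "(complex ^ 'd) set \<Rightarrow> (complex ^ 'd) set \<Rightarrow> bool" where
  "complementary U W \<longleftrightarrow> U \<inter> W = {0} \<and> (\<forall>v. \<exists>u\<in>U. \<exists>w\<in>W. v = u + w)"

end

theory Submission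
  imports Defs "Jordan_Normal_Form.Jordan_Normal_Form_Existence"
begin

text \<open>
  Why the theorem holds. A projection \<open>p\<close> of \<open>\<complex>\<^sup>d\<close> onto the invariant subspace \<open>W\<close> that
  commutes with the group has an invariant kernel, which is then the desired complement. An arbitrary
  linear projection \<open>p\<close> onto \<open>W\<close> fails to commute with the infinitesimal action by \<open>X \<mapsto> [X, p]\<close>. This is
  a 1-cocycle of the Lie algebra with values in the maps that send \<open>\<complex>\<^sup>d\<close> into \<open>W\<close> and \<open>W\<close> to \<open>0\<close>. If it
  is a coboundary, say \<open>[X, p] = [X, m]\<close> for such a map \<open>m\<close>, then \<open>p - m\<close> is still a projection onto
  \<open>W\<close> and commutes with everything. So it suffices to pass from the group to a Lie algebra without
  abelian ideals, and to show that the first cohomology of such an algebra vanishes.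

  From the group to the Lie algebra. Instead of differentiating the representation, the group is replaced
  by the graph of \<open>\<rho>\<close>, a closed connected group of block-diagonal endomorphisms of \<open>\<real>\<^sup>n \<times> \<complex>\<^sup>d\<close>, on which
  the representation is the restriction of the linear map \<open>block2\<close>. A limit argument
  (\<open>lie_limit\<close>) shows that \<open>lie\<close> of a closed group is a Lie algebra, and that the exponentials of this
  algebra generate a dense subgroup of a connected group (\<open>subgroup_containing_exp_lie\<close>). Hence what is
  invariant under the algebra is invariant under the group. The closure of the exponentials of an abelian
  ideal is a closed connected abelian normal subgroup, and such a subgroup is trivial in a semisimple group
  (\<open>abelian_ideal_trivial\<close>).

  Cohomology. The main input is Cartan's criterion in the form \<open>cartan_perfect\<close>: a perfect Lie algebra
  of endomorphisms with vanishing trace form is zero. It combines Engel's theorem with the operator that has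
  the same generalized eigenspaces as \<open>x\<close> and the conjugate eigenvalues (\<open>conjugate_part\<close>). Without abelian
  ideals the trace form is therefore nondegenerate on every ideal, every ideal has a complementary ideal, and
  every ideal is perfect. For a representation \<open>\<tau>\<close> the form \<open>tr (\<tau> x * \<tau> y)\<close> is nondegenerate on a
  complement of the kernel. Its Casimir operator \<open>C\<close> commutes with \<open>\<tau>\<close> and turns every cocycle \<open>f\<close> into
  the coboundary \<open>C f\<close>. Unless \<open>\<tau>\<close> is trivial, the trace of \<open>C\<close> is positive, so \<open>C\<close> is invertible on a nonzero invariant
  summand, the cocycle is a coboundary there, and induction handles the rest
  (\<open>cocycle_is_coboundary\<close>).
\<close>

no_notation vec_index (infixl "$" 100)
no_notation scalar_prod (infix "\<bullet>" 70)
hide_const (open) VectorSpace.subspace Matrix.vec Matrix.mat Matrix.row Matrix.col Determinant.det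
hide_type (open) Matrix.vec Matrix.mat

section \<open>The Banach algebra of endomorphisms\<close>

text \<open>
  A copy of the bounded linear endomorphisms with composition as multiplication, so that powers, the exponential
  and the ring laws of Banach algebras apply to them.
\<close>

typedef (overloaded) 'a endo = "UNIV :: ('a::real_normed_vector \<Rightarrow>\<^sub>L 'a) set"
  morphisms blinfun_of_endo Endo ..

setup_lifting type_definition_endo

lift_definition app :: "'a::real_normed_vector endo \<Rightarrow> 'a \<Rightarrow> 'a" is blinfun_apply .

instantiation endo :: (real_normed_vector) real_vector
begin
lift_definition zero_endo :: "'a endo" is 0 .
lift_definition plus_endo :: "'a endo \<Rightarrow> 'a endo \<Rightarrow> 'a endo" is "(+)" .
lift_definition minus_endo :: "'a endo \<Rightarrow> 'a endo \<Rightarrow> 'a endo" is "(-)" .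
lift_definition uminus_endo :: "'a endo \<Rightarrow> 'a endo" is uminus .
lift_definition scaleR_endo :: "real \<Rightarrow> 'a endo \<Rightarrow> 'a endo" is scaleR .
instance
  by standard (transfer; simp add: algebra_simps scaleR_add_left scaleR_add_right)+
end

instantiation endo :: (real_normed_vector) real_normed_vector
begin
lift_definition norm_endo :: "'a endo \<Rightarrow> real" is norm .
definition dist_endo :: "'a endo \<Rightarrow> 'a endo \<Rightarrow> real" where "dist_endo f g = norm (f - g)"
definition sgn_endo :: "'a endo \<Rightarrow> 'a endo" where "sgn_endo f = f /\<^sub>R norm f"
definition uniformity_endo :: "('a endo \<times> 'a endo) filter"
  where "uniformity_endo = (INF e\<in>{0<..}. principal {(x, y). dist x y < e})"
definition open_endo :: "'a endo set \<Rightarrow> bool"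
  where "open_endo S = (\<forall>x\<in>S. \<forall>\<^sub>F (x', y) in uniformity. x' = x \<longrightarrow> y \<in> S)"
instance
  apply standard
        apply (simp_all add: dist_endo_def sgn_endo_def uniformity_endo_def open_endo_def)
    apply (transfer; simp add: norm_triangle_ineq)+
  done
end

instantiation endo :: ("{real_normed_vector,perfect_space}") real_normed_algebra_1
begin
lift_definition one_endo :: "'a endo" is id_blinfun .
lift_definition times_endo :: "'a endo \<Rightarrow> 'a endo \<Rightarrow> 'a endo" is "(o\<^sub>L)" .
instance
proof
  fix a b c :: "'a endo" and r :: real
  show "a * b * c = a * (b * c)" by transfer (rule blinfun_eqI, simp)
  show "1 * a = a" by transfer (rule blinfun_eqI, simp)
  show "a * 1 = a" by transfer (rule blinfun_eqI, simp)
  show "(a + b) * c = a * c + b * c" by transfer (rule blinfun_eqI, simp add: blinfun.bilinear_simps)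
  show "a * (b + c) = a * b + a * c" by transfer (rule blinfun_eqI, simp add: blinfun.bilinear_simps)
  show "r *\<^sub>R a * b = r *\<^sub>R (a * b)" by transfer (rule blinfun_eqI, simp add: blinfun.bilinear_simps)
  show "a * r *\<^sub>R b = r *\<^sub>R (a * b)" by transfer (rule blinfun_eqI, simp add: blinfun.bilinear_simps)
  show "norm (1 :: 'a endo) = 1" by transfer simp
  then show "(0::'a endo) \<noteq> 1" by (metis norm_zero zero_neq_one)
  show "norm (a * b) \<le> norm a * norm b" by transfer (rule norm_blinfun_compose)
qed
end

lemma isometry_blinfun_of_endo: "dist (blinfun_of_endo x) (blinfun_of_endo y) = dist x y"
  by (simp add: dist_endo_def dist_norm norm_endo.rep_eq minus_endo.rep_eq)

instance endo :: ("{banach,perfect_space}") banach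
proof
  fix X :: "nat \<Rightarrow> 'a endo" assume "Cauchy X"
  then have "Cauchy (\<lambda>n. blinfun_of_endo (X n))"
    by (simp add: Cauchy_def isometry_blinfun_of_endo)
  then obtain L where "(\<lambda>n. blinfun_of_endo (X n)) \<longlonglongrightarrow> L"
    by (auto simp: Cauchy_convergent_iff convergent_def)
  then have "X \<longlonglongrightarrow> Endo L"
    by (simp add: lim_sequentially isometry_blinfun_of_endo[symmetric] Endo_inverse)
  then show "convergent X" by (auto simp: convergent_def)
qed

instance endo :: (euclidean_space) heine_borel
proof
  fix f :: "nat \<Rightarrow> 'a endo" assume "bounded (range f)"
  then obtain K where "\<And>n. norm (f n) \<le> K" by (auto simp: bounded_iff)
  then have "bounded (range (\<lambda>n. blinfun_of_endo (f n)))"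
    by (auto simp: bounded_iff norm_endo.rep_eq)
  from bounded_imp_convergent_subsequence[OF this] obtain l r where
    lr: "strict_mono r" "((\<lambda>n. blinfun_of_endo (f n)) \<circ> r) \<longlonglongrightarrow> l" by blast
  then have "(f \<circ> r) \<longlonglongrightarrow> Endo l"
    by (simp add: lim_sequentially isometry_blinfun_of_endo[symmetric] Endo_inverse o_def)
  with lr(1) show "\<exists>l r. strict_mono (r::nat\<Rightarrow>nat) \<and> (f \<circ> r) \<longlonglongrightarrow> l" by blast
qed

lemma endo_eqI: "(\<And>v. app f v = app g v) \<Longrightarrow> f = g"
  by transfer (rule blinfun_eqI)

lemma bounded_bilinear_app: "bounded_bilinear app"
proof
  show "\<exists>K. \<forall>(a::'a endo) b. norm (app a b) \<le> norm a * norm b * K"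
    by (rule exI[of _ 1]) (transfer; simp add: norm_blinfun)
qed (transfer; simp add: blinfun.bilinear_simps)+

lemma linear_app: "linear (app f)"
  using bounded_bilinear.bounded_linear_right[OF bounded_bilinear_app] bounded_linear.linear by blast

lemma app_simps [simp]:
  "app 0 v = 0" "app f 0 = 0"
  "app (f + g) v = app f v + app g v" "app (f - g) v = app f v - app g v" "app (- f) v = - app f v"
  "app (r *\<^sub>R f) v = r *\<^sub>R app f v"
  "app f (v + w) = app f v + app f w" "app f (v - w) = app f v - app f w" "app f (- v) = - app f v"
  "app f (r *\<^sub>R v) = r *\<^sub>R app f v"
  by (transfer; simp add: blinfun.bilinear_simps)+

lemma app_mult [simp]: "app (f * g) v = app f (app g v)" and app_one [simp]: "app 1 v = v"
  by (transfer; simp)+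

lemma app_sum: "app (\<Sum>i\<in>A. f i) v = (\<Sum>i\<in>A. app (f i) v)"
  by (induction A rule: infinite_finite_induct) auto

lemma app_sum_right: "app f (\<Sum>i\<in>A. v i) = (\<Sum>i\<in>A. app f (v i))"
  by (induction A rule: infinite_finite_induct) auto

definition endo :: "('a::real_normed_vector \<Rightarrow> 'a) \<Rightarrow> 'a endo" where
  "endo f = Endo (Blinfun f)"

lemma app_endo: "bounded_linear f \<Longrightarrow> app (endo f) = f"
  by (simp add: endo_def app.rep_eq Endo_inverse bounded_linear_Blinfun_apply)

lemma app_endo_linear: "linear f \<Longrightarrow> app (endo (f :: 'a::euclidean_space \<Rightarrow> 'a)) = f"
  by (simp add: app_endo linear_conv_bounded_linear)

section \<open>Exponentials, closed subgroups and their Lie algebras\<close>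

text \<open>
  The power condition is asked only along the powers of \<open>x\<close>, so that the lemma covers unital homomorphisms
  and also the antihomomorphism of right multiplication.
\<close>

lemma hom_exp:
  fixes \<Phi> :: "'a::{real_normed_algebra_1,banach} \<Rightarrow> 'b::{real_normed_algebra_1,banach}"
  assumes "bounded_linear \<Phi>" "\<Phi> 1 = 1" "\<And>n. \<Phi> (x ^ n) = \<Phi> x ^ n"
  shows "\<Phi> (exp x) = exp (\<Phi> x)"
proof -
  interpret bounded_linear \<Phi> by fact
  have "\<Phi> (exp x) = (\<Sum>n. \<Phi> (x ^ n /\<^sub>R fact n))"
    unfolding exp_def by (rule suminf[OF summable_exp_generic])
  also have "\<dots> = exp (\<Phi> x)"
    by (simp add: scale assms(3) exp_def)
  finally show ?thesis .
qed

lemma exp_conj: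
  fixes x :: "'a::{real_normed_algebra_1,banach}"
  assumes "g * h = 1" "h * g = 1"
  shows "g * exp x * h = exp (g * x * h)"
proof (rule hom_exp[where \<Phi> = "\<lambda>x. g * x * h"])
  show "bounded_linear (\<lambda>x. g * x * h)"
    by (intro bounded_linear_const_mult bounded_linear_mult_const bounded_linear_ident)
  show "g * 1 * h = 1" using assms by simp
  show "g * x ^ n * h = (g * x * h) ^ n" for n
  proof (induction n)
    case (Suc n)
    have "g * x ^ Suc n * h = g * x * (h * g) * x ^ n * h" using assms by (simp add: mult.assoc)
    also have "\<dots> = (g * x * h) * (g * x ^ n * h)" by (simp only: mult.assoc)
    finally show ?case using Suc by simp
  qed (use assms in simp)
qed

text \<open>
  The partial sums of the exponential series, applied to \<open>v\<close>, stay in the subspace.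
\<close>

lemma subspace_exp:
  fixes T :: "'v::{banach,perfect_space} endo"
  assumes "closed a" "subspace a" "\<And>v. v \<in> a \<Longrightarrow> app T v \<in> a" "v \<in> a"
  shows "app (exp T) v \<in> a"
proof -
  have bl: "bounded_linear (\<lambda>f. app f v)"
    by (rule bounded_bilinear.bounded_linear_left[OF bounded_bilinear_app])
  have "(\<lambda>n. app (T ^ n /\<^sub>R fact n) v) sums app (exp T) v"
    using bounded_linear.sums[OF bl exp_converges] .
  moreover have "app (T ^ n) v \<in> a" for n
    by (induction n) (auto simp: assms)
  then have "app (T ^ n /\<^sub>R fact n) v \<in> a" for n
    by (simp add: assms subspace_scale)
  then have "(\<Sum>i<n. app (T ^ i /\<^sub>R fact i) v) \<in> a" for n
    by (intro subspace_sum assms)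
  ultimately show ?thesis
    unfolding sums_def by (rule closed_sequentially[OF assms(1), rotated])
qed


text \<open>
  Conjugation by \<open>exp X\<close> is the exponential of the commutator with \<open>X\<close>, an endomorphism of the algebra
  itself: left multiplication by \<open>X\<close> and right multiplication by \<open>- X\<close> commute, so the exponential of
  their sum is the product of their exponentials. This reduces the claim to \<open>subspace_exp\<close>.
\<close>

lemma exp_ad:
  fixes X :: "'a::{real_normed_algebra_1,banach}"
  assumes "closed a" "subspace a" "\<And>v. v \<in> a \<Longrightarrow> X * v - v * X \<in> a" "v \<in> a"
  shows "exp X * v * exp (- X) \<in> a"
proof -
  define L where "L x = endo (\<lambda>v::'a. x * v)" for x
  define R where "R x = endo (\<lambda>v::'a. v * x)" for x
  have L: "app (L x) v = x * v" and R: "app (R x) v = v * x" for x v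
    by (simp_all add: L_def R_def app_endo bounded_linear_mult_right bounded_linear_mult_left)
  have powL: "L (x ^ n) = L x ^ n" for x n
  proof (induction n)
    case (Suc n)
    show ?case
      by (rule endo_eqI) (simp only: L app_mult power_Suc Suc[symmetric] mult.assoc)
  qed (rule endo_eqI, simp add: L)
  have powR: "R (x ^ n) = R x ^ n" for x n
  proof (induction n)
    case (Suc n)
    show ?case
      by (rule endo_eqI) (simp add: R Suc[symmetric] mult.assoc power_commutes)
  qed (rule endo_eqI, simp add: R)
  have norm_endo_le: "norm f \<le> b" if "\<And>v. norm (app f v) \<le> b * norm v" "0 \<le> b" for f :: "'a endo" and b
    using that by transfer (simp add: norm_blinfun_bound)
  have "bounded_linear L"
  proof (rule bounded_linear_intro[where K = 1])
    fix x y r show "L (x + y) = L x + L y" "L (r *\<^sub>R x) = r *\<^sub>R L x"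
      by (rule endo_eqI, simp add: L distrib_right)+
    show "norm (L x) \<le> norm x * 1" by (rule norm_endo_le) (simp_all add: L norm_mult_ineq)
  qed
  then have eL: "L (exp x) = exp (L x)" for x
    by (rule hom_exp[OF _ _ powL]) (rule endo_eqI, simp add: L)
  have "bounded_linear R"
  proof (rule bounded_linear_intro[where K = 1])
    fix x y r show "R (x + y) = R x + R y" "R (r *\<^sub>R x) = r *\<^sub>R R x"
      by (rule endo_eqI, simp add: R distrib_left)+
    show "norm (R x) \<le> norm x * 1"
      by (rule norm_endo_le) (simp_all add: R, metis mult.commute norm_mult_ineq)
  qed
  then have eR: "R (exp x) = exp (R x)" for x
    by (rule hom_exp[OF _ _ powR]) (rule endo_eqI, simp add: R)
  have "L X * R (- X) = R (- X) * L X"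
    by (rule endo_eqI) (simp add: L R mult.assoc)
  then have "exp (L X + R (- X)) = L (exp X) * R (exp (- X))"
    unfolding eL eR by (rule exp_add_commuting)
  then have "exp X * v * exp (- X) = app (exp (L X + R (- X))) v"
    by (simp add: L R mult.assoc)
  also have "\<dots> \<in> a"
    by (rule subspace_exp[OF assms(1,2) _ assms(4)]) (use assms(3) in \<open>simp add: L R\<close>)
  finally show ?thesis .
qed

lemma power_diff_bound:
  fixes a b :: "'a::real_normed_algebra_1"
  assumes "norm a \<le> c" "norm b \<le> c" "1 \<le> c"
  shows "norm (a ^ k - b ^ k) \<le> real k * c ^ k * norm (a - b)"
proof (induction k)
  case (Suc k)
  have "a ^ Suc k - b ^ Suc k = a * (a ^ k - b ^ k) + (a - b) * b ^ k"
    by (simp add: algebra_simps)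
  also have "norm \<dots> \<le> norm a * norm (a ^ k - b ^ k) + norm (a - b) * norm (b ^ k)"
    by (intro norm_triangle_le add_mono norm_mult_ineq)
  also have "\<dots> \<le> c * (real k * c ^ k * norm (a - b)) + norm (a - b) * c ^ Suc k"
  proof (intro add_mono mult_mono Suc assms)
    have "norm (b ^ k) \<le> c ^ k"
      using norm_power_ineq[of b k] power_mono[OF assms(2), of k] by simp
    also have "\<dots> \<le> c ^ Suc k" using assms(3) by (simp add: mult_le_cancel_right1)
    finally show "norm (b ^ k) \<le> c ^ Suc k" .
  qed (use assms in auto)
  also have "\<dots> = real (Suc k) * c ^ Suc k * norm (a - b)" by (simp add: algebra_simps)
  finally show ?case .
qed simp

lemma difference_quotient_tendsto:
  assumes "(f has_vector_derivative d) (at 0)"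
  shows "((\<lambda>t. (f t - f 0) /\<^sub>R t) \<longlongrightarrow> d) (at 0)"
proof -
  have "((\<lambda>t. norm (f (0 + t) - f 0 - t *\<^sub>R d) / norm t) \<longlongrightarrow> 0) (at 0)"
    using assms unfolding has_vector_derivative_def has_derivative_at by simp
  then have "((\<lambda>t. norm ((f t - f 0) /\<^sub>R t - d)) \<longlongrightarrow> 0) (at 0)"
  proof (rule Lim_transform_eventually)
    show "\<forall>\<^sub>F t in at 0. norm (f (0 + t) - f 0 - t *\<^sub>R d) / norm t = norm ((f t - f 0) /\<^sub>R t - d)"
    proof (rule eventually_at_filter[THEN iffD2], rule always_eventually, intro allI impI)
      fix t :: real assume "t \<noteq> 0"
      then have "(f t - f 0) /\<^sub>R t - d = (f (0 + t) - f 0 - t *\<^sub>R d) /\<^sub>R t"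
        by (simp add: scaleR_diff_right)
      then show "norm (f (0 + t) - f 0 - t *\<^sub>R d) / norm t = norm ((f t - f 0) /\<^sub>R t - d)"
        by (simp add: divide_inverse mult.commute)
    qed
  qed
  then show ?thesis using tendsto_norm_zero_iff LIM_zero_iff by blast
qed

lemma exp_has_vector_derivative_0:
  fixes X :: "'a::{real_normed_algebra_1,banach}"
  shows "((\<lambda>t. exp (t *\<^sub>R X)) has_vector_derivative X) (at 0)"
  using exp_scaleR_has_vector_derivative_right[of X 0 UNIV] by simp

lemma exp_lipschitz:
  fixes a b :: "'a::{real_normed_algebra_1,banach}"
  assumes "norm a \<le> c" "norm b \<le> c" "1 \<le> c"
  shows "norm (exp a - exp b) \<le> exp (2 * c) * norm (a - b)"
proof -
  have le: "norm ((a ^ n - b ^ n) /\<^sub>R fact n) \<le> ((2 * c) ^ n /\<^sub>R fact n) * norm (a - b)" for n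
  proof -
    have "real n * c ^ n * norm (a - b) \<le> 2 ^ n * c ^ n * norm (a - b)"
      using assms(3) by (intro mult_right_mono) (auto simp: less_imp_le)
    with power_diff_bound[OF assms, of n]
    have "norm (a ^ n - b ^ n) \<le> (2 * c) ^ n * norm (a - b)"
      by (simp add: power_mult_distrib)
    then show ?thesis by (simp add: divide_simps)
  qed
  have "exp a - exp b = (\<Sum>n. (a ^ n - b ^ n) /\<^sub>R fact n)"
    unfolding exp_def by (simp add: suminf_diff summable_exp_generic scaleR_diff_right)
  also have "norm \<dots> \<le> (\<Sum>n. ((2 * c) ^ n /\<^sub>R fact n) * norm (a - b))"
    by (intro norm_suminf_le le summable_mult2 summable_exp_generic)
  also have "\<dots> = exp (2 * c) * norm (a - b)"
    unfolding exp_def by (intro suminf_mult2[symmetric] summable_exp_generic)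
  finally show ?thesis .
qed

lemma tendsto_exp_algebra:
  fixes f :: "_ \<Rightarrow> 'a::{real_normed_algebra_1,banach}"
  assumes "(f \<longlongrightarrow> l) F"
  shows "((\<lambda>x. exp (f x)) \<longlongrightarrow> exp l) F"
proof -
  have "\<forall>\<^sub>F x in F. norm (f x) < norm l + 1"
    by (rule order_tendstoD[OF tendsto_norm[OF assms]]) simp
  then have "\<forall>\<^sub>F x in F. norm (exp (f x) - exp l) \<le> exp (2 * (norm l + 1)) * norm (f x - l)"
    by eventually_elim (rule exp_lipschitz; simp)
  moreover have "((\<lambda>x. exp (2 * (norm l + 1)) * norm (f x - l)) \<longlongrightarrow> 0) F"
    by (intro tendsto_mult_right_zero tendsto_norm_zero LIM_zero assms)
  ultimately have "((\<lambda>x. exp (f x) - exp l) \<longlongrightarrow> 0) F"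
    by (rule Lim_null_comparison)
  then show ?thesis by (simp add: LIM_zero_iff)
qed

lemma exp_power:
  fixes X :: "'a::{real_normed_algebra_1,banach}"
  shows "exp X ^ k = exp (real k *\<^sub>R X)"
proof (induction k)
  case (Suc k)
  have "exp (X + real k *\<^sub>R X) = exp X * exp (real k *\<^sub>R X)"
    by (rule exp_add_commuting) simp
  then show ?case by (simp add: Suc algebra_simps)
qed simp

text \<open>
  The noncommutative version of the compound interest limit. Both factors are compared with the exact
  \<open>k\<close>-th root \<open>exp (z / k)\<close>: by telescoping, the \<open>k\<close>-th powers differ by at most \<open>k\<close> times a bounded
  factor times the difference of the bases, and this difference is \<open>o(1 / k)\<close>.
\<close>

lemma power_limit_exp:
  fixes z :: "'a::{real_normed_algebra_1,banach}"
  assumes Z: "Z \<longlonglongrightarrow> z" and k: "filterlim k at_top sequentially"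
  shows "(\<lambda>n. (1 + Z n /\<^sub>R real (k n)) ^ k n) \<longlonglongrightarrow> exp z"
proof -
  define t where "t n = inverse (real (k n))" for n
  \<comment> \<open>An eventual bound for \<open>Z n\<close>; with it both bases have norm at most \<open>exp (M / k)\<close>.\<close>
  define M where "M = norm z + 1"
  have t0: "t \<longlonglongrightarrow> 0" unfolding t_def
    by (intro tendsto_inverse_0_at_top filterlim_compose[OF filterlim_real_sequentially k])
  have kpos: "\<forall>\<^sub>F n in sequentially. k n \<ge> 1"
    using k by (simp add: filterlim_at_top)
  then have "filterlim t (at 0) sequentially"
    using t0 by (auto simp: filterlim_at t_def elim!: eventually_mono)
  from filterlim_compose[OF difference_quotient_tendsto[OF exp_has_vector_derivative_0[of z]] this]
  have "(\<lambda>n. (exp (t n *\<^sub>R z) - 1) /\<^sub>R t n) \<longlonglongrightarrow> z" by simp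
  from tendsto_norm[OF tendsto_diff[OF Z this]]
  have "(\<lambda>n. norm (Z n - (exp (t n *\<^sub>R z) - 1) /\<^sub>R t n)) \<longlonglongrightarrow> 0" by simp
  then have lim: "(\<lambda>n. exp M * norm (Z n - (exp (t n *\<^sub>R z) - 1) /\<^sub>R t n)) \<longlonglongrightarrow> 0"
    by (rule tendsto_mult_right_zero)
  have "\<forall>\<^sub>F n in sequentially. norm (Z n) < M"
    by (rule order_tendstoD[OF tendsto_norm[OF Z]]) (simp add: M_def)
  with kpos have "\<forall>\<^sub>F n in sequentially. norm ((1 + Z n /\<^sub>R real (k n)) ^ k n - exp z)
      \<le> exp M * norm (Z n - (exp (t n *\<^sub>R z) - 1) /\<^sub>R t n)"
  proof eventually_elim
    case (elim n)
    have tp: "t n > 0" "t n \<le> 1" "real (k n) * t n = 1" "1 / real (k n) = t n"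
      using elim by (auto simp: t_def divide_simps)
    have kM: "exp (t n * M) ^ k n = exp M"
      using tp by (simp add: exp_power flip: mult.assoc)
    have kz: "exp (t n *\<^sub>R z) ^ k n = exp z"
      using tp by (simp add: exp_power)
    have "norm (1 + t n *\<^sub>R Z n) \<le> 1 + t n * M"
      using elim tp by (intro norm_triangle_le) auto
    also have "\<dots> \<le> exp (t n * M)" by (rule exp_ge_add_one_self)
    finally have 1: "norm (1 + t n *\<^sub>R Z n) \<le> exp (t n * M)" .
    have 2: "norm (exp (t n *\<^sub>R z)) \<le> exp (t n * M)"
      using norm_exp[of "t n *\<^sub>R z"] tp by (simp add: M_def) (smt (verit) exp_le_cancel_iff mult_left_mono)
    have 3: "1 \<le> exp (t n * M)" using tp by (simp add: M_def)
    have "norm ((1 + t n *\<^sub>R Z n) ^ k n - exp z)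
        \<le> real (k n) * exp M * norm (1 + t n *\<^sub>R Z n - exp (t n *\<^sub>R z))"
      using power_diff_bound[OF 1 2 3, of "k n"] by (simp add: kM kz)
    also have "\<dots> = exp M * norm (real (k n) *\<^sub>R (1 + t n *\<^sub>R Z n - exp (t n *\<^sub>R z)))"
      by simp
    also have "real (k n) *\<^sub>R (1 + t n *\<^sub>R Z n - exp (t n *\<^sub>R z)) = Z n - (exp (t n *\<^sub>R z) - 1) /\<^sub>R t n"
      using tp by (simp add: algebra_simps) (simp add: t_def)
    finally show ?case by (simp add: t_def)
  qed
  from Lim_null_comparison[OF this lim] show ?thesis
    using LIM_zero_iff by blast
qed

definition lie :: "'a::{real_normed_algebra_1,banach} set \<Rightarrow> 'a set" where
  "lie G = {X. \<forall>t::real. exp (t *\<^sub>R X) \<in> G}"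

text \<open>
  Closedness is relative to the units, as for matrix groups, which are closed in the general linear group but
  not among all matrices.
\<close>

locale closed_subgroup =
  fixes G :: "'a::{real_normed_algebra_1,banach} set"
  assumes one: "1 \<in> G"
    and mult: "g \<in> G \<Longrightarrow> h \<in> G \<Longrightarrow> g * h \<in> G"
    and inv: "g \<in> G \<Longrightarrow> \<exists>h\<in>G. g * h = 1 \<and> h * g = 1"
    and closed: "(\<And>n. f n \<in> G) \<Longrightarrow> f \<longlonglongrightarrow> a \<Longrightarrow> a * b = 1 \<Longrightarrow> b * a = 1 \<Longrightarrow> a \<in> G"
begin

lemma power_closed: "g \<in> G \<Longrightarrow> g ^ n \<in> G"
  by (induction n) (auto simp: one mult)

lemma closed_exp: "(\<And>n. f n \<in> G) \<Longrightarrow> f \<longlonglongrightarrow> exp X \<Longrightarrow> exp X \<in> G"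
  using closed[of f "exp X" "exp (- X)"] by (simp add: exp_minus_inverse) (metis exp_minus_inverse minus_minus)

lemma inv_exp: "exp X \<in> G \<Longrightarrow> exp (- X) \<in> G"
  by (metis inv exp_minus_inverse mult.assoc mult.right_neutral mult.left_neutral)

text \<open>
  The source of all elements of the Lie algebra: if group elements approach the identity in the direction
  \<open>Y\<close>, then suitable powers of them approach \<open>exp (t Y)\<close>, which therefore lies in the closed group.
\<close>

lemma lie_limit:
  assumes h: "\<And>n. h n \<in> G" and e: "\<And>n. e n > 0" "e \<longlonglongrightarrow> 0"
    and Y: "(\<lambda>n. (h n - 1) /\<^sub>R e n) \<longlonglongrightarrow> Y"
  shows "Y \<in> lie G"
proof -
  have pos: "exp (t *\<^sub>R Y) \<in> G" if t: "t > 0" for t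
  proof -
    have ne: "e n \<noteq> 0" for n using e(1)[of n] by simp
    \<comment> \<open>The number of steps of length \<open>e n\<close> that reach time \<open>t\<close>.\<close>
    define k where "k n = nat \<lfloor>t / e n\<rfloor>" for n
    have einf: "filterlim (\<lambda>n. t / e n) at_top sequentially"
      unfolding divide_inverse
      by (intro filterlim_tendsto_pos_mult_at_top[OF tendsto_const t] filterlim_inverse_at_top e(2))
         (simp add: e(1))
    have k: "filterlim k at_top sequentially"
      unfolding k_def using filterlim_compose[OF filterlim_nat_sequentially] einf
      by (intro filterlim_compose[OF filterlim_nat_sequentially] filterlim_compose[OF filterlim_floor_sequentially])
    have "(\<lambda>n. real (k n) * e n) \<longlonglongrightarrow> t"
    proof (rule tendsto_sandwich)
      show "\<forall>\<^sub>F n in sequentially. t - e n \<le> real (k n) * e n"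
      proof (rule always_eventually, rule allI)
        fix n have "t / e n - 1 \<le> real (k n)" unfolding k_def by linarith
        then have "(t / e n - 1) * e n \<le> real (k n) * e n" using e(1)[of n] by (intro mult_right_mono) auto
        then show "t - e n \<le> real (k n) * e n" using e(1)[of n] by (simp add: left_diff_distrib)
      qed
      show "\<forall>\<^sub>F n in sequentially. real (k n) * e n \<le> t"
      proof (rule always_eventually, rule allI)
        fix n have "t / e n > 0" using t e(1) by simp
        then have "real (k n) \<le> t / e n" unfolding k_def by linarith
        then show "real (k n) * e n \<le> t" using e(1)[of n] by (simp add: field_simps)
      qed
      show "(\<lambda>n. t - e n) \<longlonglongrightarrow> t" using tendsto_diff[OF tendsto_const e(2)] by simp
    qed simp
    from tendsto_scaleR[OF this Y]
    have "(\<lambda>n. real (k n) *\<^sub>R (h n - 1)) \<longlonglongrightarrow> t *\<^sub>R Y"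
      using ne by (simp add: mult.assoc)
    from power_limit_exp[OF this k]
    have lim: "(\<lambda>n. (1 + (real (k n) *\<^sub>R (h n - 1)) /\<^sub>R real (k n)) ^ k n) \<longlonglongrightarrow> exp (t *\<^sub>R Y)" .
    have "(1 + (real (k n) *\<^sub>R (h n - 1)) /\<^sub>R real (k n)) ^ k n \<in> G" for n
      by (cases "k n = 0") (auto simp: power_closed h one)
    then show ?thesis using lim by (rule closed_exp)
  qed
  have "exp (t *\<^sub>R Y) \<in> G" for t
    using pos[of t] pos[of "- t"] inv_exp[of "(- t) *\<^sub>R Y"] by (cases t "0::real" rule: linorder_cases) (auto simp: one)
  then show ?thesis by (simp add: lie_def)
qed

lemma lie_derivative:
  assumes h: "\<And>t. h t \<in> G" "h 0 = 1" and d: "(h has_vector_derivative Y) (at 0)"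
  shows "Y \<in> lie G"
proof (rule lie_limit)
  have e: "filterlim (\<lambda>n. inverse (real (Suc n))) (at 0) sequentially"
    using LIMSEQ_inverse_real_of_nat by (auto simp: filterlim_at)
  show "(\<lambda>n. (h (inverse (real (Suc n))) - 1) /\<^sub>R inverse (real (Suc n))) \<longlonglongrightarrow> Y"
    using filterlim_compose[OF difference_quotient_tendsto[OF d] e] by (simp add: h)
  show "(\<lambda>n. inverse (real (Suc n))) \<longlonglongrightarrow> 0" by (rule LIMSEQ_inverse_real_of_nat)
qed (use h in auto)

lemma lie_conj:
  assumes "X \<in> lie G" "g \<in> G" "h \<in> G" "g * h = 1" "h * g = 1"
  shows "g * X * h \<in> lie G"
  unfolding lie_def
proof (safe)
  fix t :: real
  have "exp (t *\<^sub>R (g * X * h)) = g * exp (t *\<^sub>R X) * h"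
    using exp_conj[OF assms(4,5), of "t *\<^sub>R X"] by simp
  then show "exp (t *\<^sub>R (g * X * h)) \<in> G"
    using assms by (auto simp: lie_def intro!: mult)
qed

lemma subspace_lie: "subspace (lie G)"
proof (rule subspaceI)
  show "0 \<in> lie G" by (simp add: lie_def one)
  show "c *\<^sub>R X \<in> lie G" if "X \<in> lie G" for c X
    using that by (auto simp: lie_def)
  fix X Y assume X: "X \<in> lie G" and Y: "Y \<in> lie G"
  show "X + Y \<in> lie G"
  proof (rule lie_derivative)
    show "((\<lambda>t. exp (t *\<^sub>R X) * exp (t *\<^sub>R Y)) has_vector_derivative X + Y) (at 0)"
      using has_vector_derivative_mult[OF exp_has_vector_derivative_0[of X] exp_has_vector_derivative_0[of Y]]
      by (simp add: add.commute)
  qed (use X Y in \<open>auto simp: lie_def intro: mult\<close>)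
qed

text \<open>
  Closedness is needed because brackets arise as limits of difference quotients.
\<close>

lemma closed_lie: "closed (lie G)"
  unfolding closed_sequential_limits
proof (intro allI impI, elim conjE)
  fix X l assume X: "\<forall>n. X n \<in> lie G" "X \<longlonglongrightarrow> l"
  have "exp (t *\<^sub>R l) \<in> G" for t
  proof (rule closed_exp)
    show "(\<lambda>n. exp (t *\<^sub>R X n)) \<longlonglongrightarrow> exp (t *\<^sub>R l)" by (intro tendsto_exp_algebra tendsto_intros X)
  qed (use X in \<open>auto simp: lie_def\<close>)
  then show "l \<in> lie G" by (simp add: lie_def)
qed

text \<open>
  The bracket is the derivative at \<open>0\<close> of the conjugates of \<open>Y\<close> by \<open>exp (t X)\<close>, which stay in the
  closed subspace \<open>lie G\<close>.
\<close>

lemma lie_bracket: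
  assumes X: "X \<in> lie G" and Y: "Y \<in> lie G"
  shows "X * Y - Y * X \<in> lie G"
proof -
  let ?c = "\<lambda>t. exp (t *\<^sub>R X) * Y * exp (t *\<^sub>R (- X))"
  have "(?c has_vector_derivative X * Y - Y * X) (at 0)"
    using has_vector_derivative_mult[OF has_vector_derivative_mult_left[OF exp_has_vector_derivative_0[of X], of Y]
        exp_has_vector_derivative_0[of "- X"]] by simp
  from difference_quotient_tendsto[OF this]
  have lim: "((\<lambda>t. (?c t - Y) /\<^sub>R t) \<longlongrightarrow> X * Y - Y * X) (at 0)" by simp
  have "?c t \<in> lie G" for t
  proof (rule lie_conj[OF Y])
    show "exp (t *\<^sub>R X) \<in> G" using X by (simp add: lie_def)
    then show "exp (t *\<^sub>R - X) \<in> G" using inv_exp by fastforce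
  qed (simp_all add: exp_minus_inverse, metis exp_minus_inverse minus_minus)
  then have "(?c t - Y) /\<^sub>R t \<in> lie G" for t
    by (intro subspace_scale[OF subspace_lie] subspace_diff[OF subspace_lie] Y)
  then show ?thesis
    using Lim_in_closed_set[OF closed_lie _ _ lim] by simp
qed

end

text \<open>
  Group elements near the identity are, up to half of their distance to it, exponentials of the Lie algebra.
  Otherwise there would be group elements tending to the identity for which no exponential helps; by
  compactness their directions would accumulate at some \<open>l\<close>, this \<open>l\<close> lies in the Lie algebra by
  \<open>lie_limit\<close>, and the exponentials in the direction \<open>l\<close> do help. This weak form replaces the statement that
  the exponential map is a local homeomorphism.
\<close>

lemma near_identity_exp:
  fixes G :: "'a::{real_normed_algebra_1,banach,heine_borel} set"
  assumes "closed_subgroup G"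
  shows "\<exists>d>0. \<forall>h\<in>G. norm (h - 1) < d \<longrightarrow>
    (\<exists>Z\<in>lie G. norm (exp (- Z) * h - 1) \<le> norm (h - 1) / 2)"
proof (rule ccontr)
  interpret closed_subgroup G by fact
  assume contra: "\<not> ?thesis"
  have "\<exists>h\<in>G. norm (h - 1) < inverse (real (Suc n)) \<and>
      (\<forall>Z\<in>lie G. norm (exp (- Z) * h - 1) > norm (h - 1) / 2)" for n
  proof (rule ccontr)
    assume "\<not> ?thesis"
    then have "\<forall>h\<in>G. norm (h - 1) < inverse (real (Suc n)) \<longrightarrow>
        (\<exists>Z\<in>lie G. norm (exp (- Z) * h - 1) \<le> norm (h - 1) / 2)" by (meson not_less)
    moreover have "inverse (real (Suc n)) > 0" by simp
    ultimately show False using contra by blast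
  qed
  then obtain h where hG: "\<And>n. h n \<in> G" and small: "\<And>n. norm (h n - 1) < inverse (real (Suc n))"
    and far: "\<And>n Z. Z \<in> lie G \<Longrightarrow> norm (exp (- Z) * h n - 1) > norm (h n - 1) / 2"
    by metis
  define e where "e n = norm (h n - 1)" for n
  have epos: "e n > 0" for n
  proof -
    have "h n \<noteq> 1" using far[of 0 n] subspace_0[OF subspace_lie] by auto
    then show ?thesis by (simp add: e_def)
  qed
  have e0: "e \<longlonglongrightarrow> 0" unfolding e_def
    by (rule Lim_null_comparison[OF _ LIMSEQ_inverse_real_of_nat])
       (use small in \<open>auto intro!: always_eventually less_imp_le\<close>)
  \<comment> \<open>The directions in which the sequence approaches \<open>1\<close>.\<close>
  define Y where "Y n = (h n - 1) /\<^sub>R e n" for n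
  have "norm (Y n) = 1" for n using epos[of n] by (simp add: Y_def e_def)
  then have "bounded (range Y)" by (auto simp: bounded_iff)
  then obtain l r where r: "strict_mono r" and "(Y \<circ> r) \<longlonglongrightarrow> l"
    using bounded_imp_convergent_subsequence by blast
  then have Yl: "(\<lambda>n. Y (r n)) \<longlonglongrightarrow> l" by (simp add: o_def)
  have er: "(\<lambda>n. e (r n)) \<longlonglongrightarrow> 0" using LIMSEQ_subseq_LIMSEQ[OF e0 r] by (simp add: o_def)
  have l: "l \<in> lie G"
    by (rule lie_limit[OF _ _ er]) (use hG epos Yl in \<open>auto simp: Y_def\<close>)
  \<comment> \<open>The distance to \<open>1\<close> that remains after moving along \<open>l\<close>, relative to \<open>e (r n)\<close>.\<close>
  define err where "err n = (exp (e (r n) *\<^sub>R (- l)) - 1) /\<^sub>R e (r n) +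
    exp (e (r n) *\<^sub>R (- l)) * Y (r n)" for n
  have "((\<lambda>t. exp (t *\<^sub>R (- l))) has_vector_derivative - l) (at 0)"
    by (rule exp_has_vector_derivative_0)
  moreover have "e (r n) \<noteq> 0" for n using epos[of "r n"] by simp
  then have "filterlim (\<lambda>n. e (r n)) (at 0) sequentially"
    using er by (simp add: filterlim_at)
  ultimately have "(\<lambda>n. (exp (e (r n) *\<^sub>R (- l)) - 1) /\<^sub>R e (r n)) \<longlonglongrightarrow> - l"
    using filterlim_compose[OF difference_quotient_tendsto] by force
  moreover have "(\<lambda>n. exp (e (r n) *\<^sub>R (- l)) * Y (r n)) \<longlonglongrightarrow> exp (0 *\<^sub>R (- l)) * l"
    by (intro tendsto_mult tendsto_exp_algebra tendsto_scaleR er tendsto_const Yl)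
  ultimately have "err \<longlonglongrightarrow> - l + exp (0 *\<^sub>R (- l)) * l"
    unfolding err_def by (rule tendsto_add)
  then have "(\<lambda>n. norm (err n)) \<longlonglongrightarrow> 0" by (intro tendsto_norm_zero) simp
  then have "\<forall>\<^sub>F n in sequentially. norm (err n) < 1 / 2"
    by (rule order_tendstoD) simp
  then obtain n where n: "norm (err n) < 1 / 2" by (auto simp: eventually_sequentially)
  have "exp (- (e (r n) *\<^sub>R l)) * h (r n) - 1 = e (r n) *\<^sub>R err n"
    using epos[of "r n"] by (simp add: err_def Y_def algebra_simps)
  then have "norm (exp (- (e (r n) *\<^sub>R l)) * h (r n) - 1) = e (r n) * norm (err n)"
    using epos[of "r n"] by simp
  also have "\<dots> \<le> e (r n) * (1 / 2)"
    using n epos[of "r n"] by (intro mult_left_mono) auto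
  finally have "norm (exp (- (e (r n) *\<^sub>R l)) * h (r n) - 1) \<le> norm (h (r n) - 1) / 2" by (simp add: e_def)
  with far[of "e (r n) *\<^sub>R l" "r n"] l show False
    by (auto simp: subspace_scale[OF subspace_lie])
qed

text \<open>
  Iterating \<open>near_identity_exp\<close> moves any element near the identity to the identity by factors from \<open>K\<close>.
  Since \<open>K\<close> is closed in \<open>G\<close>, it contains a neighbourhood of the identity, so it is open and closed.
\<close>

theorem subgroup_containing_exp_lie:
  fixes G :: "'a::{real_normed_algebra_1,banach,heine_borel} set"
  assumes G: "closed_subgroup G" "connected G"
    and K: "K \<subseteq> G" "1 \<in> K" "\<And>g h. g \<in> K \<Longrightarrow> h \<in> K \<Longrightarrow> g * h \<in> K"
      "\<And>g h. g \<in> K \<Longrightarrow> h \<in> G \<Longrightarrow> g * h = 1 \<Longrightarrow> h * g = 1 \<Longrightarrow> h \<in> K"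
      "\<And>f a. (\<And>n. f n \<in> K) \<Longrightarrow> f \<longlonglongrightarrow> a \<Longrightarrow> a \<in> G \<Longrightarrow> a \<in> K"
    and exp: "\<And>X. X \<in> lie G \<Longrightarrow> exp X \<in> K"
  shows "K = G"
proof -
  interpret closed_subgroup G by (rule G(1))
  obtain d where d: "d > 0" and near: "\<And>h. h \<in> G \<Longrightarrow> norm (h - 1) < d \<Longrightarrow>
      \<exists>Z\<in>lie G. norm (exp (- Z) * h - 1) \<le> norm (h - 1) / 2"
    using near_identity_exp[OF G(1)] by blast
  have nbhd: "h \<in> K" if h: "h \<in> G" "norm (h - 1) < d" for h
  proof -
    \<comment> \<open>Then \<open>m k\<close> converges to the inverse of \<open>h\<close>.\<close>
    have "\<exists>m\<in>K. norm (m * h - 1) \<le> norm (h - 1) / 2 ^ k" for k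
    proof (induction k)
      case 0 show ?case using K(2) by (intro bexI[of _ 1]) auto
    next
      case (Suc k)
      then obtain m where m: "m \<in> K" "norm (m * h - 1) \<le> norm (h - 1) / 2 ^ k" by blast
      have "norm (h - 1) / 2 ^ k \<le> norm (h - 1)" by (simp add: divide_le_eq mult_le_cancel_left1)
      then have "norm (m * h - 1) < d" using m h by linarith
      moreover have "m * h \<in> G" using m K(1) h by (intro mult) auto
      ultimately obtain Z where Z: "Z \<in> lie G" "norm (exp (- Z) * (m * h) - 1) \<le> norm (m * h - 1) / 2"
        using near by blast
      have "exp (- Z) \<in> K" using exp Z(1) by (simp add: subspace_neg[OF subspace_lie])
      with m(1) have "exp (- Z) * m \<in> K" by (intro K(3))
      moreover have "norm (exp (- Z) * m * h - 1) \<le> norm (h - 1) / 2 ^ Suc k"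
        using Z(2) m(2) by (simp add: mult.assoc)
      ultimately show ?case by blast
    qed
    then obtain m where m: "\<And>k. m k \<in> K" "\<And>k. norm (m k * h - 1) \<le> norm (h - 1) / 2 ^ k"
      by metis
    obtain h' where h': "h' \<in> G" "h * h' = 1" "h' * h = 1" using inv h by blast
    have "(\<lambda>k. norm (h - 1) / 2 ^ k) \<longlonglongrightarrow> 0"
      by (rule LIMSEQ_divide_realpow_zero) simp
    then have "(\<lambda>k. m k * h - 1) \<longlonglongrightarrow> 0"
      by (rule Lim_null_comparison[rotated]) (use m(2) in auto)
    then have "(\<lambda>k. m k * h) \<longlonglongrightarrow> 1" by (simp add: LIM_zero_iff)
    then have "(\<lambda>k. m k * h * h') \<longlonglongrightarrow> 1 * h'" by (intro tendsto_mult tendsto_const)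
    then have "m \<longlonglongrightarrow> h'" by (simp add: mult.assoc h')
    then have "h' \<in> K" by (rule K(5)[OF m(1) _ h'(1)])
    then show "h \<in> K" by (rule K(4)[OF _ h(1) h'(3,2)])
  qed
  have "openin (top_of_set G) K"
    unfolding openin_contains_ball
  proof (intro conjI ballI)
    fix g assume g: "g \<in> K"
    then obtain g' where g': "g' \<in> G" "g * g' = 1" "g' * g = 1" using inv K(1) by blast
    have npos: "norm g' > 0" using g' by auto
    have "x \<in> K" if x: "x \<in> G" "dist g x < d / norm g'" for x
    proof -
      have "g' * x - 1 = g' * (x - g)" using g' by (simp add: right_diff_distrib)
      then have "norm (g' * x - 1) \<le> norm g' * norm (x - g)" by (simp add: norm_mult_ineq)
      also have "\<dots> < d" using x(2) npos by (simp add: dist_norm norm_minus_commute field_simps)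
      finally have "g' * x \<in> K" by (intro nbhd mult g' x(1))
      then have "g * (g' * x) \<in> K" by (rule K(3)[OF g])
      then show ?thesis by (simp add: g' flip: mult.assoc)
    qed
    then show "\<exists>e>0. ball g e \<inter> G \<subseteq> K"
      using d npos by (intro exI[of _ "d / norm g'"]) (auto simp: mem_ball)
  qed (rule K(1))
  moreover have "closedin (top_of_set G) K"
    unfolding closedin_limpt
  proof (intro conjI allI impI K(1), elim conjE)
    fix x assume "x islimpt K" "x \<in> G"
    then obtain f where "\<And>n. f n \<in> K - {x}" "f \<longlonglongrightarrow> x"
      unfolding islimpt_sequential by blast
    then show "x \<in> K" using \<open>x \<in> G\<close> by (intro K(5)[of f x]) auto
  qed
  ultimately show ?thesis
    using G(2)[unfolded connected_clopen, rule_format, of K] K(2) by auto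
qed

section \<open>Engel's theorem\<close>

abbreviation bracket :: "'a::ring \<Rightarrow> 'a \<Rightarrow> 'a" where "bracket x y \<equiv> x * y - y * x"

abbreviation brackets :: "'a::ring set \<Rightarrow> 'a set" where
  "brackets h \<equiv> {bracket x y |x y. x \<in> h \<and> y \<in> h}"

text \<open>
  Images of linear maps are controlled on generators. This is the form in which all statements about
  spans of products and brackets are proved below.
\<close>

lemma span_map:
  assumes "linear f" "\<And>s. s \<in> S \<Longrightarrow> f s \<in> span T" "y \<in> span S"
  shows "f y \<in> span T"
proof -
  have "f y \<in> f ` span S" using assms by blast
  also have "\<dots> = span (f ` S)" using linear_span_image[OF assms(1)] by simp
  also have "\<dots> \<subseteq> span T" by (rule span_minimal) (use assms(2) in auto)
  finally show ?thesis .
qed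

lemma dim_strict_mono:
  fixes S T :: "'a::real_vector set"
  assumes "finite B" "S \<subseteq> span B" "subspace T" "T \<subset> S"
  shows "dim T < dim S"
proof -
  obtain C where C: "C \<subseteq> T" "independent C" "T \<subseteq> span C" "card C = dim T"
    using basis_exists by blast
  have "C \<subseteq> S" using C(1) assms(4) by blast
  then obtain D where D: "C \<subseteq> D" "D \<subseteq> S" "independent D" "S \<subseteq> span D"
    using maximal_independent_subset_extend[OF _ C(2)] by blast
  have "finite D" using independent_span_bound[OF assms(1) D(3)] D(2) assms(2) by auto
  moreover have "C \<noteq> D"
    using span_minimal[OF C(1) assms(3)] D(4) assms(4) by auto
  ultimately have "card C < card D" using D(1) by (intro psubset_card_mono) auto
  moreover have "dim S = card D" using basis_card_eq_dim[OF D(2,4,3)] by simp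
  ultimately show ?thesis using C(4) by simp
qed

lemma dim_le_card_spanning:
  fixes S :: "'a::real_vector set"
  assumes "finite B" "S \<subseteq> span B"
  shows "dim S \<le> card B"
proof -
  obtain C where "C \<subseteq> S" "independent C" "card C = dim S" using basis_exists by metis
  then show ?thesis using independent_span_bound[OF assms(1)] assms(2) by (metis subset_trans)
qed

text \<open>
  Products of exactly \<open>n\<close> factors from a set. That \<open>prods A N\<close> vanishes for some \<open>N\<close> means that \<open>A\<close>
  generates a nilpotent associative algebra without unit.
\<close>

primrec prods :: "'a::monoid_mult set \<Rightarrow> nat \<Rightarrow> 'a set" where
  "prods A 0 = {1}"
| "prods A (Suc n) = {a * p |a p. a \<in> A \<and> p \<in> prods A n}"

lemma prods_mult: "p \<in> prods A m \<Longrightarrow> q \<in> prods A n \<Longrightarrow> p * q \<in> prods A (m + n)"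
proof (induction m arbitrary: p)
  case (Suc m)
  then obtain a p' where "p = a * p'" "a \<in> A" "p' \<in> prods A m" by auto
  then show ?case using Suc by (auto simp: mult.assoc)
qed simp

lemma prods_Suc_right: "p \<in> prods A n \<Longrightarrow> a \<in> A \<Longrightarrow> p * a \<in> prods A (Suc n)"
  using prods_mult[of p A n a 1] by (auto simp: mult.assoc)

lemma prods_power: "x \<in> A \<Longrightarrow> x ^ n \<in> prods A n"
  by (induction n) auto

lemma prods_mono: "A \<subseteq> B \<Longrightarrow> prods A n \<subseteq> prods B n"
  by (induction n) auto

lemma prods_split: "p \<in> prods A (m + n) \<Longrightarrow> \<exists>u\<in>prods A m. \<exists>v\<in>prods A n. p = u * v"
proof (induction m arbitrary: p)
  case (Suc m)
  then obtain a p' where "p = a * p'" "a \<in> A" "p' \<in> prods A (m + n)" by auto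
  with Suc.IH[of p'] obtain u v where "p = (a * u) * v" "u \<in> prods A m" "v \<in> prods A n" by (metis mult.assoc)
  then show ?case using \<open>a \<in> A\<close> by (intro bexI[of _ "a * u"] bexI[of _ v]) auto
qed auto

lemma prods_zero_mono:
  fixes A :: "'a::real_algebra_1 set"
  assumes "prods A N \<subseteq> {0}" "N \<le> n" "p \<in> prods A n"
  shows "p = 0"
proof -
  have "p \<in> prods A (N + (n - N))" using assms by simp
  from prods_split[OF this] show ?thesis using assms(1) by auto
qed

lemma span_mult:
  fixes A B :: "'a::real_algebra set"
  assumes "a \<in> span A" "b \<in> span B"
  shows "a * b \<in> span {x * y |x y. x \<in> A \<and> y \<in> B}"
proof -
  have "a * y \<in> span {x * y |x y. x \<in> A \<and> y \<in> B}" if "y \<in> B" for y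
  proof (rule span_map[where f = "\<lambda>x. x * y", OF _ _ assms(1)])
    show "linear (\<lambda>x. x * y)" by (simp add: linear_iff distrib_right)
    fix s assume "s \<in> A"
    with that show "s * y \<in> span {x * y |x y. x \<in> A \<and> y \<in> B}" by (intro span_base) blast
  qed
  then show ?thesis
    by (intro span_map[where f = "(*) a", OF _ _ assms(2)]) (simp_all add: linear_iff distrib_left)
qed

lemma prods_span:
  fixes A :: "'a::real_algebra_1 set"
  shows "prods (span A) n \<subseteq> span (prods A n)"
proof (induction n)
  case (Suc n)
  show ?case
  proof
    fix q assume "q \<in> prods (span A) (Suc n)"
    then obtain a p where "q = a * p" "a \<in> span A" "p \<in> span (prods A n)" using Suc by auto
    then show "q \<in> span (prods A (Suc n))"
      using span_mult[of a A p "prods A n"] by simp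
  qed
qed (auto intro: span_base)

lemma prods_insert_cases:
  assumes "w \<in> prods (insert x k) (m + n)"
  shows "(\<exists>w'. w = x ^ m * w') \<or>
    (\<exists>j y w' n'. w = x ^ j * y * w' \<and> y \<in> k \<and> n \<le> n' \<and> w' \<in> prods (insert x k) n')"
  using assms
proof (induction m arbitrary: w)
  case (Suc m)
  then obtain a v where w: "w = a * v" "a \<in> insert x k" and v: "v \<in> prods (insert x k) (m + n)" by auto
  show ?case
  proof (cases "a \<in> k")
    case True
    have "w = x ^ 0 * a * v" "n \<le> m + n" using w by auto
    then show ?thesis using True v by blast
  next
    case False
    then have a: "a = x" using w by simp
    from Suc.IH[OF v] show ?thesis
    proof (elim disjE exE conjE)
      fix w' assume "v = x ^ m * w'"
      then have "w = x ^ Suc m * w'" by (simp add: w a mult.assoc)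
      then show ?thesis by blast
    next
      fix j y w' n' assume "v = x ^ j * y * w'" and *: "y \<in> k" "n \<le> n'" "w' \<in> prods (insert x k) n'"
      then have "w = x ^ Suc j * y * w'" by (simp add: w a mult.assoc)
      then show ?thesis using * by blast
    qed
  qed
qed simp

lemma power_mult_normal_form:
  fixes k :: "'a::real_algebra_1 set"
  assumes "\<And>y. y \<in> k \<Longrightarrow> x * y - y * x \<in> k" "y \<in> k"
  shows "x ^ j * y \<in> span {z * x ^ i |z i. z \<in> k}"
proof (induction j)
  case 0
  have "x ^ 0 * y = y * x ^ 0" by simp
  then show ?case using assms(2) by (intro span_base) blast
next
  case (Suc j)
  have "x * (x ^ j * y) \<in> span {z * x ^ i |z i. z \<in> k}"
  proof (rule span_map[where f = "(*) x", OF _ _ Suc])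
    show "linear ((*) x)" by (auto simp: linear_iff distrib_left)
    fix s assume "s \<in> {z * x ^ i |z i. z \<in> k}"
    then obtain z i where s: "s = z * x ^ i" "z \<in> k" by auto
    have "x * s = (x * z - z * x) * x ^ i + z * x ^ Suc i" by (simp add: s algebra_simps)
    also have "\<dots> \<in> span {z * x ^ i |z i. z \<in> k}"
      using s(2) assms(1)[OF s(2)] by (intro span_add span_base) blast+
    finally show "x * s \<in> span {z * x ^ i |z i. z \<in> k}" .
  qed
  then show ?case by (simp add: mult.assoc)
qed

text \<open>
  Adding to a set \<open>k\<close> with vanishing long products a nilpotent element \<open>x\<close> that normalizes \<open>k\<close> keeps
  long products zero. A long word either contains a long run of \<open>x\<close>, or its first factor from \<open>k\<close>
  can be moved to the front, past few powers of \<open>x\<close>. The induction collects up to \<open>N\<close> factors from \<open>k\<close>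
  in front, each at the cost of \<open>M\<close> letters.
\<close>

lemma prods_insert_zero:
  fixes k :: "'a::real_algebra_1 set"
  assumes k: "prods k N \<subseteq> {0}" and x: "x ^ M = 0"
    and norm: "\<And>y. y \<in> k \<Longrightarrow> x * y - y * x \<in> k"
  shows "\<exists>L. prods (insert x k) L \<subseteq> {0}"
proof -
  \<comment> \<open>Here \<open>p\<close> factors from \<open>k\<close> have been collected and \<open>d\<close> are missing.\<close>
  have "\<forall>u\<in>prods k p. \<forall>n\<ge>d * M. \<forall>w\<in>prods (insert x k) n. u * w = 0" if "p + d = N" for p d
    using that
  proof (induction d arbitrary: p)
    case 0
    then show ?case using k by auto
  next
    case (Suc d)
    show ?case
    proof (intro ballI allI impI)
      fix u n w assume u: "u \<in> prods k p" and n: "Suc d * M \<le> n" and w: "w \<in> prods (insert x k) n"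
      \<comment> \<open>The letters that remain after at most \<open>M\<close> of them have been spent on the next factor from \<open>k\<close>.\<close>
      define r where "r = n - M"
      have r: "n = M + r" "d * M \<le> r" using n by (auto simp: r_def)
      from prods_insert_cases[of w x k M r] w r consider w' where "w = x ^ M * w'"
        | j y w' n' where "w = x ^ j * y * w'" "y \<in> k" "r \<le> n'" "w' \<in> prods (insert x k) n'" by blast
      then show "u * w = 0"
      proof cases
        case 2
        have "u * (x ^ j * y) * w' \<in> span {0}"
        proof (rule span_map[where f = "\<lambda>v. u * v * w'", OF _ _ power_mult_normal_form[OF norm 2(2), of j]])
          show "linear (\<lambda>v. u * v * w')" by (auto simp: linear_iff distrib_left distrib_right)
          fix s assume "s \<in> {z * x ^ i |z i. z \<in> k}"
          then obtain z i where s: "s = z * x ^ i" "z \<in> k" by auto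
          have "(u * z) * (x ^ i * w') = 0"
            using Suc.IH[of "Suc p"] Suc.prems prods_Suc_right[OF u s(2)]
              prods_mult[OF prods_power[of x "insert x k" i] 2(4)] 2(3) r(2)
            by (metis add_Suc_right add_Suc insertI1 le_trans trans_le_add2)
          then show "u * s * w' \<in> span {0}" by (simp add: s mult.assoc)
        qed
        then show ?thesis by (simp add: 2(1) mult.assoc)
      qed (simp add: x)
    qed
  qed
  from this[of 0 N] have "\<forall>w\<in>prods (insert x k) (N * M). w = 0" by auto
  then show ?thesis by blast
qed

text \<open>
  Jacobson's argument. If no element outside \<open>k\<close> normalized \<open>k\<close>, one could bracket an element \<open>y0\<close>
  again and again with elements of \<open>k\<close> and never land in \<open>k\<close>. But an iterated bracket of length \<open>2 N\<close>
  expands into terms \<open>a y0 b\<close> in which \<open>a\<close> or \<open>b\<close> has at least \<open>N\<close> factors from \<open>k\<close>, so it vanishes.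
\<close>

lemma exists_normalizing_element:
  fixes k :: "'a::real_algebra_1 set"
  assumes k: "prods k N \<subseteq> {0}" "0 \<in> k" and kh: "k \<subseteq> h" "\<not> h \<subseteq> k"
    and h: "\<And>x y. x \<in> h \<Longrightarrow> y \<in> h \<Longrightarrow> x * y - y * x \<in> h"
  shows "\<exists>x\<in>h - k. \<forall>z\<in>k. x * z - z * x \<in> k"
proof (rule ccontr)
  assume contra: "\<not> ?thesis"
  obtain y0 where y0: "y0 \<in> h - k" using kh by blast
  \<comment> \<open>The terms into which an \<open>i\<close>-fold bracket of \<open>y0\<close> with elements of \<open>k\<close> expands.\<close>
  define S where "S i = {a * y0 * b |a b p q. a \<in> prods k p \<and> b \<in> prods k q \<and> p + q = i}" for i
  have "\<exists>y\<in>h - k. y \<in> span (S i)" for i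
  proof (induction i)
    case 0
    have "y0 \<in> S 0" by (auto simp: S_def)
    then show ?case using y0 span_base by blast
  next
    case (Suc i)
    then obtain y where y: "y \<in> h - k" "y \<in> span (S i)" by blast
    then obtain z where z: "z \<in> k" "y * z - z * y \<notin> k" using contra by blast
    have "y * z \<in> span (S (Suc i))"
    proof (rule span_map[where f = "\<lambda>y. y * z", OF _ _ y(2)])
      show "linear (\<lambda>y. y * z)" by (auto simp: linear_iff distrib_right)
      fix s assume "s \<in> S i"
      then obtain a b p q where s: "s = a * y0 * b" "a \<in> prods k p" "b \<in> prods k q" "p + q = i"
        by (auto simp: S_def)
      have "s * z = a * y0 * (b * z)" by (simp add: s(1) mult.assoc)
      moreover have "p + Suc q = Suc i" using s(4) by simp
      ultimately have "s * z \<in> S (Suc i)" unfolding S_def using s(2) prods_Suc_right[OF s(3) z(1)] by blast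
      then show "s * z \<in> span (S (Suc i))" by (rule span_base)
    qed
    moreover have "z * y \<in> span (S (Suc i))"
    proof (rule span_map[where f = "\<lambda>y. z * y", OF _ _ y(2)])
      show "linear (\<lambda>y. z * y)" by (auto simp: linear_iff distrib_left)
      fix s assume "s \<in> S i"
      then obtain a b p q where s: "s = a * y0 * b" "a \<in> prods k p" "b \<in> prods k q" "p + q = i"
        by (auto simp: S_def)
      have "z * s = (z * a) * y0 * b" by (simp add: s(1) mult.assoc)
      moreover have "Suc p + q = Suc i" using s(4) by simp
      moreover have "z * a \<in> prods k (Suc p)" using s(2) z(1) by auto
      ultimately have "z * s \<in> S (Suc i)" unfolding S_def using s(3) by blast
      then show "z * s \<in> span (S (Suc i))" by (rule span_base)
    qed
    ultimately have "y * z - z * y \<in> span (S (Suc i))" by (rule span_diff)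
    moreover have "y * z - z * y \<in> h" using y(1) z(1) kh(1) h by blast
    ultimately show ?case using z(2) by blast
  qed
  then obtain y where y: "y \<in> h - k" "y \<in> span (S (2 * N))" by blast
  have "S (2 * N) \<subseteq> {0}"
  proof
    fix s assume "s \<in> S (2 * N)"
    then obtain a b p q where s: "s = a * y0 * b" "a \<in> prods k p" "b \<in> prods k q" "p + q = 2 * N"
      by (auto simp: S_def)
    then have "N \<le> p \<or> N \<le> q" by linarith
    then have "a = 0 \<or> b = 0"
      using prods_zero_mono[OF k(1) _ s(2)] prods_zero_mono[OF k(1) _ s(3)] by blast
    then show "s \<in> {0}" by (auto simp: s)
  qed
  then have "span (S (2 * N)) \<subseteq> {0}" by (rule span_minimal[OF _ subspace_single_0])
  then show False using y k(2) by auto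
qed

text \<open>
  A subalgebra of maximal dimension among those with vanishing long products must be everything, because
  otherwise it could be enlarged by a normalizing element.
\<close>

theorem engel:
  fixes h :: "'a::real_algebra_1 set"
  assumes h: "subspace h" "finite B" "h \<subseteq> span B"
    "\<And>x y. x \<in> h \<Longrightarrow> y \<in> h \<Longrightarrow> x * y - y * x \<in> h"
    and nil: "\<And>x. x \<in> h \<Longrightarrow> \<exists>m. x ^ m = 0"
  shows "\<exists>N. prods h N \<subseteq> {0}"
proof -
  define P where "P k \<longleftrightarrow> subspace k \<and> k \<subseteq> h \<and> (\<forall>x\<in>k. \<forall>y\<in>k. x * y - y * x \<in> k) \<and>
    (\<exists>N. prods k N \<subseteq> {0})" for k
  have "prods {0::'a} 1 \<subseteq> {0}" by auto
  then have "P {0}" unfolding P_def using subspace_0[OF h(1)] subspace_single_0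
    by (intro conjI exI[of _ 1]) simp_all
  moreover have "\<forall>k. P k \<longrightarrow> dim k < Suc (card B)"
    using dim_le_card_spanning[OF h(2)] h(3) unfolding P_def by (auto simp: less_Suc_eq_le)
  ultimately have "\<exists>k. P k \<and> (\<forall>k'. P k' \<longrightarrow> dim k' \<le> dim k)"
    by (rule ex_has_greatest_nat)
  then obtain k where k: "P k" and max: "\<And>k'. P k' \<Longrightarrow> dim k' \<le> dim k" by blast
  have sk: "subspace k" "k \<subseteq> h" and bk: "\<And>x y. x \<in> k \<Longrightarrow> y \<in> k \<Longrightarrow> x * y - y * x \<in> k"
    using k by (simp_all add: P_def)
  obtain N where N: "prods k N \<subseteq> {0}" using k P_def by metis
  have "h \<subseteq> k"
  proof (rule ccontr)
    assume "\<not> h \<subseteq> k"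
    from exists_normalizing_element[OF N subspace_0[OF sk(1)] sk(2) this h(4)]
    obtain x where x: "x \<in> h" "x \<notin> k" and xk: "\<And>z. z \<in> k \<Longrightarrow> x * z - z * x \<in> k" by blast
    define k' where "k' = span (insert x k)"
    have k'E: "\<exists>c y. v = c *\<^sub>R x + y \<and> y \<in> k" if v: "v \<in> k'" for v
    proof -
      obtain c where "v - c *\<^sub>R x \<in> span k" using v unfolding k'_def span_insert by blast
      then have "v - c *\<^sub>R x \<in> k" using sk(1) span_eq_iff by metis
      then show ?thesis by (metis add.commute diff_add_cancel)
    qed
    have kk': "k \<subseteq> k'" unfolding k'_def using span_superset[of "insert x k"] by auto
    have "P k'" unfolding P_def
    proof (intro conjI ballI)
      show "subspace k'" by (simp add: k'_def)
      show "k' \<subseteq> h" unfolding k'_def by (rule span_minimal) (use x sk h(1) in auto)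
      fix v w assume "v \<in> k'" "w \<in> k'"
      from k'E[OF this(1)] k'E[OF this(2)]
      obtain c y d z where v: "v = c *\<^sub>R x + y" "y \<in> k" and w: "w = d *\<^sub>R x + z" "z \<in> k"
        by blast
      have "v * w - w * v = c *\<^sub>R (x * z - z * x) - d *\<^sub>R (x * y - y * x) + (y * z - z * y)"
        by (simp add: v w algebra_simps)
      also have "\<dots> \<in> k"
        using xk bk v(2) w(2) sk(1) by (intro subspace_add[OF sk(1) subspace_diff[OF sk(1)]] subspace_scale[OF sk(1)])
      finally show "v * w - w * v \<in> k'" using kk' by blast
    next
      obtain M where "x ^ M = 0" using nil x by blast
      from prods_insert_zero[OF N this xk] obtain L where L: "prods (insert x k) L \<subseteq> {0}" by blast
      have "prods k' L \<subseteq> span (prods (insert x k) L)" unfolding k'_def by (rule prods_span)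
      also have "\<dots> \<subseteq> {0}" using span_mono[OF L] by simp
      finally show "\<exists>N. prods k' N \<subseteq> {0}" by blast
    qed
    then have "dim k' \<le> dim k" by (rule max)
    moreover have "dim k < dim k'"
    proof (rule dim_strict_mono[OF h(2) _ sk(1)])
      show "k' \<subseteq> span B" using \<open>P k'\<close> h(3) by (auto simp: P_def)
      have "x \<in> k'" unfolding k'_def by (intro span_base) auto
      then show "k \<subset> k'" using kk' x(2) by blast
    qed
    ultimately show False by simp
  qed
  then have "prods h N \<subseteq> {0}" using prods_mono[of h k N] N by blast
  then show ?thesis by blast
qed

text \<open>
  In a perfect algebra every element is a combination of arbitrarily long products.
\<close>

corollary perfect_nilpotent_trivial:
  fixes h :: "'a::real_algebra_1 set"
  assumes "prods h N \<subseteq> {0}" "h \<subseteq> span (brackets h)"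
  shows "h \<subseteq> {0}"
proof -
  have "h \<subseteq> span (prods h (Suc n))" for n
  proof (induction n)
    case 0
    show ?case using span_base[of _ h] by (auto simp: intro!: span_base)
  next
    case (Suc n)
    have "brackets h \<subseteq> span (prods h (Suc (Suc n)))"
    proof
      fix s assume "s \<in> brackets h"
      then obtain x y where s: "s = x * y - y * x" "x \<in> h" "y \<in> h" by blast
      then have x: "x \<in> span (prods h (Suc n))" using Suc by blast
      have "x * y \<in> span (prods h (Suc (Suc n)))"
      proof (rule span_map[where f = "\<lambda>x. x * y", OF _ _ x])
        show "linear (\<lambda>x. x * y)" by (auto simp: linear_iff distrib_right)
        fix p assume "p \<in> prods h (Suc n)"
        from prods_Suc_right[OF this s(3)] show "p * y \<in> span (prods h (Suc (Suc n)))" by (rule span_base)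
      qed
      moreover have "y * x \<in> span (prods h (Suc (Suc n)))"
      proof (rule span_map[where f = "(*) y", OF _ _ x])
        show "linear ((*) y)" by (auto simp: linear_iff distrib_left)
        fix p assume "p \<in> prods h (Suc n)"
        then have "y * p \<in> prods h (Suc (Suc n))" using s(3) by auto
        then show "y * p \<in> span (prods h (Suc (Suc n)))" by (rule span_base)
      qed
      ultimately show "s \<in> span (prods h (Suc (Suc n)))" unfolding s(1) by (rule span_diff)
    qed
    then have "span (brackets h) \<subseteq> span (prods h (Suc (Suc n)))"
      by (rule span_minimal) simp
    then show ?case using assms(2) by blast
  qed
  from this[of N] have "h \<subseteq> span (prods h (Suc N))" .
  also have "prods h (Suc N) \<subseteq> {0}" using prods_zero_mono[OF assms(1), of "Suc N"] by auto
  then have "span (prods h (Suc N)) \<subseteq> {0}" by (rule span_minimal[OF _ subspace_single_0])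
  finally show ?thesis .
qed

section \<open>Jordan form and the conjugate of the semisimple part\<close>

lemmas cart_eq_iff = Finite_Cartesian_Product.vec_eq_iff

lemma jordan_matrix_Cons_entry:
  assumes "i < n + sum_list (map fst nas)" "j < n + sum_list (map fst nas)"
  shows "jordan_matrix ((n, a) # nas) $$ (i, j) =
    (if i < n then if j < n then jordan_block n a $$ (i, j) else 0
     else if j < n then 0 else jordan_matrix nas $$ (i - n, j - n))"
proof -
  have "dim_row (diag_block_mat (map (\<lambda>(n, a). jordan_block n a) nas)) = sum_list (map fst nas)"
    "dim_col (diag_block_mat (map (\<lambda>(n, a). jordan_block n a) nas)) = sum_list (map fst nas)"
    using jordan_matrix_dim[of nas] by (simp_all only: jordan_matrix_def)
  then show ?thesis using assms by (simp add: jordan_matrix_def Let_def)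
qed

text \<open>
  Nonzero entries of a Jordan matrix lie on or above the diagonal, inside a block of a single eigenvalue.
  Of the Jordan form, the arguments below use exactly this.
\<close>

lemma jordan_matrix_entry:
  assumes "i < sum_list (map fst nas)" "j < sum_list (map fst nas)"
    "jordan_matrix nas $$ (i, j) \<noteq> (0::complex)"
  shows "i \<le> j \<and> jordan_matrix nas $$ (i, i) = jordan_matrix nas $$ (j, j)"
  using assms
proof (induction nas arbitrary: i j)
  case (Cons na nas)
  obtain n a where na: "na = (n, a)" by force
  have ij: "i < n + sum_list (map fst nas)" "j < n + sum_list (map fst nas)"
    using Cons.prems by (simp_all add: na)
  note e = jordan_matrix_Cons_entry[OF ij, of a] jordan_matrix_Cons_entry[OF ij(1,1), of a]
    jordan_matrix_Cons_entry[OF ij(2,2), of a]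
  show ?case
  proof (cases "i < n")
    case True
    then show ?thesis using Cons.prems(3) by (cases "j < n") (simp_all add: na e split: if_splits)
  next
    case False
    then have j: "\<not> j < n" using Cons.prems(3) by (auto simp: na e)
    have "i - n < sum_list (map fst nas)" "j - n < sum_list (map fst nas)" using ij False j by linarith+
    moreover have "jordan_matrix nas $$ (i - n, j - n) \<noteq> 0" using Cons.prems(3) False j by (simp add: na e)
    ultimately have "i - n \<le> j - n \<and> jordan_matrix nas $$ (i - n, i - n) = jordan_matrix nas $$ (j - n, j - n)"
      by (rule Cons.IH)
    moreover from this have "i \<le> j" using False j by linarith
    ultimately show ?thesis using False j by (simp add: na e)
  qed
qed simp

lemma mat_mult_entry:
  assumes "M \<in> carrier_mat n n" "N \<in> carrier_mat n n" "i < n" "j < n"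
  shows "(M * N) $$ (i, j) = (\<Sum>k\<in>{0..<n}. M $$ (i, k) * N $$ (k, j))"
proof -
  note d = carrier_matD[OF assms(1)] carrier_matD[OF assms(2)]
  have "(M * N) $$ (i, j) = scalar_prod (Matrix.row M i) (Matrix.col N j)"
    by (rule index_mult_mat) (simp_all add: d assms)
  also have "\<dots> = (\<Sum>k\<in>{0..<n}. M $$ (i, k) * N $$ (k, j))"
    unfolding scalar_prod_def dim_col d
    by (rule sum.cong) (simp_all add: d assms)
  finally show ?thesis .
qed

text \<open>
  The Jordan form transported to matrices over an arbitrary finite index type. Triangularity refers to an
  enumeration \<open>r\<close> of that type.
\<close>

lemma triangular_form:
  fixes A :: "complex ^ 'i ^ 'i"
  obtains P Q J :: "complex ^ 'i ^ 'i" and r :: "'i \<Rightarrow> nat" where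
    "P ** Q = mat 1" "Q ** P = mat 1" "A = P ** J ** Q" "inj r"
    "\<And>i j. J $ i $ j \<noteq> 0 \<Longrightarrow> r i \<le> r j \<and> J $ i $ i = J $ j $ j"
proof -
  define n where "n = CARD('i)"
  obtain r :: "'i \<Rightarrow> nat" where r: "bij_betw r UNIV {0..<n}"
    using ex_bij_betw_finite_nat[of "UNIV :: 'i set"] by (auto simp: n_def)
  define s where "s = inv_into UNIV r"
  have rn: "r i < n" for i using r by (auto simp: bij_betw_def)
  have rinj: "r i = r j \<longleftrightarrow> i = j" for i j using r by (auto simp: bij_betw_def inj_eq)
  have sr: "s (r i) = i" for i unfolding s_def using r by (simp add: bij_betw_def)
  define F :: "complex Matrix.mat \<Rightarrow> complex ^ 'i ^ 'i" where "F M = (\<chi> i j. M $$ (r i, r j))" for M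
  have F_mult: "F (M * N) = F M ** F N" if "M \<in> carrier_mat n n" "N \<in> carrier_mat n n" for M N
  proof -
    have "F (M * N) $ i $ j = (F M ** F N) $ i $ j" for i j
    proof -
      have "F (M * N) $ i $ j = (\<Sum>k\<in>{0..<n}. M $$ (r i, k) * N $$ (k, r j))"
        unfolding F_def vec_lambda_beta by (rule mat_mult_entry[OF that rn rn])
      also have "\<dots> = (\<Sum>k\<in>UNIV. M $$ (r i, r k) * N $$ (r k, r j))"
        by (rule sum.reindex_bij_betw[OF r, symmetric])
      also have "\<dots> = (F M ** F N) $ i $ j"
        unfolding F_def matrix_matrix_mult_def vec_lambda_beta by (rule refl)
      finally show ?thesis .
    qed
    then show ?thesis unfolding cart_eq_iff by blast
  qed
  have F_one: "F (1\<^sub>m n) = mat 1"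
    by (simp add: F_def Finite_Cartesian_Product.mat_def cart_eq_iff rn rinj)
  define A' where "A' = Matrix.mat n n (\<lambda>(a, b). A $ s a $ s b)"
  have A': "A' \<in> carrier_mat n n" by (simp add: A'_def)
  have FA: "F A' = A" using rn by (simp add: F_def A'_def sr cart_eq_iff)
  obtain as where "char_poly A' = (\<Prod>a\<leftarrow>as. [:- a, 1:])" using char_poly_factorized[OF A'] by blast
  from jordan_nf_exists[OF A' this] obtain nas where "similar_mat A' (jordan_matrix nas)"
    by (auto simp: jordan_nf_def)
  then obtain P Q where "similar_mat_wit A' (jordan_matrix nas) P Q" by (auto simp: similar_mat_def)
  note w = similar_mat_witD2[OF A' this]
  have nas: "sum_list (map fst nas) = n" using w(5) by auto
  show thesis
  proof (rule that[of "F P" "F Q" "F (jordan_matrix nas)" r])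
    show "F P ** F Q = mat 1" "F Q ** F P = mat 1"
      using F_mult[OF w(6,7)] F_mult[OF w(7,6)] w(1,2) F_one by simp_all
    show "A = F P ** F (jordan_matrix nas) ** F Q"
      using F_mult[OF w(6,5)] F_mult[OF mult_carrier_mat[OF w(6,5)] w(7)] w(3) FA by simp
    show "inj r" using r by (simp add: bij_betw_def)
    fix i j assume "F (jordan_matrix nas) $ i $ j \<noteq> 0"
    then have "jordan_matrix nas $$ (r i, r j) \<noteq> 0" unfolding F_def vec_lambda_beta .
    from jordan_matrix_entry[OF _ _ this] rn
    show "r i \<le> r j \<and> F (jordan_matrix nas) $ i $ i = F (jordan_matrix nas) $ j $ j"
      unfolding F_def vec_lambda_beta nas by blast
  qed
qed

context vector_space
begin

text \<open>
  For \<open>M = 1\<close> this is the heart: modulo \<open>U\<close> the vector \<open>u\<close> is an eigenvector for \<open>b\<close>, so \<open>T - a\<close> acts on it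
  as the nonzero scalar \<open>b - a\<close>, and a power of \<open>T - a\<close> kills it.
\<close>

lemma generalized_eigenvector_in_subspace:
  assumes U: "subspace U" "\<And>u. u \<in> U \<Longrightarrow> T u \<in> U"
    and T: "\<And>u v. T (u + v) = T u + T v" "\<And>c u. T (scale c u) = scale c (T u)"
    and "a \<noteq> b"
    and "((\<lambda>v. T v - scale a v) ^^ N) u = 0" "((\<lambda>v. T v - scale b v) ^^ M) u \<in> U"
  shows "u \<in> U"
  using assms(6,7)
proof (induction M arbitrary: u)
  case (Suc M)
  define L where "L c v = T v - scale c v" for c v
  have L: "(\<lambda>v. T v - scale c v) = L c" for c by (simp add: L_def fun_eq_iff)
  have Ladd: "L c (u + v) = L c u + L c v" "L c (scale d u) = scale d (L c u)" for c d u v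
    by (simp_all add: L_def T scale_right_distrib scale_right_diff_distrib mult.commute)
  have LU: "L c u \<in> U" if "u \<in> U" for c u
    using that by (simp add: L_def U subspace_diff subspace_scale)
  have comm: "L c (L d u) = L d (L c u)" for c d u
    using T(1)[of "T u - scale d u" "scale d u"] T(1)[of "T u - scale c u" "scale c u"]
    by (simp add: L_def T scale_right_diff_distrib algebra_simps)
  have "(L a ^^ N) (L b u) = L b ((L a ^^ N) u)" for u
    by (induction N) (simp_all add: comm)
  moreover have "L c 0 = 0" for c using Ladd(2)[of c 0 0] by simp
  ultimately have "(L a ^^ N) (L b u) = 0" using Suc.prems by (simp add: L)
  moreover have "(L b ^^ M) (L b u) \<in> U" using Suc.prems(2) by (simp add: L funpow_swap1)
  ultimately have w: "L b u \<in> U" using Suc.IH[of "L b u"] by (simp add: L)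
  have "(L a ^^ n) u - scale ((b - a) ^ n) u \<in> U" for n
  proof (induction n)
    case (Suc n)
    define z where "z = (L a ^^ n) u - scale ((b - a) ^ n) u"
    have "L a u = L b u + scale (b - a) u" by (simp add: L_def scale_left_diff_distrib)
    moreover have "(L a ^^ n) u = z + scale ((b - a) ^ n) u" by (simp add: z_def)
    ultimately have "(L a ^^ Suc n) u - scale ((b - a) ^ Suc n) u = L a z + scale ((b - a) ^ n) (L b u)"
      by (simp add: Ladd scale_right_distrib mult.commute)
    also have "\<dots> \<in> U" using Suc w U by (simp add: z_def[symmetric] LU subspace_add subspace_scale)
    finally show ?case .
  qed (simp add: subspace_0[OF U(1)])
  from this[of N] have "- scale ((b - a) ^ N) u \<in> U" using Suc.prems(1) by (simp add: L)
  then have "scale (- inverse ((b - a) ^ N)) (- scale ((b - a) ^ N) u) \<in> U"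
    using U(1) subspace_scale by blast
  then show ?case using \<open>a \<noteq> b\<close> by simp
qed simp

text \<open>
  Invariant subspaces contain the generalized eigencomponents of their elements. Applying \<open>(T - b)\<^sup>N\<close>
  removes one component, and the remaining ones are recovered by the previous lemma.
\<close>

lemma generalized_eigencomponents_in_subspace:
  assumes U: "subspace U" "\<And>u. u \<in> U \<Longrightarrow> T u \<in> U"
    and T: "\<And>u v. T (u + v) = T u + T v" "\<And>c u. T (scale c u) = scale c (T u)"
    and "finite I" "\<And>a. a \<in> I \<Longrightarrow> ((\<lambda>v. T v - scale a v) ^^ N) (u a) = 0" "(\<Sum>a\<in>I. u a) \<in> U"
  shows "\<forall>a\<in>I. u a \<in> U"
  using assms(5-)
proof (induction I arbitrary: u rule: finite_induct)
  case (insert b I)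
  define L where "L c v = T v - scale c v" for c v
  have L: "(\<lambda>v. T v - scale c v) = L c" for c by (simp add: L_def fun_eq_iff)
  have Ladd: "L c (u + v) = L c u + L c v" "L c (scale d u) = scale d (L c u)" for c d u v
    by (simp_all add: L_def T scale_right_distrib scale_right_diff_distrib mult.commute)
  have LU: "L c u \<in> U" if "u \<in> U" for c u
    using that by (simp add: L_def U subspace_diff subspace_scale)
  have comm: "L c (L d u) = L d (L c u)" for c d u
    using T(1)[of "T u - scale d u" "scale d u"] T(1)[of "T u - scale c u" "scale c u"]
    by (simp add: L_def T scale_right_diff_distrib algebra_simps)
  have commN: "(L c ^^ n) (L d u) = L d ((L c ^^ n) u)" for c d n u
    by (induction n) (simp_all add: comm)
  have commNM: "(L c ^^ n) ((L d ^^ m) u) = (L d ^^ m) ((L c ^^ n) u)" for c d n m u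
    by (induction m) (simp_all add: commN)
  have L0: "L c 0 = 0" for c using Ladd(2)[of c 0 0] by simp
  have LN0: "(L c ^^ n) 0 = 0" for c n by (induction n) (simp_all add: L0)
  have LNadd: "(L c ^^ n) (u + v) = (L c ^^ n) u + (L c ^^ n) v" for c n u v
    by (induction n) (simp_all add: Ladd)
  have LNsum: "(L c ^^ n) (sum f A) = (\<Sum>x\<in>A. (L c ^^ n) (f x))" for c n f and A :: "'a set"
    by (induction A rule: infinite_finite_induct) (simp_all add: LN0 LNadd)
  have LNU: "(L c ^^ n) u \<in> U" if "u \<in> U" for c n u
    using that by (induction n) (simp_all add: LU)
  have "(L b ^^ N) (\<Sum>a\<in>insert b I. u a) \<in> U" using insert.prems(2) by (rule LNU)
  then have "(\<Sum>a\<in>I. (L b ^^ N) (u a)) \<in> U"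
    using insert.hyps insert.prems(1)[of b] by (simp add: LNsum LNadd L)
  moreover have "(L a ^^ N) ((L b ^^ N) (u a)) = 0" if "a \<in> I" for a
    unfolding commNM[of N a] using insert.prems(1)[of a] that by (simp add: L LN0)
  ultimately have "\<forall>a\<in>I. (L b ^^ N) (u a) \<in> U"
    using insert.IH[of "\<lambda>a. (L b ^^ N) (u a)"] by (simp add: L)
  then have uI: "u a \<in> U" if "a \<in> I" for a
    using generalized_eigenvector_in_subspace[OF U T, of a b N "u a" N] insert that by (auto simp: L)
  then have "(\<Sum>a\<in>insert b I. u a) - (\<Sum>a\<in>I. u a) \<in> U"
    using uI by (intro subspace_diff[OF U(1) insert.prems(2)] subspace_sum[OF U(1)])
  then have "u b \<in> U" using insert.hyps by simp
  then show ?case using uI by simp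
qed simp

end

definition cscale :: "complex \<Rightarrow> complex ^ 'i ^ 'i \<Rightarrow> complex ^ 'i ^ 'i" where
  "cscale c M = (\<chi> i j. c * M $ i $ j)"

lemma cscale_nth [simp]: "cscale c M $ i $ j = c * M $ i $ j"
  by (simp add: cscale_def)

interpretation cscale: vector_space cscale
  by standard (simp_all add: cart_eq_iff algebra_simps)

lemma matrix_mult_nth: "(A ** B) $ i $ j = (\<Sum>k\<in>UNIV. A $ i $ k * B $ k $ j)"
  by (simp add: matrix_matrix_mult_def)

lemma matrix_mult_distribs:
  fixes A B C :: "complex ^ 'i ^ 'i"
  shows "A ** (B + C) = A ** B + A ** C" "(B + C) ** A = B ** A + C ** A"
    "A ** (B - C) = A ** B - A ** C" "(B - C) ** A = B ** A - C ** A"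
    "A ** cscale c B = cscale c (A ** B)" "cscale c B ** A = cscale c (B ** A)"
  by (simp_all add: cart_eq_iff matrix_mult_nth algebra_simps sum.distrib sum_subtractf sum_distrib_left)

text \<open>
  Matrices supported at positions \<open>(i, j)\<close> with \<open>J\<^sub>i\<^sub>i - J\<^sub>j\<^sub>j = \<nu>\<close> are generalized eigenvectors of the
  commutator with \<open>J\<close>: there the diagonal part of \<open>J\<close> acts as \<open>\<nu>\<close>, and its off-diagonal part moves the
  support strictly away from the lower left corner. The offset \<open>R\<close> keeps the bookkeeping in the natural
  numbers.
\<close>

lemma commutator_triangular_nilpotent:
  fixes J w :: "complex ^ 'i ^ 'i" and r :: "'i \<Rightarrow> nat"
  assumes J: "\<And>i j. J $ i $ j \<noteq> 0 \<Longrightarrow> r i \<le> r j \<and> J $ i $ i = J $ j $ j" and r: "inj r" "\<And>i. r i < R"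
    and w: "\<And>i j. w $ i $ j \<noteq> 0 \<Longrightarrow> J $ i $ i - J $ j $ j = \<nu>"
  shows "((\<lambda>v. (J ** v - v ** J) - cscale \<nu> v) ^^ (2 * R)) w = 0"
proof -
  define L where "L v = (J ** v - v ** J) - cscale \<nu> v" for v
  define S where "S c v \<longleftrightarrow> (\<forall>i j. v $ i $ j \<noteq> 0 \<longrightarrow> J $ i $ i - J $ j $ j = \<nu> \<and> r i + c \<le> r j + R)"
    for c and v :: "complex ^ 'i ^ 'i"
  have step: "S (Suc c) (L v)" if v: "S c v" for c v
    unfolding S_def
  proof (intro allI impI)
    fix i j assume nz: "L v $ i $ j \<noteq> 0"
    have d1: "(\<Sum>k\<in>UNIV. J $ i $ k * v $ k $ j) =
        J $ i $ i * v $ i $ j + (\<Sum>k\<in>UNIV - {i}. J $ i $ k * v $ k $ j)"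
      by (rule sum.remove) auto
    have d2: "(\<Sum>k\<in>UNIV. v $ i $ k * J $ k $ j) =
        v $ i $ j * J $ j $ j + (\<Sum>k\<in>UNIV - {j}. v $ i $ k * J $ k $ j)"
      by (rule sum.remove) auto
    have "(J $ i $ i - J $ j $ j) * v $ i $ j = \<nu> * v $ i $ j"
      using v by (cases "v $ i $ j = 0") (auto simp: S_def)
    then have Lv: "L v $ i $ j = (\<Sum>k\<in>UNIV - {i}. J $ i $ k * v $ k $ j) - (\<Sum>k\<in>UNIV - {j}. v $ i $ k * J $ k $ j)"
      unfolding L_def vector_minus_component matrix_mult_nth cscale_nth d1 d2 by (simp add: algebra_simps)
    from nz consider k where "k \<noteq> i" "J $ i $ k \<noteq> 0" "v $ k $ j \<noteq> 0"
      | k where "k \<noteq> j" "v $ i $ k \<noteq> 0" "J $ k $ j \<noteq> 0"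
    proof (cases "(\<Sum>k\<in>UNIV - {i}. J $ i $ k * v $ k $ j) = 0")
      case True
      then have "(\<Sum>k\<in>UNIV - {j}. v $ i $ k * J $ k $ j) \<noteq> 0" using nz Lv by simp
      then obtain k where "k \<in> UNIV - {j}" "v $ i $ k * J $ k $ j \<noteq> 0" by (rule sum.not_neutral_contains_not_neutral)
      then show thesis using that(2) by auto
    next
      case False
      then obtain k where "k \<in> UNIV - {i}" "J $ i $ k * v $ k $ j \<noteq> 0" by (rule sum.not_neutral_contains_not_neutral)
      then show thesis using that(1) by auto
    qed
    then show "J $ i $ i - J $ j $ j = \<nu> \<and> r i + Suc c \<le> r j + R"
    proof cases
      case 1
      have "r i \<noteq> r k" using 1(1) r(1) by (auto dest: injD)
      then have "r i < r k" "J $ i $ i = J $ k $ k" using J[OF 1(2)] by auto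
      moreover have "J $ k $ k - J $ j $ j = \<nu>" "r k + c \<le> r j + R" using v 1(3) by (auto simp: S_def)
      ultimately show ?thesis by simp
    next
      case 2
      have "r j \<noteq> r k" using 2(1) r(1) by (auto dest: injD)
      then have "r k < r j" "J $ k $ k = J $ j $ j" using J[OF 2(3)] by auto
      moreover have "J $ i $ i - J $ k $ k = \<nu>" "r i + c \<le> r k + R" using v 2(2) by (auto simp: S_def)
      ultimately show ?thesis by simp
    qed
  qed
  have "S n ((L ^^ n) w)" for n
  proof (induction n)
    case 0
    show ?case unfolding S_def
      using w r(2) by (simp add: less_imp_le trans_le_add2)
  qed (simp add: step)
  from this[of "2 * R"] have "(L ^^ (2 * R)) w $ i $ j = 0" for i j
    unfolding S_def using r(2)[of i] r(2)[of j] by force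
  then have "(L ^^ (2 * R)) w = 0" by (simp add: cart_eq_iff)
  then show ?thesis by (simp add: L_def[abs_def])
qed

lemma matrix_vector_mult_nth: "(A *v v) $ i = (\<Sum>k\<in>UNIV. A $ i $ k * v $ k)"
  by (simp add: matrix_vector_mult_def)

lemma strictly_triangular_nilpotent:
  fixes J :: "complex ^ 'i ^ 'i" and r :: "'i \<Rightarrow> nat"
  assumes J: "\<And>i j. J $ i $ j \<noteq> 0 \<Longrightarrow> r i < r j" and r: "\<And>i. r i < R"
  shows "((*v) J ^^ R) v = 0"
proof -
  have "(((*v) J ^^ n) v) $ i \<noteq> 0 \<Longrightarrow> r i + n < R" for n i
  proof (induction n arbitrary: i)
    case (Suc n)
    have "(\<Sum>k\<in>UNIV. J $ i $ k * ((*v) J ^^ n) v $ k) \<noteq> 0"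
      using Suc.prems unfolding funpow.simps comp_apply matrix_vector_mult_nth .
    then obtain k where "J $ i $ k * ((*v) J ^^ n) v $ k \<noteq> 0" by (rule sum.not_neutral_contains_not_neutral)
    then have "r i < r k" "r k + n < R" using J[of i k] Suc.IH[of k] by auto
    then show ?case by simp
  qed (use r in auto)
  from this[of R] show ?thesis by (auto simp: cart_eq_iff)
qed

lemma triangular_nilpotent_diagonal:
  fixes J :: "complex ^ 'i ^ 'i" and r :: "'i \<Rightarrow> nat"
  assumes J: "\<And>i j. J $ i $ j \<noteq> 0 \<Longrightarrow> r i \<le> r j" and r: "inj r" and nil: "\<And>v. ((*v) J ^^ N) v = 0"
  shows "J $ i $ i = 0"
proof -
  have "(\<forall>k. ((*v) J ^^ n) (axis i 1) $ k \<noteq> 0 \<longrightarrow> r k \<le> r i) \<and> ((*v) J ^^ n) (axis i 1) $ i = (J $ i $ i) ^ n" for n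
  proof (induction n)
    case 0
    show ?case by (auto simp: axis_def)
  next
    case (Suc n)
    define w where "w = ((*v) J ^^ n) (axis i 1)"
    have w: "w $ k \<noteq> 0 \<Longrightarrow> r k \<le> r i" "w $ i = (J $ i $ i) ^ n" for k using Suc by (auto simp: w_def)
    have "r k \<le> r i" if "(J *v w) $ k \<noteq> 0" for k
    proof -
      have "(\<Sum>l\<in>UNIV. J $ k $ l * w $ l) \<noteq> 0" using that by (simp add: matrix_vector_mult_def)
      then obtain l where "J $ k $ l * w $ l \<noteq> 0" by (rule sum.not_neutral_contains_not_neutral)
      then show ?thesis using J[of k l] w(1)[of l] by auto
    qed
    moreover have "(J *v w) $ i = (J $ i $ i) ^ Suc n"
    proof -
      have "J $ i $ l * w $ l = 0" if "l \<noteq> i" for l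
      proof (rule ccontr)
        assume "J $ i $ l * w $ l \<noteq> 0"
        then have "r i = r l" using J[of i l] w(1)[of l] by auto
        then show False using r that by (auto dest: injD)
      qed
      then have "(\<Sum>l\<in>UNIV. J $ i $ l * w $ l) = (\<Sum>l\<in>{i}. J $ i $ l * w $ l)"
        by (intro sum.mono_neutral_right) auto
      then show ?thesis by (simp add: matrix_vector_mult_def w)
    qed
    ultimately show ?case by (simp add: w_def)
  qed
  from this[of N] show ?thesis using nil by simp
qed

lemma conj_funpow:
  assumes "\<And>v. f (g v) = g (h v)"
  shows "(f ^^ n) (g v) = g ((h ^^ n) v)"
  by (induction n) (simp_all add: assms)


lemma matrix_mult_sum:
  fixes P Q :: "complex ^ 'i ^ 'i"
  shows "(\<Sum>x\<in>A. P ** f x ** Q) = P ** (\<Sum>x\<in>A. f x) ** Q"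
proof (induction A rule: infinite_finite_induct)
  case (insert x F)
  then show ?case by (simp add: matrix_mult_distribs)
qed (simp_all add: cart_eq_iff matrix_mult_nth)

lemma nilpotent_trace_zero:
  fixes A :: "complex ^ 'i ^ 'i"
  assumes "\<And>v. ((*v) A ^^ N) v = 0"
  shows "trace A = 0"
proof -
  obtain P Q J r where PQ: "P ** Q = mat 1" "Q ** P = mat 1" and A: "A = P ** J ** Q"
    and r: "inj (r :: 'i \<Rightarrow> nat)"
    and J: "\<And>i j. J $ i $ j \<noteq> 0 \<Longrightarrow> r i \<le> r j \<and> J $ i $ i = J $ j $ j"
    using triangular_form[of A] by blast
  have "A *v (P *v v) = P *v (J *v v)" for v
    by (simp add: A matrix_vector_mul_assoc matrix_mul_assoc[symmetric] PQ)
  then have "((*v) A ^^ N) (P *v v) = P *v ((*v) J ^^ N) v" for v by (rule conj_funpow)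
  then have "P *v ((*v) J ^^ N) v = 0" for v using assms by metis
  then have "Q *v (P *v ((*v) J ^^ N) v) = 0" for v by simp
  then have "((*v) J ^^ N) v = 0" for v by (simp add: matrix_vector_mul_assoc PQ)
  then have "J $ i $ i = 0" for i using triangular_nilpotent_diagonal[of J r N] J r by blast
  then have "trace J = 0" by (simp add: trace_def)
  moreover have "trace A = trace J"
    using trace_mul_sym[of "P ** J" Q] by (simp add: A matrix_mul_assoc PQ)
  ultimately show ?thesis by simp
qed

text \<open>
  If \<open>A = P J Q\<close> with \<open>J\<close> in triangular form, then \<open>S = P D Q\<close> for the conjugate diagonal \<open>D\<close> of \<open>J\<close>.
  On the component of eigenvalue \<open>\<nu>\<close> of the commutator with \<open>A\<close>, the commutator with \<open>S\<close> is multiplication by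
  the conjugate of \<open>\<nu>\<close>, so \<open>S\<close> normalizes every subspace that \<open>A\<close> normalizes. The trace of \<open>A S\<close> is the
  sum of the squared absolute values of the eigenvalues of \<open>A\<close>.
\<close>

theorem complex_conjugate_part:
  fixes A :: "complex ^ 'i ^ 'i"
  obtains S :: "complex ^ 'i ^ 'i" where
    "\<And>U u. cscale.subspace U \<Longrightarrow> (\<And>v. v \<in> U \<Longrightarrow> A ** v - v ** A \<in> U) \<Longrightarrow> u \<in> U \<Longrightarrow> S ** u - u ** S \<in> U"
    "Re (trace (A ** S)) = 0 \<Longrightarrow> \<exists>N. \<forall>v. ((*v) A ^^ N) v = 0"
proof -
  obtain P Q J r where PQ: "P ** Q = mat 1" "Q ** P = mat 1" and A: "A = P ** J ** Q"
    and r: "inj (r :: 'i \<Rightarrow> nat)"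
    and J: "\<And>i j. J $ i $ j \<noteq> 0 \<Longrightarrow> r i \<le> r j \<and> J $ i $ i = J $ j $ j"
    using triangular_form[of A] by blast
  \<comment> \<open>Any bound for the enumeration works.\<close>
  define R where "R = Suc (Max (range r))"
  have R: "r i < R" for i by (simp add: R_def less_Suc_eq_le)
  have cancel: "P ** (Q ** X) = X" "Q ** (P ** X) = X" for X :: "complex ^ 'i ^ 'i"
    by (simp_all add: matrix_mul_assoc PQ)
  note assoc = matrix_mul_assoc[symmetric]
  define l where "l i = J $ i $ i" for i
  define D :: "complex ^ 'i ^ 'i" where "D = (\<chi> i j. if i = j then cnj (l i) else 0)"
  define S where "S = P ** D ** Q"
  have DX: "(D ** X) $ i $ j = cnj (l i) * X $ i $ j" "(X ** D) $ i $ j = X $ i $ j * cnj (l j)" for X i j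
    by (simp_all add: matrix_mult_nth D_def if_distrib if_distribR cong: if_cong)
  show thesis
  proof (rule that[of S])
    fix U u assume U: "cscale.subspace U" "\<And>v. v \<in> U \<Longrightarrow> A ** v - v ** A \<in> U" and u: "u \<in> U"
    define w where "w = Q ** u ** P"
    \<comment> \<open>The eigencomponents of \<open>u\<close> in the basis where \<open>A\<close> is triangular.\<close>
    define w' where "w' \<nu> = (\<chi> i j. if l i - l j = \<nu> then w $ i $ j else 0)" for \<nu>
    define I where "I = (\<lambda>(i, j). l i - l j) ` UNIV"
    define c where "c \<nu> = P ** w' \<nu> ** Q" for \<nu>
    have sum_w': "(\<Sum>\<nu>\<in>I. w' \<nu>) = w"
    proof -
      have "(\<Sum>\<nu>\<in>I. w' \<nu>) $ i $ j = w $ i $ j" for i j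
      proof -
        have "l i - l j \<in> I" by (auto simp: I_def)
        then show ?thesis by (simp add: w'_def I_def sum.delta')
      qed
      then show ?thesis by (simp add: cart_eq_iff)
    qed
    have sum_c: "(\<Sum>\<nu>\<in>I. c \<nu>) = u"
      by (simp add: c_def matrix_mult_sum sum_w') (simp add: w_def assoc cancel PQ)
    have "((\<lambda>v. (A ** v - v ** A) - cscale \<nu> v) ^^ (2 * R)) (c \<nu>) = 0" for \<nu>
    proof -
      have "(A ** (P ** v ** Q) - (P ** v ** Q) ** A) - cscale \<nu> (P ** v ** Q)
          = P ** ((J ** v - v ** J) - cscale \<nu> v) ** Q" for v
        by (simp add: A matrix_mult_distribs) (simp add: assoc cancel)
      from conj_funpow[where f = "\<lambda>v. (A ** v - v ** A) - cscale \<nu> v" and g = "\<lambda>v. P ** v ** Q", OF this]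
      have "((\<lambda>v. (A ** v - v ** A) - cscale \<nu> v) ^^ (2 * R)) (c \<nu>) =
          P ** ((\<lambda>v. (J ** v - v ** J) - cscale \<nu> v) ^^ (2 * R)) (w' \<nu>) ** Q"
        by (simp add: c_def)
      also have "((\<lambda>v. (J ** v - v ** J) - cscale \<nu> v) ^^ (2 * R)) (w' \<nu>) = 0"
        by (rule commutator_triangular_nilpotent[where r = r, OF J r R])
           (auto simp: w'_def l_def split: if_splits)
      finally show ?thesis by (simp add: cart_eq_iff matrix_mult_nth)
    qed
    then have cU: "\<forall>\<nu>\<in>I. c \<nu> \<in> U"
      by (intro cscale.generalized_eigencomponents_in_subspace[where T = "\<lambda>v. A ** v - v ** A", OF U])
         (simp_all add: matrix_mult_distribs cscale.scale_right_diff_distrib sum_c u, simp add: I_def)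
    have "S ** c \<nu> - c \<nu> ** S = cscale (cnj \<nu>) (c \<nu>)" for \<nu>
    proof -
      have "D ** w' \<nu> - w' \<nu> ** D = cscale (cnj \<nu>) (w' \<nu>)"
        by (auto simp: cart_eq_iff DX w'_def algebra_simps)
      moreover have "S ** c \<nu> - c \<nu> ** S = P ** (D ** w' \<nu> - w' \<nu> ** D) ** Q"
        by (simp add: matrix_mult_distribs S_def c_def) (simp add: assoc cancel)
      ultimately show ?thesis by (simp add: matrix_mult_distribs c_def)
    qed
    moreover have "S ** u - u ** S = (\<Sum>\<nu>\<in>I. S ** c \<nu> - c \<nu> ** S)"
      unfolding sum_subtractf using matrix_mult_sum[of S c "mat 1" I]
        matrix_mult_sum[of "mat 1" c S I]
      by (simp add: sum_c)
    ultimately have "S ** u - u ** S = (\<Sum>\<nu>\<in>I. cscale (cnj \<nu>) (c \<nu>))" by simp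
    also have "\<dots> \<in> U" by (intro cscale.subspace_sum U cscale.subspace_scale cU[rule_format])
    finally show "S ** u - u ** S \<in> U" .
  next
    assume zero: "Re (trace (A ** S)) = 0"
    have "A ** S = (P ** (J ** D)) ** Q" by (simp add: A S_def assoc cancel)
    then have "trace (A ** S) = trace (J ** D)"
      using trace_mul_sym[of "P ** (J ** D)" Q] by (simp add: matrix_mul_assoc PQ)
    also have "\<dots> = (\<Sum>i\<in>UNIV. l i * cnj (l i))" by (simp add: trace_def DX l_def)
    finally have "(\<Sum>i\<in>UNIV. (cmod (l i))\<^sup>2) = 0"
      using zero by (simp add: complex_mult_cnj cmod_power2)
    then have "l i = 0" for i by (simp add: sum_nonneg_eq_0_iff)
    then have "J $ i $ j \<noteq> 0 \<Longrightarrow> r i < r j" for i j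
      using J[of i j] r by (cases "i = j") (auto simp: l_def le_less dest: injD)
    from strictly_triangular_nilpotent[where J = J and r = r, OF this R]
    have "((*v) J ^^ R) v = 0" for v by blast
    moreover have "A *v (P *v v) = P *v (J *v v)" for v
      by (simp add: A matrix_vector_mul_assoc matrix_mul_assoc[symmetric] PQ)
    then have "((*v) A ^^ R) (P *v v) = P *v ((*v) J ^^ R) v" for v by (rule conj_funpow)
    ultimately have "((*v) A ^^ R) (P *v (Q *v v)) = 0" for v by simp
    then have "((*v) A ^^ R) v = 0" for v by (simp add: matrix_vector_mul_assoc PQ)
    then show "\<exists>N. \<forall>v. ((*v) A ^^ N) v = 0" by blast
  qed
qed

section \<open>Traces and Cartan's criterion\<close>

text \<open>
  The standard basis as an index type, so that endomorphisms of an abstract Euclidean space have matrices.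
\<close>

typedef (overloaded) 'v basis_index = "Basis :: 'v::euclidean_space set"
  using nonempty_Basis by blast

instance basis_index :: (euclidean_space) finite
proof
  have "inj (Rep_basis_index :: 'a basis_index \<Rightarrow> 'a)" by (simp add: inj_def Rep_basis_index_inject)
  moreover have "range (Rep_basis_index :: 'a basis_index \<Rightarrow> 'a) \<subseteq> Basis" using Rep_basis_index by blast
  ultimately show "finite (UNIV :: 'a basis_index set)" by (rule inj_on_finite) simp
qed

lemma sum_basis_index:
  fixes f :: "'v::euclidean_space \<Rightarrow> 'b::comm_monoid_add"
  shows "(\<Sum>i\<in>UNIV. f (Rep_basis_index i)) = sum f Basis"
proof (rule sum.reindex_bij_betw)
  show "bij_betw (Rep_basis_index :: 'v basis_index \<Rightarrow> 'v) UNIV Basis"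
    unfolding bij_betw_def using Rep_basis_index by (auto simp: inj_def Rep_basis_index_inject elim: Rep_basis_index_cases)
qed

definition tr :: "'v::euclidean_space endo \<Rightarrow> real" where
  "tr f = (\<Sum>b\<in>Basis. app f b \<bullet> b)"

lemmas linear_rules = linear_add linear_scale linear_0 linear_diff

lemma linear_tr: "linear tr"
  by (simp add: linear_iff tr_def inner_add_left sum.distrib sum_distrib_left)

lemma app_expand: "app f v = (\<Sum>b\<in>Basis. (v \<bullet> b) *\<^sub>R app f b)"
proof -
  have "app f v = app f (\<Sum>b\<in>Basis. (v \<bullet> b) *\<^sub>R b)" by (simp add: euclidean_representation)
  then show ?thesis by (simp add: app_sum_right)
qed

lemma tr_mult: "tr (f * g) = (\<Sum>b\<in>Basis. \<Sum>c\<in>Basis. (app g b \<bullet> c) * (app f c \<bullet> b))"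
  unfolding tr_def
proof (rule sum.cong[OF refl])
  fix b :: 'a assume "b \<in> Basis"
  have "app (f * g) b \<bullet> b = (\<Sum>c\<in>Basis. (app g b \<bullet> c) *\<^sub>R app f c) \<bullet> b"
    by (simp add: app_expand[of f "app g b"])
  then show "app (f * g) b \<bullet> b = (\<Sum>c\<in>Basis. (app g b \<bullet> c) * (app f c \<bullet> b))"
    by (simp add: inner_sum_left)
qed

lemma tr_commute: "tr (f * g) = tr (g * f)"
  unfolding tr_mult by (subst sum.swap) (simp add: mult.commute)

lemma tr_bracket: "tr (bracket x z * w) = - tr (z * bracket x w)"
proof -
  have "tr (x * z * w) = tr (z * w * x)" using tr_commute[of x "z * w"] by (simp add: mult.assoc)
  then show ?thesis by (simp add: left_diff_distrib right_diff_distrib linear_diff[OF linear_tr] mult.assoc)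
qed

lemma tr_linear: "linear (\<lambda>x. tr (x * y))" "linear (\<lambda>y. tr (x * y))"
  by (simp_all add: linear_iff distrib_left distrib_right linear_add[OF linear_tr] linear_scale[OF linear_tr])

text \<open>
  The dimension arguments for subspaces of an algebra of endomorphisms need a finite spanning set: the
  matrix units.
\<close>

lemma endo_finite_span: "\<exists>B. finite B \<and> (UNIV :: 'v::euclidean_space endo set) \<subseteq> span B"
proof -
  define E :: "'v \<Rightarrow> 'v \<Rightarrow> 'v endo" where "E b c = endo (\<lambda>v. (v \<bullet> b) *\<^sub>R c)" for b c
  have E: "app (E b c) v = (v \<bullet> b) *\<^sub>R c" for b c v
    unfolding E_def by (subst app_endo) (auto intro!: bounded_linear_intros)
  have "f \<in> span ((\<lambda>(b, c). E b c) ` (Basis \<times> Basis))" for f :: "'v endo"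
  proof -
    have "f = (\<Sum>b\<in>Basis. \<Sum>c\<in>Basis. (app f b \<bullet> c) *\<^sub>R E b c)"
    proof (rule endo_eqI)
      fix v
      have "app (\<Sum>b\<in>Basis. \<Sum>c\<in>Basis. (app f b \<bullet> c) *\<^sub>R E b c) v
          = (\<Sum>b\<in>Basis. (v \<bullet> b) *\<^sub>R (\<Sum>c\<in>Basis. (app f b \<bullet> c) *\<^sub>R c))"
        by (simp add: app_sum E scaleR_sum_right mult.commute)
      then show "app f v = app (\<Sum>b\<in>Basis. \<Sum>c\<in>Basis. (app f b \<bullet> c) *\<^sub>R E b c) v"
        by (simp add: euclidean_representation flip: app_expand)
    qed
    also have "\<dots> \<in> span ((\<lambda>(b, c). E b c) ` (Basis \<times> Basis))"
      by (intro span_sum span_scale span_base) auto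
    finally show ?thesis .
  qed
  moreover have "finite ((\<lambda>(b, c). E b c) ` (Basis \<times> (Basis :: 'v set)))" by simp
  ultimately show ?thesis by blast
qed

definition cmat :: "'v::euclidean_space endo \<Rightarrow> complex ^ 'v basis_index ^ 'v basis_index" where
  "cmat f = (\<chi> i j. complex_of_real (app f (Rep_basis_index j) \<bullet> Rep_basis_index i))"

text \<open>
  The endomorphism with the entrywise real part of a complex matrix.
\<close>

definition rmat :: "complex ^ 'v basis_index ^ 'v basis_index \<Rightarrow> 'v::euclidean_space endo" where
  "rmat M = endo (\<lambda>v. \<Sum>i\<in>UNIV. (\<Sum>j\<in>UNIV. Re (M $ i $ j) * (v \<bullet> Rep_basis_index j)) *\<^sub>R Rep_basis_index i)"

lemma cmat_linear:
  "cmat (f + g) = cmat f + cmat g" "cmat (f - g) = cmat f - cmat g" "cmat 0 = 0"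
  "cmat (c *\<^sub>R f) = cscale (complex_of_real c) (cmat f)"
  by (simp_all add: cmat_def cart_eq_iff inner_add_left inner_diff_left)

lemma cmat_mult: "cmat (f * g) = cmat f ** cmat g"
proof -
  have "app (f * g) c \<bullet> b = (\<Sum>k\<in>UNIV. (app f (Rep_basis_index k) \<bullet> b) * (app g c \<bullet> Rep_basis_index k))" for b c
    using app_expand[of f "app g c"] sum_basis_index[of "\<lambda>k. (app g c \<bullet> k) * (app f k \<bullet> b)"]
    by (simp add: inner_sum_left mult.commute)
  then show ?thesis
    by (simp add: cmat_def cart_eq_iff matrix_mult_nth del: app_mult)
qed

lemma inner_Rep_basis_index: "Rep_basis_index i \<bullet> Rep_basis_index j = (if i = j then 1 else 0)"
  using inner_Basis[OF Rep_basis_index Rep_basis_index, of i j] by (simp add: Rep_basis_index_inject)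

lemma cmat_rmat: "cmat (rmat M) $ i $ j = complex_of_real (Re (M $ i $ j))"
proof -
  have "linear (\<lambda>v::'a. \<Sum>i\<in>UNIV. (\<Sum>j\<in>UNIV. Re (M $ i $ j) * (v \<bullet> Rep_basis_index j)) *\<^sub>R Rep_basis_index i)"
    by (intro linear_compose_sum ballI)
       (simp add: linear_iff inner_add_left algebra_simps sum.distrib scaleR_left_distrib flip: sum_distrib_left)
  then show ?thesis
    by (simp add: cmat_def rmat_def app_endo_linear inner_sum_left inner_Rep_basis_index if_distrib if_distribR cong: if_cong)
qed

lemma cmat_inject:
  assumes "cmat f = cmat g"
  shows "f = g"
proof (rule endo_eqI)
  fix v
  have "app f (Rep_basis_index j) \<bullet> Rep_basis_index i = app g (Rep_basis_index j) \<bullet> Rep_basis_index i" for i j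
    using arg_cong[OF assms, of "\<lambda>M. M $ i $ j"] by (simp add: cmat_def)
  then have eq: "app f b \<bullet> c = app g b \<bullet> c" if "b \<in> Basis" "c \<in> Basis" for b c
    using that by (metis Abs_basis_index_inverse)
  have "app f b = app g b" if "b \<in> Basis" for b
    by (rule euclidean_eqI) (rule eq[OF that])
  then have "(\<Sum>b\<in>Basis. (v \<bullet> b) *\<^sub>R app f b) = (\<Sum>b\<in>Basis. (v \<bullet> b) *\<^sub>R app g b)"
    by (intro sum.cong) auto
  then show "app f v = app g v" by (simp flip: app_expand)
qed

lemma trace_cmat: "trace (cmat f) = complex_of_real (tr f)"
  using sum_basis_index[of "\<lambda>b. app f b \<bullet> b"] by (simp add: trace_def cmat_def tr_def flip: of_real_sum)

definition cvec :: "'v::euclidean_space \<Rightarrow> complex ^ 'v basis_index" where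
  "cvec v = (\<chi> i. complex_of_real (v \<bullet> Rep_basis_index i))"

lemma cmat_cvec: "cmat f *v cvec v = cvec (app f v)"
proof -
  have "app f v \<bullet> b = (\<Sum>k\<in>UNIV. (app f (Rep_basis_index k) \<bullet> b) * (v \<bullet> Rep_basis_index k))" for b
    using app_expand[of f v] sum_basis_index[of "\<lambda>k. (v \<bullet> k) * (app f k \<bullet> b)"]
    by (simp add: inner_sum_left mult.commute)
  then show ?thesis
    by (simp add: cmat_def cvec_def cart_eq_iff matrix_vector_mult_nth)
qed

lemma cvec_eq_0: "cvec v = 0 \<Longrightarrow> v = 0"
proof (rule euclidean_eqI)
  fix b :: 'a assume "cvec v = 0" "b \<in> Basis"
  then show "v \<bullet> b = 0 \<bullet> b"
    using Abs_basis_index_inverse[of b] by (simp add: cvec_def cart_eq_iff) metis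
qed

lemma power_cvec: "((*v) (cmat f) ^^ n) (cvec v) = cvec (app (f ^ n) v)"
  by (induction n) (simp_all add: cmat_cvec)

lemma nilpotent_tr_zero:
  assumes "f ^ N = 0" shows "tr (f :: 'v::euclidean_space endo) = 0"
proof -
  have one: "cmat (1 :: 'v endo) = mat 1"
    by (simp add: cmat_def Finite_Cartesian_Product.mat_def cart_eq_iff inner_Rep_basis_index)
  have "((*v) (cmat f) ^^ n) v = cmat (f ^ n) *v v" for n v
    by (induction n) (simp_all add: one cmat_mult matrix_vector_mul_assoc)
  then have "((*v) (cmat f) ^^ N) v = 0" for v by (simp add: assms cmat_linear)
  from nilpotent_trace_zero[OF this] show ?thesis by (simp add: trace_cmat)
qed

text \<open>
  The real version of \<open>complex_conjugate_part\<close>: apply it to the complexification \<open>UC\<close> of the real subspace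
  \<open>U\<close> and take real parts of entries at the end.
\<close>

theorem conjugate_part:
  fixes x :: "'v::euclidean_space endo"
  obtains s :: "'v endo" where
    "\<And>U u. subspace U \<Longrightarrow> (\<And>v. v \<in> U \<Longrightarrow> x * v - v * x \<in> U) \<Longrightarrow> u \<in> U \<Longrightarrow> s * u - u * s \<in> U"
    "tr (x * s) = 0 \<Longrightarrow> \<exists>N. x ^ N = 0"
proof -
  obtain S where S: "\<And>U u. cscale.subspace U \<Longrightarrow> (\<And>v. v \<in> U \<Longrightarrow> cmat x ** v - v ** cmat x \<in> U) \<Longrightarrow> u \<in> U \<Longrightarrow> S ** u - u ** S \<in> U"
    and nil: "Re (trace (cmat x ** S)) = 0 \<Longrightarrow> \<exists>N. \<forall>v. ((*v) (cmat x) ^^ N) v = 0"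
    using complex_conjugate_part[of "cmat x"] by blast
  have Re_mult: "Re ((S ** cmat u) $ i $ j) = Re ((cmat (rmat S) ** cmat u) $ i $ j)"
    "Re ((cmat u ** S) $ i $ j) = Re ((cmat u ** cmat (rmat S)) $ i $ j)" for u i j
    by (simp_all add: matrix_mult_nth cmat_rmat) (simp_all add: cmat_def)
  show thesis
  proof (rule that[of "rmat S"])
    fix U u assume U: "subspace U" "\<And>v. v \<in> U \<Longrightarrow> x * v - v * x \<in> U" and u: "u \<in> U"
    define UC where "UC = {cmat a + cscale \<i> (cmat b) |a b. a \<in> U \<and> b \<in> U}"
    have UC: "cscale.subspace UC"
    proof (rule cscale.subspaceI)
      have "cmat 0 + cscale \<i> (cmat 0) \<in> UC" unfolding UC_def using subspace_0[OF U(1)] by blast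
      then show "0 \<in> UC" by (simp add: cmat_linear cart_eq_iff)
      fix v assume "v \<in> UC"
      then obtain a b where ab: "v = cmat a + cscale \<i> (cmat b)" "a \<in> U" "b \<in> U" by (auto simp: UC_def)
      show "v + w \<in> UC" if w: "w \<in> UC" for w
      proof -
        obtain c d where cd: "w = cmat c + cscale \<i> (cmat d)" "c \<in> U" "d \<in> U" using w by (auto simp: UC_def)
        have "v + w = cmat (a + c) + cscale \<i> (cmat (b + d))"
          by (simp add: ab cd cmat_linear cart_eq_iff algebra_simps)
        then show ?thesis unfolding UC_def using ab cd subspace_add[OF U(1)] by blast
      qed
      show "cscale c v \<in> UC" for c
      proof -
        have "cscale c v = cmat (Re c *\<^sub>R a - Im c *\<^sub>R b) + cscale \<i> (cmat (Im c *\<^sub>R a + Re c *\<^sub>R b))"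
          by (simp add: ab cmat_linear cart_eq_iff complex_eq_iff)
             (simp add: cmat_def algebra_simps)
        moreover have "Re c *\<^sub>R a - Im c *\<^sub>R b \<in> U" "Im c *\<^sub>R a + Re c *\<^sub>R b \<in> U"
          using ab U(1) by (auto intro!: subspace_add subspace_diff subspace_scale)
        ultimately show ?thesis unfolding UC_def by blast
      qed
    qed
    have "cmat x ** v - v ** cmat x \<in> UC" if v: "v \<in> UC" for v
    proof -
      obtain a b where ab: "v = cmat a + cscale \<i> (cmat b)" "a \<in> U" "b \<in> U" using v by (auto simp: UC_def)
      have "cmat x ** v - v ** cmat x = cmat (x * a - a * x) + cscale \<i> (cmat (x * b - b * x))"
        by (simp add: ab(1) matrix_mult_distribs cmat_linear cmat_mult cscale.scale_right_diff_distrib)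
      then show ?thesis unfolding UC_def using U(2) ab by blast
    qed
    moreover have "cmat u \<in> UC"
    proof -
      have "cmat u = cmat u + cscale \<i> (cmat 0)" by (simp add: cmat_linear cart_eq_iff)
      then show ?thesis unfolding UC_def using u subspace_0[OF U(1)] by blast
    qed
    ultimately have "S ** cmat u - cmat u ** S \<in> UC" using S[OF UC] by blast
    then obtain a b where ab: "S ** cmat u - cmat u ** S = cmat a + cscale \<i> (cmat b)" "a \<in> U" by (auto simp: UC_def)
    have "Re (cmat (rmat S * u - u * rmat S) $ i $ j) = Re (cmat a $ i $ j)" for i j
    proof -
      have "Re (cmat (rmat S * u - u * rmat S) $ i $ j) = Re ((S ** cmat u - cmat u ** S) $ i $ j)"
        by (simp add: cmat_linear cmat_mult Re_mult)
      also have "\<dots> = Re (cmat a $ i $ j)" unfolding ab(1) by (simp add: cmat_def)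
      finally show ?thesis .
    qed
    then have "cmat (rmat S * u - u * rmat S) = cmat a" by (simp add: cmat_def cart_eq_iff)
    then have "rmat S * u - u * rmat S = a" by (rule cmat_inject)
    then show "rmat S * u - u * rmat S \<in> U" using ab(2) by simp
  next
    assume "tr (x * rmat S) = 0"
    then have "Re (trace (cmat x ** cmat (rmat S))) = 0" by (simp add: trace_cmat flip: cmat_mult)
    then have "Re (trace (cmat x ** S)) = 0" by (simp add: trace_def Re_mult)
    from nil[OF this] obtain N where "\<forall>v. ((*v) (cmat x) ^^ N) v = 0" by blast
    then have "cvec (app (x ^ N) v) = 0" for v by (metis power_cvec)
    then have "x ^ N = 0" by (intro endo_eqI) (simp add: cvec_eq_0)
    then show "\<exists>N. x ^ N = 0" by blast
  qed
qed

text \<open>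
  Every \<open>x\<close> in \<open>h\<close> is nilpotent. With the conjugate part \<open>s\<close> of \<open>x\<close>, the trace of \<open>[u, v] s\<close> equals that of
  \<open>u [v, s]\<close>, which vanishes because \<open>[v, s]\<close> lies in \<open>h\<close> again. As \<open>x\<close> is a sum of brackets, the trace of
  \<open>x s\<close> vanishes. Engel's theorem and perfectness then leave only \<open>0\<close>.
\<close>

theorem cartan_perfect:
  fixes h :: "'v::euclidean_space endo set"
  assumes h: "subspace h" "\<And>x y. x \<in> h \<Longrightarrow> y \<in> h \<Longrightarrow> x * y - y * x \<in> h"
    and perfect: "h \<subseteq> span (brackets h)"
    and tr: "\<And>x y. x \<in> h \<Longrightarrow> y \<in> h \<Longrightarrow> tr (x * y) = 0"
  shows "h \<subseteq> {0}"
proof -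
  have nil: "\<exists>N. x ^ N = 0" if x: "x \<in> h" for x
  proof -
    obtain s where s: "\<And>U u. subspace U \<Longrightarrow> (\<And>v. v \<in> U \<Longrightarrow> x * v - v * x \<in> U) \<Longrightarrow> u \<in> U \<Longrightarrow> s * u - u * s \<in> U"
      and nil: "tr (x * s) = 0 \<Longrightarrow> \<exists>N. x ^ N = 0"
      using conjugate_part[of x] by blast
    have "tr (x * s) = 0"
    proof -
      have "tr (x * s) \<in> span {0}"
      proof (rule span_map[where f = "\<lambda>z. tr (z * s)", OF _ _ subsetD[OF perfect x]])
        show "linear (\<lambda>z. tr (z * s))"
          by (simp add: linear_iff distrib_right linear_add[OF linear_tr] linear_scale[OF linear_tr])
        fix z assume "z \<in> brackets h"
        then obtain u v where z: "z = u * v - v * u" "u \<in> h" "v \<in> h" by blast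
        have "s * v - v * s \<in> h" by (rule s) (use h x z in auto)
        then have "v * s - s * v \<in> h" using subspace_neg[OF h(1)] by fastforce
        then have "tr (u * (v * s - s * v)) = 0" by (rule tr[OF z(2)])
        moreover have "tr (v * u * s) = tr (u * (s * v))"
          using tr_commute[of v "u * s"] by (simp add: mult.assoc)
        ultimately have "tr (z * s) = 0"
          by (simp add: z left_diff_distrib right_diff_distrib linear_diff[OF linear_tr] mult.assoc)
        then show "tr (z * s) \<in> span {0}" by simp
      qed
      then show ?thesis by simp
    qed
    then show ?thesis by (rule nil)
  qed
  obtain B where "finite B" "h \<subseteq> span (B :: 'v endo set)" using endo_finite_span by blast
  from engel[OF h(1) this h(2) nil] obtain N where "prods h N \<subseteq> {0}" by blast
  then show ?thesis using perfect by (rule perfect_nilpotent_trivial)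
qed

section \<open>Semisimple Lie algebras and their first cohomology\<close>

text \<open>
  Gram-Schmidt for a possibly indefinite form: polarization provides a vector \<open>b\<close> with \<open>B b b \<noteq> 0\<close>, and its
  orthogonal space carries a nondegenerate form of smaller dimension. That every \<open>x\<close> has the stated expansion
  forces \<open>D\<close> to be an orthogonal basis of \<open>s\<close>.
\<close>

lemma orthogonal_basis:
  fixes B :: "'a::real_vector \<Rightarrow> 'a \<Rightarrow> real"
  assumes "finite F" "s \<subseteq> span F" "subspace s"
    and lin: "\<And>y. linear (\<lambda>x. B x y)" "\<And>x. linear (\<lambda>y. B x y)" and sym: "\<And>x y. B x y = B y x"
    and "\<And>x. x \<in> s \<Longrightarrow> (\<forall>y\<in>s. B x y = 0) \<Longrightarrow> x = 0"
  shows "\<exists>D. finite D \<and> D \<subseteq> s \<and> (\<forall>b\<in>D. B b b \<noteq> 0) \<and>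
    (\<forall>x\<in>s. x = (\<Sum>b\<in>D. (B x b / B b b) *\<^sub>R b))"
  using assms(2,3,7)
proof (induction "dim s" arbitrary: s rule: less_induct)
  case less
  note add = linear_add[OF lin(1)] linear_scale[OF lin(1)] linear_diff[OF lin(1)]
  note add2 = linear_add[OF lin(2)] linear_scale[OF lin(2)] linear_diff[OF lin(2)]
  show ?case
  proof (cases "\<forall>b\<in>s. B b b = 0")
    case True
    have "x = 0" if x: "x \<in> s" for x
    proof (rule less.prems(3)[OF x], rule ballI)
      fix y assume y: "y \<in> s"
      have "B (x + y) (x + y) = 0" using True subspace_add[OF less.prems(2) x y] by blast
      then show "B x y = 0" using True x y sym[of y x] by (simp add: add add2)
    qed
    then show ?thesis by (intro exI[of _ "{}"]) auto
  next
    case False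
    then obtain b where b: "b \<in> s" "B b b \<noteq> 0" by blast
    define s' where "s' = {x \<in> s. B x b = 0}"
    have ss': "subspace s'"
      unfolding s'_def
      by (rule subspaceI) (simp_all add: add linear_0[OF lin(1)] subspace_0[OF less.prems(2)]
          subspace_add[OF less.prems(2)] subspace_scale[OF less.prems(2)])
    have dec: "y - (B y b / B b b) *\<^sub>R b \<in> s'" if "y \<in> s" for y
      unfolding s'_def using that b
      by (simp add: add subspace_diff[OF less.prems(2)] subspace_scale[OF less.prems(2)])
    have dim': "dim s' < dim s"
      by (rule dim_strict_mono[OF assms(1) less.prems(1) ss']) (use b in \<open>auto simp: s'_def\<close>)
    have span': "s' \<subseteq> span F" using less.prems(1) by (auto simp: s'_def)
    have nondeg': "x = 0" if x: "x \<in> s'" "\<forall>y\<in>s'. B x y = 0" for x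
    proof (rule less.prems(3))
      show "\<forall>y\<in>s. B x y = 0"
      proof
        fix y assume "y \<in> s"
        then have "B x (y - (B y b / B b b) *\<^sub>R b) = 0" using x(2) dec by blast
        then show "B x y = 0" using x(1) by (simp add: add2 s'_def)
      qed
    qed (use x in \<open>simp add: s'_def\<close>)
    obtain D where D: "finite D" "D \<subseteq> s'" "\<forall>b\<in>D. B b b \<noteq> 0"
      "\<forall>x\<in>s'. x = (\<Sum>b\<in>D. (B x b / B b b) *\<^sub>R b)"
      using less.hyps[OF dim' span' ss' nondeg'] by blast
    have bD: "b \<notin> D" using D(2) b(2) by (auto simp: s'_def)
    have "x = (\<Sum>c\<in>insert b D. (B x c / B c c) *\<^sub>R c)" if x: "x \<in> s" for x
    proof -
      define x' where "x' = x - (B x b / B b b) *\<^sub>R b"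
      have "B x' c = B x c" if "c \<in> D" for c
      proof -
        have "B c b = 0" using D(2) that by (auto simp: s'_def)
        then show ?thesis using sym[of b c] by (simp add: x'_def add)
      qed
      then have "(\<Sum>c\<in>D. (B x' c / B c c) *\<^sub>R c) = (\<Sum>c\<in>D. (B x c / B c c) *\<^sub>R c)"
        by (intro sum.cong) auto
      moreover have "x' = (\<Sum>c\<in>D. (B x' c / B c c) *\<^sub>R c)" using D(4) dec[OF x] by (simp add: x'_def)
      ultimately have "x = (B x b / B b b) *\<^sub>R b + (\<Sum>c\<in>D. (B x c / B c c) *\<^sub>R c)"
        unfolding x'_def by (metis add.commute diff_add_cancel)
      then show ?thesis using D(1) bD by simp
    qed
    then show ?thesis
      using D(1-3) b by (intro exI[of _ "insert b D"]) (auto simp: s'_def)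
  qed
qed

text \<open>
  The projection onto the part where \<open>C\<close> is invertible. The spans of the powers \<open>C\<^sup>i\<close> with \<open>i \<ge> k\<close> decrease
  with \<open>k\<close>, hence stabilize, so \<open>C\<^sup>k = C\<^bsup>k+1\<^esup> D\<close> for a polynomial \<open>D\<close> in \<open>C\<close>. Then \<open>C\<^sup>n = C\<^bsup>2n\<^esup> D\<^sup>n\<close> for
  \<open>n > k\<close>, and \<open>P = C\<^sup>n D\<^sup>n\<close> is idempotent.
\<close>

lemma fitting_idempotent:
  fixes C :: "'a::real_algebra_1"
  assumes "finite F" "UNIV \<subseteq> span (F :: 'a set)"
  obtains P E where "P * P = P" "P = E * C"
    "\<And>x. x * C = C * x \<Longrightarrow> x * P = P * x" "\<And>x. x * C = C * x \<Longrightarrow> x * E = E * x"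
    "P = 0 \<Longrightarrow> \<exists>k. C ^ k = 0"
proof -
  define R where "R k = span {C ^ i |i. k \<le> i}" for k
  have R_mono: "R (Suc k) \<subseteq> R k" for k
    unfolding R_def by (rule span_mono) (auto dest: Suc_leD)
  have "\<exists>k. C ^ k \<in> R (Suc k)"
  proof (rule ccontr)
    assume contra: "\<not> ?thesis"
    have "dim (R (Suc k)) < dim (R k)" for k
    proof (rule dim_strict_mono[OF assms(1)])
      have "C ^ k \<in> R k" unfolding R_def by (rule span_base) auto
      then show "R (Suc k) \<subset> R k" using contra R_mono[of k] by blast
    qed (use assms(2) in \<open>auto simp: R_def\<close>)
    then have "dim (R k) + k \<le> dim (R 0)" for k
    proof (induction k)
      case (Suc k)
      from Suc.prems[of k] Suc.IH[OF Suc.prems] show ?case by simp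
    qed simp
    from this[of "Suc (dim (R 0))"] show False by simp
  qed
  then obtain k where k: "C ^ k \<in> R (Suc k)" by blast
  have "{C ^ i |i. Suc k \<le> i} = (*) (C ^ Suc k) ` range (\<lambda>i. C ^ i)"
  proof (intro equalityI subsetI)
    fix y assume "y \<in> {C ^ i |i. Suc k \<le> i}"
    then obtain i where i: "y = C ^ i" "Suc k \<le> i" by blast
    have "C ^ Suc k * C ^ (i - Suc k) = C ^ i" unfolding power_add[symmetric] using i(2) by simp
    then show "y \<in> (*) (C ^ Suc k) ` range (\<lambda>i. C ^ i)" using i(1) by (intro image_eqI[of _ _ "C ^ (i - Suc k)"]) auto
  next
    fix y assume "y \<in> (*) (C ^ Suc k) ` range (\<lambda>i. C ^ i)"
    then obtain i where "y = C ^ Suc k * C ^ i" by auto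
    then have "y = C ^ (Suc k + i)" unfolding power_add .
    then show "y \<in> {C ^ i |i. Suc k \<le> i}" by (intro CollectI exI[of _ "Suc k + i"]) simp
  qed
  moreover have lin: "linear ((*) (C ^ Suc k))" by (simp add: linear_iff distrib_left)
  ultimately have "C ^ k \<in> (*) (C ^ Suc k) ` span (range (\<lambda>i. C ^ i))"
    using k unfolding R_def by (simp only: linear_span_image[OF lin])
  then obtain D where D: "D \<in> span (range (\<lambda>i. C ^ i))" "C ^ k = C ^ Suc k * D" by auto
  have comm_power: "x * y ^ n = y ^ n * x" if "x * y = y * x" for x y :: 'a and n
  proof (induction n)
    case (Suc n)
    have "x * y ^ Suc n = (x * y) * y ^ n" by (simp add: mult.assoc)
    also have "\<dots> = y * (x * y ^ n)" by (simp add: that mult.assoc)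
    also have "\<dots> = y ^ Suc n * x" by (simp add: Suc mult.assoc)
    finally show ?case .
  qed simp
  have commD: "x * D = D * x" if x: "x * C = C * x" for x
  proof -
    have "x * D - D * x \<in> span {0}"
      using comm_power[OF x]
      by (intro span_map[where f = "\<lambda>D. x * D - D * x", OF _ _ D(1)])
         (auto simp: linear_iff distrib_left distrib_right scaleR_diff_right)
    then show ?thesis by simp
  qed
  \<comment> \<open>A positive exponent, so that a factor \<open>C\<close> can be split off from \<open>P\<close>.\<close>
  define n where "n = Suc k"
  have n1: "C ^ n = C ^ Suc n * D" using D(2) by (simp add: n_def mult.assoc)
  have nj: "C ^ n = C ^ (n + j) * D ^ j" for j
  proof (induction j)
    case (Suc j)
    have "C ^ (n + j) = C ^ j * C ^ n" by (simp add: power_add[symmetric] add.commute)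
    also have "\<dots> = C ^ j * C ^ Suc n * D" by (subst n1) (simp add: mult.assoc)
    also have "C ^ j * C ^ Suc n = C ^ (n + Suc j)" unfolding power_add[symmetric] by (simp add: add.commute)
    finally have "C ^ (n + j) * D ^ j = C ^ (n + Suc j) * D ^ Suc j" by (simp only: power_Suc[of D] mult.assoc)
    with Suc show ?case by simp
  qed simp
  define P where "P = C ^ n * D ^ n"
  define E where "E = C ^ k * D ^ n"
  have CD: "C * D = D * C" by (rule commD) simp
  have DnC: "D ^ n * C ^ j = C ^ j * D ^ n" for j
    using comm_power[OF comm_power[OF CD[symmetric], of j, symmetric], of n] by simp
  show thesis
  proof (rule that[of P E])
    have "P * P = C ^ n * (D ^ n * C ^ n) * D ^ n" by (simp add: P_def mult.assoc)
    also have "\<dots> = C ^ (n + n) * D ^ n * D ^ n" by (simp add: DnC power_add mult.assoc)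
    also have "\<dots> = P" using nj[of n] by (simp add: P_def)
    finally show "P * P = P" .
    have "D ^ n * C = C * D ^ n" using DnC[of 1] by simp
    then show "P = E * C" by (simp add: P_def E_def n_def mult.assoc) (simp add: power_commutes flip: mult.assoc)
    fix x assume x: "x * C = C * x"
    have xC: "x * C ^ j = C ^ j * x" and xD: "x * D ^ j = D ^ j * x" for j
      using comm_power[OF x] comm_power[OF commD[OF x]] by blast+
    have "x * (C ^ i * D ^ j) = C ^ i * D ^ j * x" for i j
      by (metis xC xD mult.assoc)
    then show "x * P = P * x" "x * E = E * x" by (simp_all add: P_def E_def)
  next
    assume "P = 0"
    have "C ^ n = C ^ n * P" using nj[of n] by (simp add: P_def power_add mult.assoc)
    then have "C ^ n = 0" using \<open>P = 0\<close> by simp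
    then show "\<exists>k. C ^ k = 0" by blast
  qed
qed

text \<open>
  For a finite-dimensional Lie algebra, having no nonzero abelian ideal is equivalent to having no nonzero
  solvable ideal, since the last nonzero derived algebra of a solvable ideal is an abelian ideal.
\<close>

locale semisimple_lie_algebra =
  fixes g :: "'v::euclidean_space endo set"
  assumes subspace_g: "subspace g"
    and bracket_g: "x \<in> g \<Longrightarrow> y \<in> g \<Longrightarrow> bracket x y \<in> g"
    and no_abelian_ideal: "subspace a \<Longrightarrow> a \<subseteq> g \<Longrightarrow> (\<And>x y. x \<in> g \<Longrightarrow> y \<in> a \<Longrightarrow> bracket x y \<in> a) \<Longrightarrow>
      (\<And>x y. x \<in> a \<Longrightarrow> y \<in> a \<Longrightarrow> x * y = y * x) \<Longrightarrow> a \<subseteq> {0}"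
begin

definition lie_ideal :: "'v endo set \<Rightarrow> bool" where
  "lie_ideal k \<longleftrightarrow> subspace k \<and> k \<subseteq> g \<and> (\<forall>x\<in>g. \<forall>y\<in>k. bracket x y \<in> k)"

definition derived :: "'v endo set \<Rightarrow> 'v endo set" where
  "derived k = span (brackets k)"

lemma lie_idealD:
  assumes "lie_ideal k"
  shows "subspace k" "k \<subseteq> g" "x \<in> g \<Longrightarrow> y \<in> k \<Longrightarrow> bracket x y \<in> k" "x \<in> g \<Longrightarrow> y \<in> k \<Longrightarrow> bracket y x \<in> k"
proof -
  show k: "subspace k" "k \<subseteq> g" "x \<in> g \<Longrightarrow> y \<in> k \<Longrightarrow> bracket x y \<in> k" for x y
    using assms by (auto simp: lie_ideal_def)
  show "x \<in> g \<Longrightarrow> y \<in> k \<Longrightarrow> bracket y x \<in> k"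
    using subspace_neg[OF k(1) k(3)[of x y]] by simp
qed

lemma derived_subset: "lie_ideal k \<Longrightarrow> derived k \<subseteq> k"
  unfolding derived_def by (rule span_minimal) (auto simp: lie_ideal_def)

lemma lie_ideal_derived:
  assumes k: "lie_ideal k"
  shows "lie_ideal (derived k)"
  unfolding lie_ideal_def
proof (intro conjI ballI)
  show "derived k \<subseteq> g" using derived_subset[OF k] lie_idealD(2)[OF k] by blast
  fix x y assume x: "x \<in> g" and y: "y \<in> derived k"
  show "bracket x y \<in> derived k"
    unfolding derived_def
  proof (rule span_map[where f = "\<lambda>y. bracket x y", OF _ _ y[unfolded derived_def]])
    show "linear (\<lambda>y. bracket x y)" by (simp add: linear_iff algebra_simps)
    fix s assume "s \<in> brackets k"
    then obtain u v where s: "s = bracket u v" "u \<in> k" "v \<in> k" by blast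
    have "bracket x s = bracket (bracket x u) v + bracket u (bracket x v)" by (simp add: s algebra_simps)
    also have "\<dots> \<in> span (brackets k)"
      using s lie_idealD(3)[OF k x] by (intro span_add span_base) blast+
    finally show "bracket x s \<in> span (brackets k)" .
  qed
qed (simp add: derived_def)

text \<open>
  A perfect ideal is excluded by Cartan's criterion. Otherwise the derived ideal is smaller, hence zero by
  induction, and the ideal is abelian.
\<close>

lemma traceless_ideal_trivial:
  assumes "lie_ideal n" "\<And>x y. x \<in> n \<Longrightarrow> y \<in> n \<Longrightarrow> tr (x * y) = 0"
  shows "n \<subseteq> {0}"
  using assms
proof (induction "dim n" arbitrary: n rule: less_induct)
  case less
  note n = lie_idealD[OF less.prems(1)]
  show ?case
  proof (cases "n \<subseteq> derived n")
    case True
    show ?thesis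
    proof (rule cartan_perfect)
      show "n \<subseteq> span (brackets n)" using True by (simp add: derived_def)
    qed (use n less.prems in blast)+
  next
    case False
    obtain F where F: "finite F" "UNIV \<subseteq> span (F :: 'v endo set)" using endo_finite_span by blast
    have "dim (derived n) < dim n"
      by (rule dim_strict_mono[OF F(1)])
         (use F(2) False derived_subset[OF less.prems(1)] in \<open>auto simp: derived_def\<close>)
    then have d0: "derived n \<subseteq> {0}"
      by (rule less.hyps[OF _ lie_ideal_derived[OF less.prems(1)]])
         (use derived_subset[OF less.prems(1)] less.prems(2) in blast)
    show ?thesis
    proof (rule no_abelian_ideal[OF n(1,2)])
      show "bracket x y \<in> n" if "x \<in> g" "y \<in> n" for x y using n(3) that by blast
      fix x y assume "x \<in> n" "y \<in> n"
      then have "bracket x y \<in> derived n" unfolding derived_def by (intro span_base) blast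
      then show "x * y = y * x" using d0 by auto
    qed
  qed
qed

definition orth :: "'v endo set \<Rightarrow> 'v endo set" where
  "orth k = {z \<in> g. \<forall>w\<in>k. tr (z * w) = 0}"

lemma lie_ideal_orth:
  assumes k: "lie_ideal k"
  shows "lie_ideal (orth k)"
  unfolding lie_ideal_def
proof (intro conjI ballI)
  show "subspace (orth k)"
    unfolding orth_def
    by (rule subspaceI) (simp_all add: linear_add[OF tr_linear(1)] linear_scale[OF tr_linear(1)] linear_0[OF linear_tr]
        subspace_0[OF subspace_g] subspace_add[OF subspace_g] subspace_scale[OF subspace_g] del: mult_scaleR_left)
  fix x y assume x: "x \<in> g" and y: "y \<in> orth k"
  show "bracket x y \<in> orth k"
    using y bracket_g[OF x] lie_idealD(3)[OF k x] by (auto simp: orth_def tr_bracket)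
qed (auto simp: orth_def)

lemma orth_Int:
  assumes k: "lie_ideal k" "x \<in> k" "x \<in> orth k"
  shows "x = 0"
proof -
  have "lie_ideal (k \<inter> orth k)"
    using k(1) lie_ideal_orth[OF k(1)] unfolding lie_ideal_def by (auto intro: subspace_inter)
  then have "k \<inter> orth k \<subseteq> {0}"
    by (rule traceless_ideal_trivial) (auto simp: orth_def)
  then show ?thesis using k by blast
qed

text \<open>
  The orthogonal projection of \<open>x\<close> onto \<open>k\<close> exists because the trace form is nondegenerate on \<open>k\<close>.
\<close>

lemma orth_complement:
  assumes k: "lie_ideal k" and x: "x \<in> g"
  obtains y z where "x = y + z" "y \<in> k" "z \<in> orth k"
proof -
  obtain F where F: "finite F" "UNIV \<subseteq> span (F :: 'v endo set)" using endo_finite_span by blast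
  have "\<exists>D. finite D \<and> D \<subseteq> k \<and> (\<forall>b\<in>D. tr (b * b) \<noteq> 0) \<and>
    (\<forall>x\<in>k. x = (\<Sum>b\<in>D. (tr (x * b) / tr (b * b)) *\<^sub>R b))"
  proof (rule orthogonal_basis[OF F(1) _ lie_idealD(1)[OF k] tr_linear tr_commute])
    fix x assume "x \<in> k" "\<forall>y\<in>k. tr (x * y) = 0"
    then show "x = 0" using orth_Int[OF k] lie_idealD(2)[OF k] by (auto simp: orth_def)
  qed (use F in blast)
  then obtain D where D: "finite D" "D \<subseteq> k" "\<forall>x\<in>k. x = (\<Sum>b\<in>D. (tr (x * b) / tr (b * b)) *\<^sub>R b)" by blast
  define y where "y = (\<Sum>b\<in>D. (tr (x * b) / tr (b * b)) *\<^sub>R b)"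
  have yk: "y \<in> k" unfolding y_def using D(2) lie_idealD(1)[OF k] by (intro subspace_sum subspace_scale) auto
  have "tr (y * w) = tr (x * w)" if "w \<in> k" for w
  proof -
    have "tr (y * w) = (\<Sum>b\<in>D. (tr (x * b) / tr (b * b)) * tr (b * w))"
      by (simp add: y_def linear_sum[OF tr_linear(1)] linear_scale[OF tr_linear(1)] del: mult_scaleR_left)
    also have "\<dots> = (\<Sum>b\<in>D. (tr (w * b) / tr (b * b)) * tr (x * b))"
      by (intro sum.cong) (simp_all add: tr_commute[of w])
    also have "\<dots> = tr (x * (\<Sum>b\<in>D. (tr (w * b) / tr (b * b)) *\<^sub>R b))"
      by (simp add: linear_sum[OF tr_linear(2)] linear_scale[OF tr_linear(2)] del: mult_scaleR_right)
    finally show ?thesis using D(3) that by simp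
  qed
  then have "x - y \<in> orth k"
    unfolding orth_def using x yk lie_idealD(2)[OF k] subspace_diff[OF subspace_g]
    by (auto simp: left_diff_distrib linear_diff[OF linear_tr])
  then show thesis using yk by (intro that[of y "x - y"]) auto
qed

text \<open>
  The elements of \<open>k\<close> orthogonal to \<open>[k, k]\<close> commute with \<open>k\<close>: for such \<open>u\<close> and for \<open>v\<close>, \<open>w\<close> in \<open>k\<close> the
  trace of \<open>[v, u] w\<close> is up to sign that of \<open>u [v, w]\<close>, which is zero. So they form an abelian ideal.
\<close>

lemma ideal_perfect:
  assumes k: "lie_ideal k"
  shows "k \<subseteq> derived k"
proof
  fix x assume x: "x \<in> k"
  define c where "c = k \<inter> orth (derived k)"
  have c: "lie_ideal c"
    using k lie_ideal_orth[OF lie_ideal_derived[OF k]] unfolding lie_ideal_def c_def by (auto intro: subspace_inter)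
  have "c \<subseteq> {0}"
  proof (rule no_abelian_ideal[OF lie_idealD(1,2)[OF c]])
    fix u v assume u: "u \<in> c" and v: "v \<in> c"
    have "u \<in> k" "v \<in> k" "u \<in> g" "v \<in> g" using u v lie_idealD(2)[OF k] by (auto simp: c_def)
    have "bracket v u \<in> k" using lie_idealD(3)[OF k \<open>v \<in> g\<close> \<open>u \<in> k\<close>] .
    moreover have "tr (bracket v u * w) = 0" if w: "w \<in> k" for w
    proof -
      have "bracket v w \<in> derived k" unfolding derived_def using \<open>v \<in> k\<close> w by (intro span_base) blast
      then show ?thesis using u by (simp add: tr_bracket c_def orth_def)
    qed
    ultimately have "bracket v u \<in> orth k" using lie_idealD(2)[OF k] by (auto simp: orth_def)
    with \<open>bracket v u \<in> k\<close> have "bracket v u = 0" by (rule orth_Int[OF k])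
    then show "u * v = v * u" by simp
  qed (use lie_idealD[OF c] in blast)
  obtain y z where yz: "x = y + z" "y \<in> derived k" "z \<in> orth (derived k)"
    using orth_complement[OF lie_ideal_derived[OF k]] x lie_idealD(2)[OF k] by blast
  have "z = x - y" using yz(1) by simp
  then have "z \<in> k" using x yz(2) derived_subset[OF k] lie_idealD(1)[OF k] by (auto intro: subspace_diff)
  then have "z = 0" using yz(3) \<open>c \<subseteq> {0}\<close> by (auto simp: c_def)
  then show "x \<in> derived k" using yz by simp
qed


text \<open>
  The radical \<open>r\<close> of the trace form of a representation \<open>\<tau>\<close> is a perfect ideal, and the trace form vanishes
  on its image, so Cartan's criterion shows that \<open>\<tau>\<close> is zero on \<open>r\<close>. A cocycle then vanishes on brackets of
  elements of \<open>r\<close>, hence on \<open>r\<close>.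
\<close>

lemma cocycle_is_coboundary_aux:
  fixes \<tau> :: "'v endo \<Rightarrow> 'm::euclidean_space endo" and f :: "'v endo \<Rightarrow> 'm"
  assumes "linear \<tau>" "linear f" and hom: "\<And>x y. x \<in> g \<Longrightarrow> y \<in> g \<Longrightarrow> \<tau> (bracket x y) = bracket (\<tau> x) (\<tau> y)"
    and cocycle: "\<And>x y. x \<in> g \<Longrightarrow> y \<in> g \<Longrightarrow> f (bracket x y) = app (\<tau> x) (f y) - app (\<tau> y) (f x)"
  defines "r \<equiv> {x \<in> g. \<forall>y\<in>g. tr (\<tau> x * \<tau> y) = 0}"
  shows "lie_ideal r" "\<And>x. x \<in> r \<Longrightarrow> \<tau> x = 0" "\<And>x. x \<in> r \<Longrightarrow> f x = 0"
proof -
  note lt = linear_rules[OF assms(1)]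
  note lf = linear_rules[OF assms(2)]
  note ltr = linear_rules[OF linear_tr]
  show r: "lie_ideal r"
    unfolding lie_ideal_def
  proof (intro conjI ballI)
    show "subspace r" unfolding r_def
      by (rule subspaceI) (simp_all add: lt ltr distrib_right subspace_0[OF subspace_g] subspace_add[OF subspace_g]
          subspace_scale[OF subspace_g])
    show "r \<subseteq> g" by (auto simp: r_def)
    fix z x assume z: "z \<in> g" and x: "x \<in> r"
    then have "x \<in> g" by (simp add: r_def)
    have "tr (\<tau> (bracket z x) * \<tau> y) = 0" if y: "y \<in> g" for y
    proof -
      have "tr (\<tau> (bracket z x) * \<tau> y) = - tr (\<tau> x * \<tau> (bracket z y))"
        by (simp only: hom[OF z \<open>x \<in> g\<close>] hom[OF z y] tr_bracket)
      then show ?thesis using x bracket_g[OF z y] by (simp add: r_def)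
    qed
    then show "bracket z x \<in> r" using bracket_g[OF z \<open>x \<in> g\<close>] by (simp add: r_def)
  qed
  note perf = subsetD[OF ideal_perfect[OF r], unfolded derived_def]
  have rg: "r \<subseteq> g" by (auto simp: r_def)
  have "\<tau> ` r \<subseteq> {0}"
  proof (rule cartan_perfect)
    show "subspace (\<tau> ` r)" by (rule linear_subspace_image[OF assms(1) lie_idealD(1)[OF r]])
    show "\<tau> ` r \<subseteq> span (brackets (\<tau> ` r))"
    proof safe
      fix x assume x: "x \<in> r"
      show "\<tau> x \<in> span (brackets (\<tau> ` r))"
      proof (rule span_map[OF assms(1) _ perf[OF x]])
        fix s assume "s \<in> brackets r"
        then obtain u v where s: "s = bracket u v" "u \<in> r" "v \<in> r" by blast
        then have "\<tau> s = bracket (\<tau> u) (\<tau> v)" using hom rg by blast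
        then show "\<tau> s \<in> span (brackets (\<tau> ` r))" using s by (intro span_base) blast
      qed
    qed
    fix a b assume "a \<in> \<tau> ` r" "b \<in> \<tau> ` r"
    then obtain x y where xy: "a = \<tau> x" "b = \<tau> y" "x \<in> r" "y \<in> r" by blast
    then have "x \<in> g" "y \<in> g" using rg by auto
    then show "bracket a b \<in> \<tau> ` r"
      using hom lie_idealD(3)[OF r \<open>x \<in> g\<close> xy(4)] xy by (metis imageI)
    show "tr (a * b) = 0" using xy \<open>y \<in> g\<close> by (simp add: r_def)
  qed
  then show \<tau>0: "\<tau> x = 0" if "x \<in> r" for x using that by blast
  show "f x = 0" if x: "x \<in> r" for x
  proof -
    have "f x \<in> span {0}"
    proof (rule span_map[OF assms(2) _ perf[OF x]])
      fix s assume "s \<in> brackets r"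
      then obtain u v where s: "s = bracket u v" "u \<in> r" "v \<in> r" by blast
      then have "f s = app (\<tau> u) (f v) - app (\<tau> v) (f u)" using cocycle rg by blast
      then show "f s \<in> span {0}" using \<tau>0 s by simp
    qed
    then show ?thesis by simp
  qed
qed

abbreviation images :: "('v endo \<Rightarrow> 'm::euclidean_space endo) \<Rightarrow> 'm set" where
  "images \<tau> \<equiv> {app (\<tau> x) m |x m. x \<in> g}"

text \<open>
  Whitehead's first lemma. Let \<open>C\<close> be the Casimir operator of the form \<open>B x y = tr (\<tau> x * \<tau> y)\<close> on the ideal
  \<open>s\<close> complementary to its radical, built from an orthogonal basis \<open>D\<close>. Invariance of \<open>B\<close> gives both that
  \<open>C\<close> commutes with \<open>\<tau>\<close> and that \<open>C (f x) = \<tau> x m0\<close> for one vector \<open>m0\<close>. The trace of \<open>C\<close> is the dimension of \<open>s\<close>, so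
  \<open>C\<close> is not nilpotent unless \<open>s = 0\<close>, and its Fitting projection \<open>P\<close> is nonzero. On the range of \<open>P\<close> the
  operator \<open>C\<close> can be inverted. On the range of \<open>1 - P\<close>, modelled by the representation
  \<open>\<tau> x * (1 - P)\<close> of the same space, induction applies because the span of the images has shrunk.
\<close>

theorem cocycle_is_coboundary:
  fixes \<tau> :: "'v endo \<Rightarrow> 'm::euclidean_space endo" and f :: "'v endo \<Rightarrow> 'm"
  assumes "linear \<tau>" "linear f" and "\<And>x y. x \<in> g \<Longrightarrow> y \<in> g \<Longrightarrow> \<tau> (bracket x y) = bracket (\<tau> x) (\<tau> y)"
    and "\<And>x y. x \<in> g \<Longrightarrow> y \<in> g \<Longrightarrow> f (bracket x y) = app (\<tau> x) (f y) - app (\<tau> y) (f x)"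
  shows "\<exists>m. \<forall>x\<in>g. f x = app (\<tau> x) m"
  using assms
proof (induction "dim (span (images \<tau>))" arbitrary: \<tau> f rule: less_induct)
  case less
  note hom = less.prems(3) and cocycle = less.prems(4)
  note lt = linear_rules[OF less.prems(1)]
  note lf = linear_rules[OF less.prems(2)]
  note ltr = linear_rules[OF linear_tr]
  define B where "B x y = tr (\<tau> x * \<tau> y)" for x y
  define r where "r = {x \<in> g. \<forall>y\<in>g. tr (\<tau> x * \<tau> y) = 0}"
  have aux: "lie_ideal r" "\<And>x. x \<in> r \<Longrightarrow> \<tau> x = 0" "\<And>x. x \<in> r \<Longrightarrow> f x = 0"
    using cocycle_is_coboundary_aux[OF less.prems(1,2) hom cocycle] unfolding r_def by blast+
  define s where "s = orth r"
  have s: "lie_ideal s" unfolding s_def by (rule lie_ideal_orth[OF aux(1)])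
  have lin: "linear (\<lambda>x. B x y)" "linear (\<lambda>y. B x y)" for x y
    by (simp_all add: B_def linear_iff lt ltr distrib_left distrib_right)
  have sym: "B x y = B y x" for x y unfolding B_def by (rule tr_commute)
  obtain F where F: "finite F" "UNIV \<subseteq> span (F :: 'v endo set)" using endo_finite_span by blast
  have "\<exists>D. finite D \<and> D \<subseteq> s \<and> (\<forall>b\<in>D. B b b \<noteq> 0) \<and> (\<forall>x\<in>s. x = (\<Sum>b\<in>D. (B x b / B b b) *\<^sub>R b))"
  proof (rule orthogonal_basis[OF F(1) _ lie_idealD(1)[OF s] lin sym])
    fix x assume x: "x \<in> s" "\<forall>y\<in>s. B x y = 0"
    have xg: "x \<in> g" using x(1) lie_idealD(2)[OF s] by blast
    have "tr (\<tau> x * \<tau> y) = 0" if y: "y \<in> g" for y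
    proof -
      obtain y1 y2 where "y = y1 + y2" "y1 \<in> r" "y2 \<in> s" unfolding s_def by (rule orth_complement[OF aux(1) y])
      then show ?thesis using x(2) aux(2)[of y1] by (simp add: B_def lt)
    qed
    then have "x \<in> r" using xg by (simp add: r_def)
    then show "x = 0" using x(1) orth_Int[OF aux(1)] by (simp add: s_def)
  qed (use F in blast)
  then obtain D where D: "finite D" "D \<subseteq> s" "\<And>b. b \<in> D \<Longrightarrow> B b b \<noteq> 0"
    and expand: "\<And>x. x \<in> s \<Longrightarrow> x = (\<Sum>b\<in>D. (B x b / B b b) *\<^sub>R b)" by blast
  have Dg: "b \<in> g" if "b \<in> D" for b using that D(2) lie_idealD(2)[OF s] by blast
  have decomp: "P x" if "x \<in> g" "\<And>y z. y \<in> r \<Longrightarrow> z \<in> s \<Longrightarrow> P (y + z)" for P x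
    using orth_complement[OF aux(1) that(1)] that(2) unfolding s_def by metis
  have casimir_invariance: "(\<Sum>b\<in>D. (1 / B b b) *\<^sub>R (\<Phi> (bracket x b) b + \<Phi> b (bracket x b))) = 0"
    if x: "x \<in> g" and \<Phi>: "\<And>y. linear (\<lambda>x. \<Phi> x y)" "\<And>x. linear (\<lambda>y. \<Phi> x y)"
    for x and \<Phi> :: "'v endo \<Rightarrow> 'v endo \<Rightarrow> 'c::real_vector"
  proof -
    have e: "bracket x b = (\<Sum>c\<in>D. (B (bracket x b) c / B c c) *\<^sub>R c)" if "b \<in> D" for b
      using that D(2) lie_idealD(3)[OF s x] by (intro expand) blast
    have inv: "B (bracket x b) c = - B (bracket x c) b" if "b \<in> D" "c \<in> D" for b c
      using tr_bracket[of "\<tau> x" "\<tau> b" "\<tau> c"] tr_commute[of "\<tau> b"]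
      by (simp only: B_def hom[OF x Dg] that)
    define w where "w b c = B (bracket x b) c / (B b b * B c c)" for b c
    have half: "(\<Sum>b\<in>D. (1 / B b b) *\<^sub>R \<Psi> (bracket x b) b) = (\<Sum>b\<in>D. \<Sum>c\<in>D. w b c *\<^sub>R \<Psi> c b)"
      if \<Psi>: "\<And>y. linear (\<lambda>x. \<Psi> x y)" for \<Psi> :: "'v endo \<Rightarrow> 'v endo \<Rightarrow> 'c"
    proof (rule sum.cong[OF refl])
      fix b assume b: "b \<in> D"
      have "\<Psi> (bracket x b) b = (\<Sum>c\<in>D. (B (bracket x b) c / B c c) *\<^sub>R \<Psi> c b)"
        by (subst e[OF b]) (simp add: linear_sum[OF \<Psi>] linear_scale[OF \<Psi>])
      then show "(1 / B b b) *\<^sub>R \<Psi> (bracket x b) b = (\<Sum>c\<in>D. w b c *\<^sub>R \<Psi> c b)"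
        by (simp add: scaleR_sum_right w_def)
    qed
    have "(\<Sum>b\<in>D. (1 / B b b) *\<^sub>R \<Phi> b (bracket x b)) = (\<Sum>b\<in>D. \<Sum>c\<in>D. w b c *\<^sub>R \<Phi> b c)"
      using half[of "\<lambda>x y. \<Phi> y x", OF \<Phi>(2)] .
    also have "\<dots> = (\<Sum>b\<in>D. \<Sum>c\<in>D. w c b *\<^sub>R \<Phi> c b)" by (rule sum.swap)
    also have "\<dots> = (\<Sum>b\<in>D. \<Sum>c\<in>D. - (w b c *\<^sub>R \<Phi> c b))"
    proof (intro sum.cong refl)
      fix b c assume "b \<in> D" "c \<in> D"
      then show "w c b *\<^sub>R \<Phi> c b = - (w b c *\<^sub>R \<Phi> c b)"
        using inv[of b c] by (simp add: w_def mult.commute)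
    qed
    finally show ?thesis by (simp add: half[of \<Phi>, OF \<Phi>(1)] scaleR_add_right sum.distrib sum_negf)
  qed
  define C where "C = (\<Sum>b\<in>D. (1 / B b b) *\<^sub>R (\<tau> b * \<tau> b))"
  define m0 where "m0 = (\<Sum>b\<in>D. (1 / B b b) *\<^sub>R app (\<tau> b) (f b))"
  have commC: "\<tau> x * C = C * \<tau> x" if x: "x \<in> g" for x
  proof -
    have "\<tau> x * C - C * \<tau> x = (\<Sum>b\<in>D. (1 / B b b) *\<^sub>R (\<tau> (bracket x b) * \<tau> b + \<tau> b * \<tau> (bracket x b)))"
      unfolding C_def sum_distrib_left sum_distrib_right sum_subtractf[symmetric]
    proof (rule sum.cong[OF refl])
      fix b assume b: "b \<in> D"
      show "\<tau> x * ((1 / B b b) *\<^sub>R (\<tau> b * \<tau> b)) - (1 / B b b) *\<^sub>R (\<tau> b * \<tau> b) * \<tau> x =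
        (1 / B b b) *\<^sub>R (\<tau> (bracket x b) * \<tau> b + \<tau> b * \<tau> (bracket x b))"
        by (simp only: hom[OF x Dg[OF b]] mult_scaleR_left mult_scaleR_right scaleR_diff_right[symmetric])
           (simp add: left_diff_distrib right_diff_distrib mult.assoc)
    qed
    also have "\<dots> = 0"
      by (rule casimir_invariance[OF x]) (simp_all add: linear_iff lt distrib_left distrib_right)
    finally show ?thesis by simp
  qed
  have Cf: "app (\<tau> x) m0 = app C (f x)" if x: "x \<in> g" for x
  proof -
    have "app (\<tau> x) m0 - app C (f x) = (\<Sum>b\<in>D. (1 / B b b) *\<^sub>R (app (\<tau> (bracket x b)) (f b) + app (\<tau> b) (f (bracket x b))))"
      unfolding C_def m0_def app_sum app_sum_right sum_subtractf[symmetric]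
    proof (rule sum.cong[OF refl])
      fix b assume b: "b \<in> D"
      show "app (\<tau> x) ((1 / B b b) *\<^sub>R app (\<tau> b) (f b)) - app ((1 / B b b) *\<^sub>R (\<tau> b * \<tau> b)) (f x) =
        (1 / B b b) *\<^sub>R (app (\<tau> (bracket x b)) (f b) + app (\<tau> b) (f (bracket x b)))"
        by (simp add: hom[OF x Dg[OF b]] cocycle[OF x Dg[OF b]] flip: scaleR_diff_right)
    qed
    also have "\<dots> = 0"
      by (rule casimir_invariance[OF x]) (simp_all add: linear_iff lt lf)
    finally show ?thesis by simp
  qed
  show ?case
  proof (cases "D = {}")
    case True
    have "f x = app (\<tau> x) 0" if x: "x \<in> g" for x
      using x
    proof (rule decomp)
      fix y z assume y: "y \<in> r" and z: "z \<in> s"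
      have "z = 0" using expand[OF z] True by simp
      then show "f (y + z) = app (\<tau> (y + z)) 0" using aux(3)[OF y] by simp
    qed
    then show ?thesis by blast
  next
    case False
    obtain F' where F': "finite F'" "UNIV \<subseteq> span (F' :: 'm endo set)" using endo_finite_span by blast
    obtain P E where P: "P * P = P" "P = E * C"
      "\<And>x. x * C = C * x \<Longrightarrow> x * P = P * x" "\<And>x. x * C = C * x \<Longrightarrow> x * E = E * x"
      "P = 0 \<Longrightarrow> \<exists>k. C ^ k = 0"
      using fitting_idempotent[OF F', of C] by blast
    have "tr C = real (card D)"
    proof -
      have "tr C = (\<Sum>b\<in>D. (1 / B b b) * B b b)"
        by (simp add: C_def linear_sum[OF linear_tr] linear_scale[OF linear_tr] B_def)
      also have "\<dots> = (\<Sum>b\<in>D. 1)" using D(3) by (intro sum.cong) auto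
      finally show ?thesis by simp
    qed
    then have "tr C \<noteq> 0" using False D(1) by simp
    then have "P \<noteq> 0" using P(5) nilpotent_tr_zero by metis
    then obtain v where v: "app P v \<noteq> 0" by (metis endo_eqI app_simps(1))
    have commP: "\<tau> x * P = P * \<tau> x" and commE: "\<tau> x * E = E * \<tau> x" if "x \<in> g" for x
      using P(3,4)[OF commC[OF that]] by blast+
    have commP': "app (\<tau> x) (app P w) = app P (app (\<tau> x) w)" if "x \<in> g" for x w
      using commP[OF that] by (metis app_mult)
    have commE': "app (\<tau> x) (app E w) = app E (app (\<tau> x) w)" if "x \<in> g" for x w
      using commE[OF that] by (metis app_mult)
    have PP: "app P (app P w) = app P w" for w using P(1) by (metis app_mult)
    \<comment> \<open>The representation with the summand \<open>range P\<close> replaced by a trivial one.\<close>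
    define \<tau>' where "\<tau>' x = \<tau> x * (1 - P)" for x
    define f' where "f' x = app (1 - P) (f x)" for x
    have CE: "C * E = E * C" using P(4)[of C] by simp
    have "\<exists>m. \<forall>x\<in>g. f' x = app (\<tau>' x) m"
    proof (rule less.hyps)
      show "linear \<tau>'" by (simp add: \<tau>'_def linear_iff lt distrib_right)
      show "linear f'" by (simp add: f'_def linear_iff lf)
      show "\<tau>' (bracket x y) = bracket (\<tau>' x) (\<tau>' y)" if "x \<in> g" "y \<in> g" for x y
        by (rule endo_eqI) (simp add: \<tau>'_def hom that commP' PP)
      show "f' (bracket x y) = app (\<tau>' x) (f' y) - app (\<tau>' y) (f' x)" if "x \<in> g" "y \<in> g" for x y
        by (simp add: f'_def \<tau>'_def cocycle that commP' PP)
      show "dim (span (images \<tau>')) < dim (span (images \<tau>))"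
      proof (rule dim_strict_mono)
        have "app (\<tau>' x) m = app (\<tau> x) (app (1 - P) m)" for x m by (simp add: \<tau>'_def)
        then have "images \<tau>' \<subseteq> images \<tau>" by blast
        then have sub: "span (images \<tau>') \<subseteq> span (images \<tau>)" by (rule span_mono)
        \<comment> \<open>This vector of the range of \<open>C\<close> is lost: \<open>P\<close> fixes it but kills all images of \<open>\<tau>'\<close>.\<close>
        have "app P v = app C (app E v)" using P(2) CE by (metis app_mult)
        also have "\<dots> = (\<Sum>b\<in>D. (1 / B b b) *\<^sub>R app (\<tau> b) (app (\<tau> b) (app E v)))"
          by (simp add: C_def app_sum)
        also have "\<dots> \<in> span (images \<tau>)"
          using Dg by (intro span_sum span_scale span_base) blast
        finally have "app P v \<in> span (images \<tau>)" .
        moreover have "app P v \<notin> span (images \<tau>')"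
        proof
          assume "app P v \<in> span (images \<tau>')"
          then have "app P (app P v) \<in> span {0}"
            by (rule span_map[OF linear_app, rotated]) (auto simp: \<tau>'_def PP commP'[symmetric])
          then show False using v by (simp add: PP)
        qed
        ultimately show "span (images \<tau>') \<subset> span (images \<tau>)" using sub by blast
        show "finite (Basis :: 'm set)" by simp
      qed simp_all
    qed
    then obtain m2 where m2: "\<And>x. x \<in> g \<Longrightarrow> f' x = app (\<tau>' x) m2" by blast
    have "f x = app (\<tau> x) (app E m0 + app (1 - P) m2)" if x: "x \<in> g" for x
    proof -
      have "app P (f x) = app (\<tau> x) (app E m0)"
        using P(2) Cf[OF x] by (simp add: commE'[OF x])
      moreover have "f x - app P (f x) = app (\<tau> x) (app (1 - P) m2)"
        using m2[OF x] by (simp add: f'_def \<tau>'_def)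
      moreover have "f x = app P (f x) + (f x - app P (f x))" by simp
      ultimately show ?thesis by (metis linear_add[OF linear_app])
    qed
    then show ?thesis by blast
  qed
qed

end

section \<open>Invariance under a connected group\<close>

text \<open>
  Inversion is continuous: \<open>v - y = v (x - u) y\<close>, and the norms of \<open>v\<close> stay bounded because eventually
  the factor \<open>(x - u) y\<close> has norm below \<open>1/2\<close>.
\<close>

lemma inverse_tendsto:
  fixes u v :: "nat \<Rightarrow> 'a::real_normed_algebra_1"
  assumes u: "u \<longlonglongrightarrow> x" and uv: "\<And>n. v n * u n = 1" and xy: "x * y = 1"
  shows "v \<longlonglongrightarrow> y"
proof -
  have "(\<lambda>n. norm (x - u n) * norm y) \<longlonglongrightarrow> norm (x - x) * norm y"
    by (intro tendsto_intros u)
  then have "\<forall>\<^sub>F n in sequentially. norm (x - u n) * norm y < 1 / 2"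
    by (rule order_tendstoD) simp
  then have "\<forall>\<^sub>F n in sequentially. norm (v n - y) \<le> 2 * norm y * (norm (x - u n) * norm y)"
  proof eventually_elim
    case (elim n)
    have "v n - y = v n * (x - u n) * y"
    proof -
      have "v n * (u n * y) = y" by (simp add: uv flip: mult.assoc)
      then show ?thesis by (simp add: right_diff_distrib left_diff_distrib mult.assoc xy)
    qed
    then have "norm (v n - y) \<le> norm (v n * (x - u n)) * norm y"
      by (simp only: norm_mult_ineq)
    also have "\<dots> \<le> norm (v n) * norm (x - u n) * norm y"
      by (intro mult_right_mono norm_mult_ineq) simp
    finally have le: "norm (v n - y) \<le> norm (v n) * (norm (x - u n) * norm y)"
      by (simp only: mult.assoc)
    also have "\<dots> \<le> norm (v n) * (1 / 2)" using elim by (intro mult_left_mono) auto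
    finally have "norm (v n) \<le> 2 * norm y" using norm_triangle_sub[of "v n" y] by simp
    then have "norm (v n) * (norm (x - u n) * norm y) \<le> 2 * norm y * (norm (x - u n) * norm y)"
      by (intro mult_right_mono) auto
    then show ?case using le by simp
  qed
  moreover have "(\<lambda>n. 2 * norm y * (norm (x - u n) * norm y)) \<longlonglongrightarrow> 2 * norm y * (norm (x - x) * norm y)"
    by (intro tendsto_intros u)
  then have "(\<lambda>n. 2 * norm y * (norm (x - u n) * norm y)) \<longlonglongrightarrow> 0" by simp
  ultimately have "(\<lambda>n. v n - y) \<longlonglongrightarrow> 0" by (rule Lim_null_comparison)
  then show ?thesis by (simp add: LIM_zero_iff)
qed

lemma exp_inverse:
  fixes X :: "'a::{real_normed_algebra_1,banach}"
  shows "exp X * exp (- X) = 1" "exp (- X) * exp X = 1"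
  using exp_minus_inverse[of X] exp_minus_inverse[of "- X"] by simp_all

text \<open>
  Infinitesimal invariance implies invariance under the connected group. The elements that together with
  their inverses preserve \<open>a\<close> form a closed subgroup containing the exponentials. The inverse is a separate
  argument of the action, so that the lemma covers both evaluation at a vector and conjugation.
\<close>

lemma action_preserves:
  fixes G :: "'a::{real_normed_algebra_1,banach,heine_borel} set"
    and act :: "'a \<Rightarrow> 'a \<Rightarrow> 'w \<Rightarrow> 'w::metric_space"
  assumes G: "closed_subgroup G" "connected G"
    and "closed a"
    and act_one: "\<And>v. act 1 1 v = v"
    and act_mult: "\<And>x1 x2 y1 y2 v. act (x1 * x2) (y2 * y1) v = act x1 y1 (act x2 y2 v)"
    and act_lim: "\<And>x y X Y v. X \<longlonglongrightarrow> x \<Longrightarrow> Y \<longlonglongrightarrow> y \<Longrightarrow> (\<lambda>n. act (X n) (Y n) v) \<longlonglongrightarrow> act x y v"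
    and act_exp: "\<And>X v. X \<in> lie G \<Longrightarrow> v \<in> a \<Longrightarrow> act (exp X) (exp (- X)) v \<in> a"
    and x: "x \<in> G" "x * y = 1" "y * x = 1" "v \<in> a"
  shows "act x y v \<in> a"
proof -
  interpret closed_subgroup G by (rule G(1))
  define K where "K = {x \<in> G. \<forall>y. x * y = 1 \<longrightarrow> y * x = 1 \<longrightarrow> (\<forall>v\<in>a. act x y v \<in> a \<and> act y x v \<in> a)}"
  have inv_unique: "y = z" if "x * y = 1" "z * x = 1" for x y z :: 'a
    using that by (metis mult.assoc mult.left_neutral mult.right_neutral)
  have "K = G"
  proof (rule subgroup_containing_exp_lie[OF G])
    show "K \<subseteq> G" by (auto simp: K_def)
    show "1 \<in> K" using one act_one by (auto simp: K_def)
    show "g * h \<in> K" if g: "g \<in> K" and h: "h \<in> K" for g h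
    proof -
      have gG: "g \<in> G" "h \<in> G" using g h by (auto simp: K_def)
      obtain g' h' where inv: "g * g' = 1" "g' * g = 1" "h * h' = 1" "h' * h = 1"
        using inv gG by metis
      have inv': "(h' * g') * (g * h) = 1" using inv by (metis mult.assoc mult.left_neutral)
      have ga: "\<forall>v\<in>a. act g g' v \<in> a \<and> act g' g v \<in> a" and ha: "\<forall>v\<in>a. act h h' v \<in> a \<and> act h' h v \<in> a"
        using g h inv by (auto simp: K_def)
      have "act (g * h) y v \<in> a \<and> act y (g * h) v \<in> a" if "g * h * y = 1" "v \<in> a" for y v
      proof -
        have "y = h' * g'" by (rule inv_unique[OF that(1) inv'])
        then show ?thesis using ga ha that(2) by (simp add: act_mult)
      qed
      then show ?thesis using gG mult by (auto simp: K_def)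
    qed
    show "h \<in> K" if g: "g \<in> K" and h: "h \<in> G" "g * h = 1" "h * g = 1" for g h
    proof -
      have "act h y v \<in> a \<and> act y h v \<in> a" if "h * y = 1" "v \<in> a" for y v
      proof -
        have "y = g" by (rule inv_unique[OF that(1) h(2)])
        then show ?thesis using g h that(2) by (auto simp: K_def)
      qed
      then show ?thesis using h(1) by (auto simp: K_def)
    qed
    show "z \<in> K" if f: "\<And>n. f n \<in> K" "f \<longlonglongrightarrow> z" and z: "z \<in> G" for f z
    proof -
      have "\<forall>n. \<exists>h\<in>G. f n * h = 1 \<and> h * f n = 1" using f(1) inv by (auto simp: K_def)
      then obtain h where h: "\<And>n. f n * h n = 1" "\<And>n. h n * f n = 1" by metis
      have "act z y v \<in> a \<and> act y z v \<in> a" if y: "z * y = 1" and v: "v \<in> a" for y v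
      proof -
        have hy: "h \<longlonglongrightarrow> y" by (rule inverse_tendsto[OF f(2) h(2) y])
        have n: "act (f n) (h n) v \<in> a" "act (h n) (f n) v \<in> a" for n
          using f(1)[of n] h[of n] v by (auto simp: K_def)
        show ?thesis
          using closed_sequentially[OF \<open>closed a\<close> n(1) act_lim[OF f(2) hy]]
            closed_sequentially[OF \<open>closed a\<close> n(2) act_lim[OF hy f(2)]] by blast
      qed
      then show ?thesis using z by (auto simp: K_def)
    qed
    show "exp X \<in> K" if X: "X \<in> lie G" for X
    proof -
      have X': "- X \<in> lie G" using X subspace_neg[OF subspace_lie] by blast
      have "act (exp X) y v \<in> a \<and> act y (exp X) v \<in> a" if "exp X * y = 1" "v \<in> a" for y v
      proof -
        have "y = exp (- X)" by (rule inv_unique[OF that(1) exp_inverse(2)])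
        then show ?thesis using act_exp[OF X that(2)] act_exp[OF X' that(2)] by simp
      qed
      moreover have "exp X \<in> G" using X by (auto simp: lie_def dest: spec[of _ 1])
      ultimately show ?thesis by (auto simp: K_def)
    qed
  qed
  then show ?thesis using x by (auto simp: K_def)
qed

lemma commute_of_exp_commute:
  fixes X B :: "'a::{real_normed_algebra_1,banach}"
  assumes "\<And>t. exp (t *\<^sub>R X) * B = B * exp (t *\<^sub>R X)"
  shows "X * B = B * X"
proof -
  have lim: "((\<lambda>t. (exp (t *\<^sub>R X) - 1) /\<^sub>R t) \<longlongrightarrow> X) (at 0)"
    using difference_quotient_tendsto[OF exp_has_vector_derivative_0[of X]] by simp
  have "((\<lambda>t. (exp (t *\<^sub>R X) - 1) /\<^sub>R t * B) \<longlongrightarrow> X * B) (at 0)"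
    by (intro tendsto_mult lim tendsto_const)
  moreover have "(exp (t *\<^sub>R X) - 1) /\<^sub>R t * B = B * ((exp (t *\<^sub>R X) - 1) /\<^sub>R t)" for t
    using assms[of t] by (simp add: left_diff_distrib right_diff_distrib)
  then have "((\<lambda>t. (exp (t *\<^sub>R X) - 1) /\<^sub>R t * B) \<longlongrightarrow> B * X) (at 0)"
    by (simp only:) (intro tendsto_mult lim tendsto_const)
  ultimately show ?thesis using tendsto_unique trivial_limit_at by blast
qed

lemma exp_trivial:
  fixes X :: "'a::{real_normed_algebra_1,banach}"
  assumes "\<And>t. exp (t *\<^sub>R X) = 1"
  shows "X = 0"
  using difference_quotient_tendsto[OF exp_has_vector_derivative_0[of X]]
  by (simp add: assms) (metis tendsto_unique tendsto_const trivial_limit_at)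

lemma tendsto_app:
  "X \<longlonglongrightarrow> x \<Longrightarrow> V \<longlonglongrightarrow> v \<Longrightarrow> (\<lambda>n. app (X n) (V n)) \<longlonglongrightarrow> app x v"
  by (rule bounded_bilinear.tendsto[OF bounded_bilinear_app])

text \<open>
  Subspaces of the algebra of endomorphisms are closed, because passing to matrices embeds it linearly
  and continuously into a Euclidean space.
\<close>

lemma closed_subspace_endo:
  fixes a :: "'v::euclidean_space endo set"
  assumes "subspace a"
  shows "closed a"
  unfolding closed_sequential_limits
proof (intro allI impI, elim conjE)
  fix X l assume X: "\<forall>n. X n \<in> a" "X \<longlonglongrightarrow> l"
  have lin: "linear (cmat :: 'v endo \<Rightarrow> _)"
    unfolding linear_iff
  proof (intro conjI allI)
    fix c and f :: "'v endo"
    show "cmat (c *\<^sub>R f) = c *\<^sub>R cmat f"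
      unfolding cart_eq_iff cmat_def vector_scaleR_component vec_lambda_beta by (simp add: complex_eq_iff)
  qed (rule cmat_linear)
  have "(\<lambda>n. cmat (X n) $ i $ j) \<longlonglongrightarrow> cmat l $ i $ j" for i j
    unfolding cmat_def vec_lambda_beta
    by (intro tendsto_of_real tendsto_inner tendsto_app[OF X(2) tendsto_const] tendsto_const)
  then have "(\<lambda>n. cmat (X n)) \<longlonglongrightarrow> cmat l"
    by (intro vec_tendstoI)
  moreover have "closed (cmat ` a)"
    by (rule closed_subspace) (rule linear_subspace_image[OF lin assms])
  moreover have "cmat (X n) \<in> cmat ` a" for n using X(1) by blast
  ultimately have "cmat l \<in> cmat ` a" using closed_sequentially[of "cmat ` a" "\<lambda>n. cmat (X n)"] by blast
  then obtain x where "x \<in> a" "cmat l = cmat x" by blast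
  then show "l \<in> a" using cmat_inject[of l x] by simp
qed

definition endo_of_matrix :: "real ^ 'n ^ 'n \<Rightarrow> (real ^ 'n) endo" where
  "endo_of_matrix A = endo ((*v) A)"

lemma app_endo_of_matrix [simp]: "app (endo_of_matrix A) v = A *v v"
  by (simp add: endo_of_matrix_def app_endo_linear)

lemma endo_of_matrix_inject: "endo_of_matrix A = endo_of_matrix B \<Longrightarrow> A = B"
  by (metis app_endo_of_matrix matrix_eq)

lemma endo_of_matrix_mult: "endo_of_matrix (A ** B) = endo_of_matrix A * endo_of_matrix B"
  by (rule endo_eqI) (simp add: matrix_vector_mul_assoc)

lemma endo_of_matrix_one: "endo_of_matrix (mat 1) = 1"
  by (rule endo_eqI) simp

lemma linear_endo_of_matrix: "linear endo_of_matrix"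
  by (simp add: linear_iff) (safe; rule endo_eqI; simp add: matrix_vector_mult_add_rdistrib scaleR_matrix_vector_assoc)

lemma endo_of_matrix_exp: "endo_of_matrix (matrix_exp X) = exp (endo_of_matrix X)"
proof -
  have pow: "endo_of_matrix (matrix_power X n) = endo_of_matrix X ^ n" for n
    by (induction n) (simp_all add: endo_of_matrix_one endo_of_matrix_mult)
  have bl: "bounded_linear (endo_of_matrix :: real ^ 'a ^ 'a \<Rightarrow> _)"
    using linear_endo_of_matrix by (simp add: linear_conv_bounded_linear)
  have "endo_of_matrix (matrix_exp X) = (\<Sum>n. endo_of_matrix ((1 / fact n) *\<^sub>R matrix_power X n))"
    unfolding matrix_exp_def by (rule bounded_linear.suminf[OF bl summable_matrix_exp])
  also have "\<dots> = exp (endo_of_matrix X)"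
    by (simp add: exp_def linear_scale[OF linear_endo_of_matrix] pow inverse_eq_divide)
  finally show ?thesis .
qed

text \<open>
  Differentiating the commutation of \<open>exp (t X)\<close> and \<open>exp (s Y)\<close> at \<open>0\<close> shows that all brackets vanish.
\<close>

lemma abelian_solvable:
  assumes one: "mat 1 \<in> H" and comm: "\<And>x y. x \<in> H \<Longrightarrow> y \<in> H \<Longrightarrow> x ** y = y ** x"
  shows "solvable_lie_group H"
proof -
  have br: "lie_bracket X Y = 0" if X: "X \<in> lie_algebra H" and Y: "Y \<in> lie_algebra H" for X Y
  proof -
    have e: "exp (t *\<^sub>R endo_of_matrix X) = endo_of_matrix (matrix_exp (t *\<^sub>R X))" for t and X :: "real ^ 'a ^ 'a"
      by (simp add: endo_of_matrix_exp linear_scale[OF linear_endo_of_matrix])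
    have "exp (t *\<^sub>R endo_of_matrix X) * exp (s *\<^sub>R endo_of_matrix Y)
        = exp (s *\<^sub>R endo_of_matrix Y) * exp (t *\<^sub>R endo_of_matrix X)" for s t
      using comm[of "matrix_exp (t *\<^sub>R X)" "matrix_exp (s *\<^sub>R Y)"] X Y
      by (simp add: e lie_algebra_def flip: endo_of_matrix_mult)
    then have "endo_of_matrix X * exp (s *\<^sub>R endo_of_matrix Y) = exp (s *\<^sub>R endo_of_matrix Y) * endo_of_matrix X" for s
      by (rule commute_of_exp_commute)
    from commute_of_exp_commute[OF this[symmetric]]
    have "endo_of_matrix (Y ** X) = endo_of_matrix (X ** Y)" by (simp add: endo_of_matrix_mult)
    then show ?thesis unfolding lie_bracket_def by (metis endo_of_matrix_inject diff_self)
  qed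
  have "endo_of_matrix (matrix_exp 0) = endo_of_matrix (mat 1 :: real ^ 'a ^ 'a)"
    by (simp add: endo_of_matrix_exp endo_of_matrix_one linear_0[OF linear_endo_of_matrix])
  then have "matrix_exp 0 = (mat 1 :: real ^ 'a ^ 'a)" by (rule endo_of_matrix_inject)
  then have "0 \<in> lie_algebra H" using one by (simp add: lie_algebra_def)
  then have "{lie_bracket x y |x y. x \<in> lie_algebra H \<and> y \<in> lie_algebra H} = {0}"
    using br by fastforce
  then have "derived_algebra (lie_algebra H) = {0}" by (simp add: derived_algebra_def)
  then show ?thesis unfolding solvable_lie_group_def by (intro exI[of _ 1]) simp
qed

section \<open>The graph of a representation\<close>

lemma matrix_vector_scaleR:
  fixes M :: "complex ^ 'd ^ 'd"
  shows "M *v (r *\<^sub>R w) = r *\<^sub>R (M *v w)" "(r *\<^sub>R M) *v w = r *\<^sub>R (M *v w)"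
  by (simp_all add: cart_eq_iff matrix_vector_mult_nth scaleR_sum_right)

definition block_diag :: "real ^ 'n ^ 'n \<Rightarrow> complex ^ 'd ^ 'd \<Rightarrow> ((real ^ 'n) \<times> (complex ^ 'd)) endo" where
  "block_diag A M = endo (\<lambda>p. (A *v fst p, M *v snd p))"

lemma app_block_diag [simp]: "app (block_diag A M) p = (A *v fst p, M *v snd p)"
proof -
  have "linear (\<lambda>p. (A *v fst p, M *v snd p))"
    by (simp add: linear_iff matrix_vector_right_distrib matrix_vector_scaleR matrix_vector_mult_scaleR)
  then show ?thesis by (simp add: block_diag_def app_endo_linear)
qed

lemma block_diag_mult: "block_diag A M * block_diag B N = block_diag (A ** B) (M ** N)"
  by (rule endo_eqI) (simp add: matrix_vector_mul_assoc)

lemma block_diag_one: "block_diag (mat 1) (mat 1) = 1"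
  by (rule endo_eqI) simp

lemma linear_block_diag: "linear (\<lambda>q. block_diag (fst q) (snd q))"
  unfolding linear_iff
  by (intro conjI allI; rule endo_eqI;
      simp add: matrix_vector_mult_add_rdistrib matrix_vector_scaleR flip: scaleR_matrix_vector_assoc)

lemma continuous_on_block_diag:
  "continuous_on S f \<Longrightarrow> continuous_on S h \<Longrightarrow> continuous_on S (\<lambda>x. block_diag (f x) (h x))"
  using bounded_linear.continuous_on[OF linear_block_diag[unfolded linear_conv_bounded_linear], of S "\<lambda>x. (f x, h x)"]
  by (simp add: continuous_on_Pair)

definition block1 :: "((real ^ 'n) \<times> (complex ^ 'd)) endo \<Rightarrow> real ^ 'n ^ 'n" where
  "block1 X = (\<chi> i j. fst (app X (axis j 1, 0)) $ i)"

definition block2 :: "((real ^ 'n) \<times> (complex ^ 'd)) endo \<Rightarrow> complex ^ 'd ^ 'd" where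
  "block2 X = (\<chi> i j. snd (app X (0, axis j 1)) $ i)"

lemma pr_block_diag [simp]: "block1 (block_diag A M) = A" "block2 (block_diag A M) = M"
  by (simp_all add: block1_def block2_def cart_eq_iff matrix_vector_mult_nth axis_def if_distrib cong: if_cong)

lemma linear_block2: "linear block2"
  by (simp add: linear_iff block2_def cart_eq_iff)

lemma tendsto_app_left: "(f \<longlongrightarrow> x) F \<Longrightarrow> ((\<lambda>n. app (f n) v) \<longlongrightarrow> app x v) F"
  by (rule bounded_linear.tendsto[OF bounded_bilinear.bounded_linear_left[OF bounded_bilinear_app]])

lemma tendsto_pr: "(f \<longlongrightarrow> x) F \<Longrightarrow> ((\<lambda>n. block1 (f n)) \<longlongrightarrow> block1 x) F" "(f \<longlongrightarrow> x) F \<Longrightarrow> ((\<lambda>n. block2 (f n)) \<longlongrightarrow> block2 x) F"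
  unfolding block1_def block2_def
  by (intro vec_tendstoI, simp only: vec_lambda_beta, intro tendsto_vec_nth tendsto_fst tendsto_snd tendsto_app_left, assumption)+

definition blocks :: "((real ^ 'n) \<times> (complex ^ 'd)) endo set" where
  "blocks = range (\<lambda>q. block_diag (fst q) (snd q))"

lemma subspace_blocks: "subspace blocks"
  unfolding blocks_def by (rule linear_subspace_image[OF linear_block_diag subspace_UNIV])

lemma blocksD: "X \<in> blocks \<Longrightarrow> X = block_diag (block1 X) (block2 X)"
  by (auto simp: blocks_def)

lemma block_diag_in_blocks: "block_diag A M \<in> blocks"
  unfolding blocks_def by (rule image_eqI[of _ _ "(A, M)"]) simp_all

lemma closed_blocks: "closed (blocks :: ((real ^ 'n) \<times> (complex ^ 'd)) endo set)"
  by (rule closed_subspace_endo[OF subspace_blocks])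

lemma GL_subgroupD:
  assumes "subgroup G GL"
  shows "mat 1 \<in> G" "\<And>x. x \<in> G \<Longrightarrow> invertible x" "\<And>x y. x \<in> G \<Longrightarrow> y \<in> G \<Longrightarrow> x ** y \<in> G"
    "\<And>x. x \<in> G \<Longrightarrow> \<exists>y\<in>G. x ** y = mat 1 \<and> y ** x = mat 1"
proof -
  show "mat 1 \<in> G" using subgroup.one_closed[OF assms] by (simp add: GL_def)
  show inv: "invertible x" if "x \<in> G" for x using subgroup.mem_carrier[OF assms that] by (simp add: GL_def)
  show "x ** y \<in> G" if "x \<in> G" "y \<in> G" for x y using subgroup.m_closed[OF assms that] by (simp add: GL_def)
  show "\<exists>y\<in>G. x ** y = mat 1 \<and> y ** x = mat 1" if x: "x \<in> G" for x
  proof (intro bexI conjI)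
    have c: "x \<in> carrier GL" using subgroup.mem_carrier[OF assms x] .
    show "m_inv GL x \<in> G" using subgroup.m_inv_closed[OF assms x] .
    show "x ** m_inv GL x = mat 1" "m_inv GL x ** x = mat 1"
      using group.r_inv[OF group_GL c] group.l_inv[OF group_GL c] by (simp_all add: GL_def)
  qed
qed

text \<open>
  Normality in terms of matrix products and explicit inverse matrices, without the inverse operation of the
  group record.
\<close>

lemma normal_subgroup_GLI:
  assumes G: "subgroup G GL" and H: "H \<subseteq> G" "mat 1 \<in> H" "\<And>x y. x \<in> H \<Longrightarrow> y \<in> H \<Longrightarrow> x ** y \<in> H"
    "\<And>x y. x \<in> H \<Longrightarrow> y \<in> G \<Longrightarrow> x ** y = mat 1 \<Longrightarrow> y ** x = mat 1 \<Longrightarrow> y \<in> H"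
    "\<And>x y h. h \<in> H \<Longrightarrow> x \<in> G \<Longrightarrow> y \<in> G \<Longrightarrow> x ** y = mat 1 \<Longrightarrow> y ** x = mat 1 \<Longrightarrow> x ** h ** y \<in> H"
  shows "H \<lhd> GL\<lparr>carrier := G\<rparr>"
proof -
  let ?K = "GL\<lparr>carrier := G\<rparr>"
  interpret K: group ?K by (rule subgroup.subgroup_is_group[OF G group_GL])
  have inv: "m_inv ?K x \<in> G" "x ** m_inv ?K x = mat 1" "m_inv ?K x ** x = mat 1"
    if "x \<in> G" for x
    using K.inv_closed[of x] K.r_inv[of x] K.l_inv[of x] that by (simp_all add: GL_def)
  have "subgroup H ?K"
  proof (rule K.subgroupI)
    show "H \<subseteq> carrier ?K" using H(1) by simp
    show "H \<noteq> {}" using H(2) by blast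
    show "m_inv ?K a \<in> H" if "a \<in> H" for a using H(4)[OF that inv] H(1) that by blast
    show "a \<otimes>\<^bsub>?K\<^esub> b \<in> H" if "a \<in> H" "b \<in> H" for a b using H(3)[OF that] by (simp add: GL_def)
  qed
  moreover have "\<forall>x\<in>carrier ?K. \<forall>h\<in>H. x \<otimes>\<^bsub>?K\<^esub> h \<otimes>\<^bsub>?K\<^esub> m_inv ?K x \<in> H"
    using H(5)[OF _ _ inv] by (simp add: GL_def)
  ultimately show ?thesis using K.normal_inv_iff by blast
qed

locale semisimple_representation =
  fixes G :: "(real ^ 'n ^ 'n) set"
    and \<rho> :: "real ^ 'n ^ 'n \<Rightarrow> complex ^ 'd ^ 'd"
  assumes lie_group: "matrix_lie_group G" and connected_G: "connected G"
    and semisimple: "semisimple_lie_group G" and representation: "lie_representation G \<rho>"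
begin

lemma subgroup_G: "subgroup G GL"
  using lie_group by (simp add: matrix_lie_group_def)

lemmas G_group = GL_subgroupD[OF subgroup_G]

lemma closed_G:
  assumes "\<And>n. f n \<in> G" "f \<longlonglongrightarrow> a" "invertible a"
  shows "a \<in> G"
proof -
  have "closedin (top_of_set {A. invertible A}) G"
    using lie_group by (simp add: matrix_lie_group_def GL_def)
  then obtain T where T: "closed T" "G = {A. invertible A} \<inter> T" by (auto simp: closedin_closed)
  then have "f n \<in> T" for n using assms(1)[of n] by simp
  then have "a \<in> T" using closed_sequentially[OF T(1) _ assms(2)] by blast
  then show ?thesis using T(2) assms(3) by simp
qed

lemma rho_mult: "x \<in> G \<Longrightarrow> y \<in> G \<Longrightarrow> \<rho> (x ** y) = \<rho> x ** \<rho> y"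
  using representation by (simp add: lie_representation_def hom_def GL_def)

lemma rho_one: "\<rho> (mat 1) = mat 1"
proof -
  let ?r = "\<rho> (mat 1)"
  have "?r \<in> carrier GL" using representation G_group(1) by (auto simp: lie_representation_def hom_def)
  then obtain s where s: "?r ** s = mat 1" by (auto simp: GL_def invertible_def)
  have "?r ** ?r = ?r" using rho_mult[OF G_group(1) G_group(1)] by simp
  then have "?r ** ?r ** s = ?r ** s" by simp
  then show ?thesis by (simp add: s flip: matrix_mul_assoc)
qed

lemma continuous_rho: "continuous_on G \<rho>"
  using representation by (simp add: lie_representation_def)

definition graph_pair :: "real ^ 'n ^ 'n \<Rightarrow> ((real ^ 'n) \<times> (complex ^ 'd)) endo" where
  "graph_pair A = block_diag A (\<rho> A)"

abbreviation graph where "graph \<equiv> graph_pair ` G"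

lemma graph_pair_mult: "x \<in> G \<Longrightarrow> y \<in> G \<Longrightarrow> graph_pair (x ** y) = graph_pair x * graph_pair y"
  by (simp add: graph_pair_def block_diag_mult rho_mult)

lemma graph_pair_one: "graph_pair (mat 1) = 1"
  by (simp add: graph_pair_def rho_one block_diag_one)

lemma graph_pair_inverse: "x \<in> G \<Longrightarrow> y \<in> G \<Longrightarrow> x ** y = mat 1 \<Longrightarrow> graph_pair x * graph_pair y = 1"
  by (simp add: graph_pair_one flip: graph_pair_mult)

lemma block1_graph_pair [simp]: "block1 (graph_pair x) = x" and block2_graph_pair [simp]: "block2 (graph_pair x) = \<rho> x"
  by (simp_all add: graph_pair_def)

lemma continuous_graph_pair: "continuous_on G graph_pair"
  unfolding graph_pair_def[abs_def] by (intro continuous_on_block_diag continuous_rho continuous_on_id)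

lemma graph_blocks: "X \<in> graph \<Longrightarrow> X \<in> blocks"
  by (auto simp: graph_pair_def block_diag_in_blocks)

text \<open>
  The graph is closed among invertible endomorphisms. A limit \<open>a\<close> of elements of the graph is block diagonal.
  If \<open>a\<close> is injective, its upper block is invertible and hence lies in \<open>G\<close>, and continuity of \<open>\<rho>\<close> identifies
  the lower block.
\<close>

lemma graph_limit:
  assumes f: "\<And>n. f n \<in> graph" and lim: "f \<longlonglongrightarrow> a" and ab: "b * a = 1"
  shows "a \<in> graph"
proof -
  have "a \<in> blocks" by (rule closed_sequentially[OF closed_blocks _ lim]) (use f graph_blocks in blast)
  then have a: "a = block_diag (block1 a) (block2 a)" by (rule blocksD)
  have fG: "block1 (f n) \<in> G" and f2: "block2 (f n) = \<rho> (block1 (f n))" for n using f[of n] by auto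
  have lim1: "(\<lambda>n. block1 (f n)) \<longlonglongrightarrow> block1 a" by (rule tendsto_pr(1)[OF lim])
  have inj: "v = 0" if "block1 a *v v = 0" for v
  proof -
    have "app a (v, 0) = 0" by (subst a) (simp add: that zero_prod_def)
    then have "app (b * a) (v, 0) = 0" by simp
    then show ?thesis by (simp add: ab zero_prod_def)
  qed
  then obtain B where "B ** block1 a = mat 1" using matrix_left_invertible_ker[of "block1 a"] by blast
  then have "invertible (block1 a)" using invertible_left_inverse by blast
  then have aG: "block1 a \<in> G" using closed_G[OF fG lim1] by blast
  have "(\<lambda>n. \<rho> (block1 (f n))) \<longlonglongrightarrow> \<rho> (block1 a)"
    using continuous_rho[unfolded continuous_on_sequentially] aG fG lim1 by (auto simp: o_def)
  then have "(\<lambda>n. block2 (f n)) \<longlonglongrightarrow> \<rho> (block1 a)" by (simp add: f2)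
  then have "block2 a = \<rho> (block1 a)" using tendsto_pr(2)[OF lim] LIMSEQ_unique by blast
  then have "a = graph_pair (block1 a)" using a by (simp add: graph_pair_def)
  then show ?thesis using aG by blast
qed

sublocale graph: closed_subgroup graph
proof
  show "1 \<in> graph" using graph_pair_one G_group(1) by (metis imageI)
  show "g * h \<in> graph" if "g \<in> graph" "h \<in> graph" for g h
    using that G_group(3) by (auto simp flip: graph_pair_mult)
  show "\<exists>h\<in>graph. g * h = 1 \<and> h * g = 1" if g: "g \<in> graph" for g
  proof -
    obtain x where x: "x \<in> G" "g = graph_pair x" using g by blast
    obtain y where "y \<in> G" "x ** y = mat 1" "y ** x = mat 1"
      using G_group(4)[OF x(1)] by blast
    then show ?thesis using x graph_pair_inverse by (intro bexI[of _ "graph_pair y"]) auto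
  qed
  show "a \<in> graph" if "\<And>n. f n \<in> graph" "f \<longlonglongrightarrow> a" "a * b = 1" "b * a = 1" for f a b
    by (rule graph_limit[OF that(1,2,4)])
qed

lemma connected_graph: "connected graph"
  by (rule connected_continuous_image[OF continuous_graph_pair connected_G])

lemma graph_inverse:
  assumes "x \<in> G" "y \<in> G" "x ** y = mat 1" "y ** x = mat 1"
  shows "graph_pair x * graph_pair y = 1" "graph_pair y * graph_pair x = 1"
  using assms graph_pair_inverse by blast+

text \<open>
  By \<open>exp_ad\<close> an ideal is invariant under conjugation by exponentials, and connectedness extends this to the
  whole group.
\<close>

lemma ideal_conj:
  assumes a: "subspace a" "\<And>X Y. X \<in> lie graph \<Longrightarrow> Y \<in> a \<Longrightarrow> X * Y - Y * X \<in> a"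
    and x: "x \<in> graph" "x * y = 1" "y * x = 1" and v: "v \<in> a"
  shows "x * v * y \<in> a"
proof (rule action_preserves[where act = "\<lambda>x y v. x * v * y", OF graph.closed_subgroup_axioms connected_graph
      closed_subspace_endo[OF a(1)] _ _ _ _ x v])
  show "exp X * v * exp (- X) \<in> a" if "X \<in> lie graph" "v \<in> a" for X v
    by (rule exp_ad[OF closed_subspace_endo[OF a(1)] a(1) a(2)[OF that(1)] that(2)])
qed (auto simp: mult.assoc intro!: tendsto_mult)

text \<open>
  This is where semisimplicity enters. The exponentials of an abelian ideal form a connected abelian group
  that is normal in the graph. The elements of \<open>G\<close> that its closure \<open>S\<close> lies over form a closed connected
  abelian normal subgroup \<open>H\<close> of \<open>G\<close>, which must be trivial. So all exponentials of the ideal are \<open>1\<close>.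
\<close>

lemma abelian_ideal_trivial:
  assumes a: "subspace a" "a \<subseteq> lie graph" "\<And>X Y. X \<in> lie graph \<Longrightarrow> Y \<in> a \<Longrightarrow> X * Y - Y * X \<in> a"
    and comm: "\<And>X Y. X \<in> a \<Longrightarrow> Y \<in> a \<Longrightarrow> X * Y = Y * X"
  shows "a \<subseteq> {0}"
proof -
  define S where "S = closure (exp ` a)"
  define H where "H = {A \<in> G. graph_pair A \<in> S}"
  have limS: "\<exists>X. (\<forall>n. X n \<in> a) \<and> (\<lambda>n. exp (X n)) \<longlonglongrightarrow> s" if s: "s \<in> S" for s
  proof -
    obtain f where f: "\<forall>n. f n \<in> exp ` a" "f \<longlonglongrightarrow> s" using s unfolding S_def closure_sequential by blast
    then have "\<forall>n. \<exists>X. X \<in> a \<and> f n = exp X" by blast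
    then obtain X where X: "\<And>n. X n \<in> a" "\<And>n. f n = exp (X n)" by metis
    then have "f = (\<lambda>n. exp (X n))" by auto
    then show ?thesis using f(2) X(1) by blast
  qed
  have Slim: "s \<in> S" if "\<And>n. X n \<in> a" "(\<lambda>n. exp (X n)) \<longlonglongrightarrow> s" for X s
    unfolding S_def closure_sequential using that by (intro exI[of _ "\<lambda>n. exp (X n)"]) blast
  have S_mult: "s * t \<in> S" "s * t = t * s" if st: "s \<in> S" "t \<in> S" for s t
  proof -
    obtain X Y where X: "\<And>n. X n \<in> a" "(\<lambda>n. exp (X n)) \<longlonglongrightarrow> s" and Y: "\<And>n. Y n \<in> a" "(\<lambda>n. exp (Y n)) \<longlonglongrightarrow> t"
      using limS[OF st(1)] limS[OF st(2)] by blast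
    have add: "exp (X n + Y n) = exp (X n) * exp (Y n)" "exp (X n + Y n) = exp (Y n) * exp (X n)" for n
      using exp_add_commuting[OF comm[OF X(1) Y(1)]] exp_add_commuting[OF comm[OF Y(1) X(1)], of n n]
      by (simp_all add: add.commute)
    have 1: "(\<lambda>n. exp (X n + Y n)) \<longlonglongrightarrow> s * t" unfolding add(1) by (intro tendsto_mult X Y)
    have 2: "(\<lambda>n. exp (X n + Y n)) \<longlonglongrightarrow> t * s" unfolding add(2) by (intro tendsto_mult X Y)
    show "s * t = t * s" using 1 2 LIMSEQ_unique by blast
    show "s * t \<in> S" by (rule Slim[OF _ 1]) (intro subspace_add a X Y)
  qed
  have S_one: "1 \<in> S" using closure_subset[of "exp ` a"] subspace_0[OF a(1)] unfolding S_def by (metis exp_zero imageI subsetD)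
  have S_inv: "t \<in> S" if s: "s \<in> S" and st: "s * t = 1" for s t
  proof -
    obtain X where X: "\<And>n. X n \<in> a" "(\<lambda>n. exp (X n)) \<longlonglongrightarrow> s" using limS[OF s] by blast
    have "(\<lambda>n. exp (- X n)) \<longlonglongrightarrow> t" by (rule inverse_tendsto[OF X(2) exp_inverse(2) st])
    then show ?thesis by (rule Slim[rotated]) (intro subspace_neg a X)
  qed
  have S_conj: "x * s * y \<in> S" if s: "s \<in> S" and x: "x \<in> graph" "x * y = 1" "y * x = 1" for x y s
  proof -
    obtain X where X: "\<And>n. X n \<in> a" "(\<lambda>n. exp (X n)) \<longlonglongrightarrow> s" using limS[OF s] by blast
    have "(\<lambda>n. x * exp (X n) * y) \<longlonglongrightarrow> x * s * y" by (intro tendsto_mult tendsto_const X)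
    then have "(\<lambda>n. exp (x * X n * y)) \<longlonglongrightarrow> x * s * y" by (simp add: exp_conj[OF x(2,3)])
    then show ?thesis by (rule Slim[rotated]) (rule ideal_conj[OF a(1,3) x X(1)])
  qed
  have exp_graph: "exp ` a \<subseteq> graph" using a(2) by (auto simp: lie_def dest!: subsetD spec[of _ "1::real"])
  have H: "H \<lhd> GL\<lparr>carrier := G\<rparr>"
  proof (rule normal_subgroup_GLI[OF subgroup_G])
    show "H \<subseteq> G" by (auto simp: H_def)
    show "mat 1 \<in> H" by (simp add: H_def G_group(1) graph_pair_one S_one)
    show "x ** y \<in> H" if "x \<in> H" "y \<in> H" for x y
      using that S_mult(1) by (simp add: H_def graph_pair_mult G_group(3))
    show "y \<in> H" if "x \<in> H" "y \<in> G" "x ** y = mat 1" "y ** x = mat 1" for x y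
      using that S_inv[of "graph_pair x" "graph_pair y"] graph_inverse(1)[of x y] by (simp add: H_def)
    show "x ** h ** y \<in> H" if h: "h \<in> H" and x: "x \<in> G" "y \<in> G" "x ** y = mat 1" "y ** x = mat 1" for x y h
    proof -
      have "graph_pair (x ** h ** y) = graph_pair x * graph_pair h * graph_pair y" using h x by (simp add: H_def graph_pair_mult G_group(3))
      then show ?thesis using S_conj[of "graph_pair h" "graph_pair x" "graph_pair y"] graph_inverse[OF x] h x by (simp add: H_def G_group(3))
    qed
  qed
  have "closedin (top_of_set G) H"
  proof -
    have "H = G \<inter> graph_pair -` S" by (auto simp: H_def)
    then show ?thesis using continuous_closedin_preimage[OF continuous_graph_pair, of S] by (simp add: S_def)
  qed
  moreover have "connected H"
  proof -
    have "convex a" by (rule subspace_imp_convex[OF a(1)])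
    moreover have "continuous_on a exp" unfolding continuous_on_def by (intro ballI tendsto_exp_algebra tendsto_ident_at)
    ultimately have "connected (exp ` a)" using connected_continuous_image convex_connected by blast
    then have "connected (graph \<inter> S)"
      by (rule connected_intermediate_closure) (use exp_graph closure_subset[of "exp ` a"] in \<open>auto simp: S_def\<close>)
    moreover have "continuous_on (graph \<inter> S) block1"
      unfolding continuous_on_def by (intro ballI tendsto_pr tendsto_ident_at)
    ultimately have "connected (block1 ` (graph \<inter> S))" by (rule connected_continuous_image[rotated])
    moreover have "block1 ` (graph \<inter> S) = H" by (force simp: H_def)
    ultimately show ?thesis by simp
  qed
  moreover have "solvable_lie_group H"
  proof (rule abelian_solvable)
    show "mat 1 \<in> H" by (simp add: H_def G_group(1) graph_pair_one S_one)
    fix x y assume "x \<in> H" "y \<in> H"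
    then have "graph_pair (x ** y) = graph_pair (y ** x)" using S_mult(2)[of "graph_pair x" "graph_pair y"] by (simp add: H_def graph_pair_mult)
    then show "x ** y = y ** x" by (metis block1_graph_pair)
  qed
  ultimately have H1: "H = {mat 1}"
    using semisimple H unfolding semisimple_lie_group_def by blast
  show ?thesis
  proof
    fix X assume X: "X \<in> a"
    have "exp (t *\<^sub>R X) = 1" for t
    proof -
      have tX: "exp (t *\<^sub>R X) \<in> exp ` a" using subspace_scale[OF a(1) X] by blast
      then obtain A where A: "A \<in> G" "exp (t *\<^sub>R X) = graph_pair A" using exp_graph by blast
      then have "A \<in> H" using tX closure_subset[of "exp ` a"] by (auto simp: H_def S_def)
      then show ?thesis using H1 A graph_pair_one by simp
    qed
    then show "X \<in> {0}" using exp_trivial by blast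
  qed
qed

sublocale lie_graph: semisimple_lie_algebra "lie graph"
proof
  show "subspace (lie graph)" by (rule graph.subspace_lie)
  show "bracket x y \<in> lie graph" if "x \<in> lie graph" "y \<in> lie graph" for x y by (rule graph.lie_bracket[OF that])
  show "a \<subseteq> {0}" if "subspace a" "a \<subseteq> lie graph" "\<And>x y. x \<in> lie graph \<Longrightarrow> y \<in> a \<Longrightarrow> bracket x y \<in> a"
    "\<And>x y. x \<in> a \<Longrightarrow> y \<in> a \<Longrightarrow> x * y = y * x" for a
    by (rule abelian_ideal_trivial[OF that])
qed

lemma lie_graph_blocks:
  assumes "X \<in> lie graph"
  shows "X = block_diag (block1 X) (block2 X)"
proof (rule blocksD)
  have lim: "((\<lambda>t. (exp (t *\<^sub>R X) - 1) /\<^sub>R t) \<longlongrightarrow> X) (at 0)"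
    using difference_quotient_tendsto[OF exp_has_vector_derivative_0[of X]] by simp
  have "1 \<in> blocks" using block_diag_in_blocks block_diag_one by metis
  moreover have "exp (t *\<^sub>R X) \<in> blocks" for t using assms graph_blocks by (auto simp: lie_def)
  ultimately have "(exp (t *\<^sub>R X) - 1) /\<^sub>R t \<in> blocks" for t
    by (intro subspace_scale subspace_diff subspace_blocks)
  then show "X \<in> blocks" using Lim_in_closed_set[OF closed_blocks _ _ lim] by simp
qed

text \<open>
  Differentiating \<open>\<rho> g *v w\<close> along one-parameter groups stays in the closed subspace \<open>W\<close>.
\<close>

lemma lie_graph_invariant:
  assumes W: "subspace W" "\<And>g w. g \<in> G \<Longrightarrow> w \<in> W \<Longrightarrow> \<rho> g *v w \<in> W" and X: "X \<in> lie graph" and w: "w \<in> W"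
  shows "block2 X *v w \<in> W"
proof -
  have lim: "((\<lambda>t. (exp (t *\<^sub>R X) - 1) /\<^sub>R t) \<longlongrightarrow> X) (at 0)"
    using difference_quotient_tendsto[OF exp_has_vector_derivative_0[of X]] by simp
  have lim': "((\<lambda>t. snd (app ((exp (t *\<^sub>R X) - 1) /\<^sub>R t) (0, w))) \<longlongrightarrow> snd (app X (0, w))) (at 0)"
    by (intro tendsto_snd tendsto_app_left lim)
  have "snd (app ((exp (t *\<^sub>R X) - 1) /\<^sub>R t) (0, w)) \<in> W" for t
  proof -
    obtain g where g: "g \<in> G" "exp (t *\<^sub>R X) = graph_pair g" using X by (auto simp: lie_def)
    have eq: "snd (app ((exp (t *\<^sub>R X) - 1) /\<^sub>R t) (0, w)) = (\<rho> g *v w - w) /\<^sub>R t"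
      by (simp add: g(2) graph_pair_def)
    show ?thesis unfolding eq
      by (intro subspace_scale[OF W(1)] subspace_diff[OF W(1)] W(2) g(1) w)
  qed
  then have "snd (app X (0, w)) \<in> W"
    using Lim_in_closed_set[OF closed_subspace[OF W(1)] _ _ lim'] by simp
  moreover have "snd (app X (0, w)) = block2 X *v w" by (subst lie_graph_blocks[OF X]) simp
  ultimately show ?thesis by simp
qed

text \<open>
  The converse of \<open>lie_graph_invariant\<close>, which uses connectedness. The subspace is placed in the second factor of
  \<open>\<real>\<^sup>n \<times> \<complex>\<^sup>d\<close>, where the graph acts.
\<close>

lemma group_invariant:
  assumes U: "subspace U" "\<And>X u. X \<in> lie graph \<Longrightarrow> u \<in> U \<Longrightarrow> block2 X *v u \<in> U" and g: "g \<in> G" and u: "u \<in> U"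
  shows "\<rho> g *v u \<in> U"
proof -
  define U0 where "U0 = {0 :: real ^ 'n} \<times> U"
  have sU0: "subspace U0" unfolding U0_def by (rule subspace_Times[OF subspace_single_0 U(1)])
  have cU0: "closed U0" by (rule closed_subspace[OF sU0])
  obtain h where h: "h \<in> G" "g ** h = mat 1" "h ** g = mat 1"
    using G_group(4)[OF g] by blast
  have "app (graph_pair g) (0, u) \<in> U0"
  proof (rule action_preserves[where act = "\<lambda>x y v. app x v", OF graph.closed_subgroup_axioms connected_graph cU0 _ _ _ _ imageI[OF g] graph_inverse[OF g h]])
    show "(\<lambda>n. app (X n) v) \<longlonglongrightarrow> app x v" if "X \<longlonglongrightarrow> x" for X x v by (rule tendsto_app_left[OF that])
    show "app (exp X) v \<in> U0" if X: "X \<in> lie graph" and v: "v \<in> U0" for X v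
    proof (rule subspace_exp[OF cU0 sU0 _ v])
      fix v assume "v \<in> U0"
      then have "fst v = 0" and U': "snd v \<in> U" by (auto simp: U0_def)
      then have "app X v = (0, block2 X *v snd v)" by (subst lie_graph_blocks[OF X]) simp
      with U' show "app X v \<in> U0" using U(2)[OF X] by (simp add: U0_def)
    qed
    show "(0, u) \<in> U0" using u by (simp add: U0_def)
  qed simp_all
  then show ?thesis by (simp add: graph_pair_def U0_def)
qed

lemma block2_mult: "X \<in> lie graph \<Longrightarrow> Y \<in> lie graph \<Longrightarrow> block2 (X * Y) = block2 X ** block2 Y"
  by (metis lie_graph_blocks block_diag_mult pr_block_diag(2))

end

section \<open>Complete reducibility\<close>

lemma projection_matrix:
  fixes W :: "(complex ^ 'd) set"
  assumes "vec.subspace W"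
  obtains p :: "complex ^ 'd ^ 'd" where "\<And>v. p *v v \<in> W" "\<And>w. w \<in> W \<Longrightarrow> p *v w = w"
proof -
  have "Vector_Spaces.linear (*s) (*s) (id :: complex ^ 'd \<Rightarrow> _)" by (rule vec.linear_id)
  from vec.linear_exists_left_inverse_on[OF this assms] obtain f where
    f: "f ` UNIV \<subseteq> W" "Vector_Spaces.linear (*s) (*s) f" "\<forall>v\<in>W. f (id v) = v" by auto
  show thesis
  proof (rule that[of "matrix f"])
    show "matrix f *v v \<in> W" for v using f(1) by (auto simp: matrix_works[OF f(2)])
    show "matrix f *v w = w" if "w \<in> W" for w using f(3) that by (simp add: matrix_works[OF f(2)])
  qed
qed

lemma matrix_mult_scaleR:
  fixes A B C :: "complex ^ 'd ^ 'd"
  shows "(r *\<^sub>R A) ** B = r *\<^sub>R (A ** B)" "A ** (r *\<^sub>R B) = r *\<^sub>R (A ** B)"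
  by (simp_all add: cart_eq_iff matrix_mult_nth scaleR_sum_right)

lemma vec_subspace_imp_subspace:
  fixes W :: "(complex ^ 'd) set"
  assumes "vec.subspace W"
  shows "subspace W"
proof (rule subspaceI)
  show "0 \<in> W" by (rule vec.subspace_0[OF assms])
  show "x + y \<in> W" if "x \<in> W" "y \<in> W" for x y by (rule vec.subspace_add[OF assms that])
  show "c *\<^sub>R x \<in> W" if "x \<in> W" for c x
  proof -
    have "c *\<^sub>R x = complex_of_real c *s x" by (simp add: cart_eq_iff complex_eq_iff)
    then show ?thesis using vec.subspace_scale[OF assms that] by simp
  qed
qed

theorem theorem3p5:
  fixes G :: "(real ^ 'n ^ 'n) set"
    and \<rho> :: "real ^ 'n ^ 'n \<Rightarrow> complex ^ 'd ^ 'd"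
    and W :: "(complex ^ 'd) set"
  assumes "matrix_lie_group G"
    and "connected G"
    and "semisimple_lie_group G"
    and "lie_representation G \<rho>"
    and "invariant_subspace G \<rho> W"
  shows "\<exists>U. invariant_subspace G \<rho> U \<and> complementary W U"
proof -
  interpret semisimple_representation G \<rho> by unfold_locales (rule assms)+
  note mm = matrix_mult_distribs matrix_mult_scaleR
  have W: "vec.subspace W" "\<And>g w. g \<in> G \<Longrightarrow> w \<in> W \<Longrightarrow> \<rho> g *v w \<in> W"
    using assms(5) by (auto simp: invariant_subspace_def)
  obtain p :: "complex ^ 'd ^ 'd" where p: "\<And>v. p *v v \<in> W" "\<And>w. w \<in> W \<Longrightarrow> p *v w = w"
    using projection_matrix[OF W(1)] by blast
  define one :: "complex ^ 'd ^ 'd" where "one = mat 1"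
  have one: "one ** A = A" "A ** one = A" "one *v v = v" for A v by (simp_all add: one_def)
  have pp: "p ** p = p"
    unfolding matrix_eq by (simp add: p flip: matrix_vector_mul_assoc)
  \<comment> \<open>A projection onto the maps with values in \<open>W\<close> that vanish on \<open>W\<close>. It need not be equivariant, but
    the Lie algebra preserves its range, so composing with it yields a representation on all matrices.\<close>
  define q where "q \<phi> = p ** \<phi> ** (one - p)" for \<phi>
  have \<pi>p: "p ** block2 X ** p = block2 X ** p" if X: "X \<in> lie graph" for X
    unfolding matrix_eq
    using p lie_graph_invariant[OF vec_subspace_imp_subspace[OF W(1)] W(2) X]
    by (simp flip: matrix_vector_mul_assoc)
  define \<tau> where "\<tau> X = endo (\<lambda>\<phi>. block2 X ** q \<phi> - q \<phi> ** block2 X)" for X :: "((real ^ 'n) \<times> (complex ^ 'd)) endo"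
  define f where "f X = block2 X ** p - p ** block2 X" for X :: "((real ^ 'n) \<times> (complex ^ 'd)) endo"
  have lq: "q (x + y) = q x + q y" "q (x - y) = q x - q y" "q (c *\<^sub>R x) = c *\<^sub>R q x" for x y c
    by (simp_all add: q_def mm scaleR_diff_right)
  have \<tau>: "app (\<tau> X) \<phi> = block2 X ** q \<phi> - q \<phi> ** block2 X" for X \<phi>
    unfolding \<tau>_def by (subst app_endo_linear) (simp_all add: linear_iff lq mm algebra_simps scaleR_diff_right)
  note l2 = linear_add[OF linear_block2] linear_scale[OF linear_block2] linear_diff[OF linear_block2]
  have qf: "q (f X) = f X" if X: "X \<in> lie graph" for X
  proof -
    have F: "f X = p ** block2 X ** p - p ** block2 X" unfolding f_def \<pi>p[OF X] ..
    have "A ** p ** p = A ** p" for A by (simp add: pp flip: matrix_mul_assoc)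
    then have "f X ** p = 0" by (simp add: F mm)
    moreover have "p ** f X = f X" by (simp add: F mm matrix_mul_assoc pp)
    ultimately show ?thesis by (simp add: q_def mm one)
  qed
  have q\<tau>: "q (block2 X ** q \<phi> - q \<phi> ** block2 X) = block2 X ** q \<phi> - q \<phi> ** block2 X" if X: "X \<in> lie graph" for X \<phi>
  proof -
    have 1: "(one - p) ** (one - p) = one - p" by (simp add: mm one pp)
    have 2: "(one - p) ** block2 X ** (one - p) = (one - p) ** block2 X"
      using \<pi>p[OF X] by (simp add: mm one)
    have "q (block2 X ** q \<phi>) = (p ** block2 X ** p) ** \<phi> ** ((one - p) ** (one - p))"
      by (simp add: q_def matrix_mul_assoc)
    also have "\<dots> = block2 X ** q \<phi>" unfolding 1 \<pi>p[OF X] by (simp add: q_def matrix_mul_assoc)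
    finally have 3: "q (block2 X ** q \<phi>) = block2 X ** q \<phi>" .
    have "q (q \<phi> ** block2 X) = (p ** p) ** \<phi> ** ((one - p) ** block2 X ** (one - p))"
      by (simp add: q_def matrix_mul_assoc)
    also have "\<dots> = q \<phi> ** block2 X" unfolding 2 pp by (simp add: q_def matrix_mul_assoc)
    finally show ?thesis by (simp add: lq 3)
  qed
  define lm where "lm A B = A ** B - B ** A" for A B :: "complex ^ 'd ^ 'd"
  have "\<exists>m. \<forall>X\<in>lie graph. f X = app (\<tau> X) m"
  proof (rule lie_graph.cocycle_is_coboundary)
    show "linear \<tau>"
      unfolding linear_iff by (intro conjI allI; rule endo_eqI; simp add: \<tau> l2 mm algebra_simps scaleR_diff_right)
    show "linear f"
      by (simp add: linear_iff f_def l2 mm algebra_simps scaleR_diff_right)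
    fix X Y assume X: "X \<in> lie graph" and Y: "Y \<in> lie graph"
    have br: "block2 (bracket X Y) = block2 X ** block2 Y - block2 Y ** block2 X" by (simp add: l2 block2_mult X Y)
    show "\<tau> (bracket X Y) = bracket (\<tau> X) (\<tau> Y)"
    proof (rule endo_eqI)
      fix \<phi>
      have "app (bracket (\<tau> X) (\<tau> Y)) \<phi> = app (\<tau> X) (app (\<tau> Y) \<phi>) - app (\<tau> Y) (app (\<tau> X) \<phi>)" by simp
      also have "\<dots> = lm (block2 X) (lm (block2 Y) (q \<phi>)) - lm (block2 Y) (lm (block2 X) (q \<phi>))"
        unfolding \<tau> q\<tau>[OF X] q\<tau>[OF Y] lm_def ..
      also have "\<dots> = app (\<tau> (bracket X Y)) \<phi>"
        by (simp add: \<tau> br lm_def mm matrix_mul_assoc)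
      finally show "app (\<tau> (bracket X Y)) \<phi> = app (bracket (\<tau> X) (\<tau> Y)) \<phi>" ..
    qed
    show "f (bracket X Y) = app (\<tau> X) (f Y) - app (\<tau> Y) (f X)"
      unfolding \<tau> qf[OF X] qf[OF Y] by (simp add: f_def br mm) (simp add: matrix_mul_assoc)
  qed
  then obtain m where m: "\<And>X. X \<in> lie graph \<Longrightarrow> f X = block2 X ** q m - q m ** block2 X" by (auto simp: \<tau>)
  \<comment> \<open>It agrees with \<open>p\<close> on \<open>W\<close>, because \<open>q m\<close> vanishes there, and by the choice of \<open>m\<close> it commutes with the Lie algebra.\<close>
  define p' where "p' = p - q m"
  have comm: "block2 X ** p' = p' ** block2 X" if "X \<in> lie graph" for X
    using m[OF that] by (simp add: p'_def f_def mm algebra_simps)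
  have p'W: "p' *v v \<in> W" for v
  proof -
    have "p' *v v = p *v v - p *v (m *v ((one - p) *v v))"
      by (simp add: p'_def q_def matrix_vector_mult_diff_rdistrib flip: matrix_vector_mul_assoc)
    then show ?thesis using vec.subspace_diff[OF W(1) p(1) p(1)] by simp
  qed
  have p'w: "p' *v w = w" if w: "w \<in> W" for w
  proof -
    have "(one - p) *v w = 0" by (simp add: matrix_vector_mult_diff_rdistrib one p(2)[OF w])
    then have "q m *v w = 0" by (simp add: q_def flip: matrix_vector_mul_assoc)
    then show ?thesis by (simp add: p'_def matrix_vector_mult_diff_rdistrib p(2)[OF w])
  qed
  define U where "U = {v. p' *v v = 0}"
  have U: "vec.subspace U"
    unfolding U_def by (rule vec.subspaceI) (simp_all add: matrix_vector_right_distrib vector_scalar_commute)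
  have "block2 X *v u \<in> U" if "X \<in> lie graph" "u \<in> U" for X u
    using comm[OF that(1)] that(2) unfolding U_def by (metis (mono_tags, lifting) matrix_vector_mul_assoc matrix_vector_mult_0_right mem_Collect_eq)
  then have "\<rho> g *v u \<in> U" if "g \<in> G" "u \<in> U" for g u
    using group_invariant[OF vec_subspace_imp_subspace[OF U] _ that] by blast
  then have "invariant_subspace G \<rho> U" using U by (simp add: invariant_subspace_def)
  moreover have "complementary W U"
    unfolding complementary_def
  proof (intro conjI allI)
    show "W \<inter> U = {0}"
      using p'w vec.subspace_0[OF W(1)] vec.subspace_0[OF U] by (auto simp: U_def)
    fix v
    have "p' *v (v - p' *v v) = 0" using p'w[OF p'W[of v]] by (simp add: matrix_vector_mult_diff_distrib)
    then have "v - p' *v v \<in> U" by (simp add: U_def)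
    moreover have "v = p' *v v + (v - p' *v v)" by simp
    ultimately show "\<exists>u\<in>W. \<exists>w\<in>U. v = u + w" using p'W by blast
  qed
  ultimately show ?thesis by blast
qed

end
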